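(* Assume the setting fixed in the context, and let $(\varepsilon_n)_{n\in\mathbb{N}}\subseteq(0,\tau]$ and $(\delta_n)_{n\in\mathbb{N}}\subseteq\mathbb{R}$ be sequences with $\limsup_{n\to\infty}\delta_n\leq 0$. Then there exist a function $\psi\in C^\infty(\mathbb{R},\mathbb{R})$, a real number $c\in(0,\infty)$, a measurable function $\Phi\colon C([0,T],\mathbb{R})\to\mathbb{R}$, and a continuous $\mathbb{F}$-adapted stochastic process $Z\colon[0,T]\times\Omega\to\mathbb{R}$ such that for all $n\in\mathbb{N}$, $t\in[0,T]$ it holds that $$\mathbb{P}\big(Z_T=\Phi((W_s)_{s\in[0,T]})\big)=1,\qquad \mathbb{P}\Big(X^{\psi,(1)}_t=\int_0^t f\big(\tfrac{Z_s}{c}\big)\,dW_s\Big)=1,$$ $$\mathbb{P}\Big(Z_t=\int_0^t c+c\,g\big(\tfrac{Z_s}{c}\big)\big[\cos(\psi(X^{\psi,(1)}_s))+1\big]\,ds\Big)=1,$$ and $$\inf_{\substack{a,b\in[0,\tau],\\ b-a\geq\varepsilon_n}}\ \inf_{\substack{u\colon C([0,a]\cup[b,T],\mathbb{R})\to\mathbb{R}\\ \text{measurable}}}\mathbb{E}\Big[\big|Z_T-u\big((W_s)_{s\in[0,a]\cup[b,T]}\big)\big|\Big]\geq\delta_n .$$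
   Context: Setting: Let $T\in(0,\infty)$, $\tau\in(0,T)$, $\tau_1\in(\tau,T)$, $\tau_2\in(\tau_1,T)$, $\alpha\in[\frac{2\tau^3}{3},\infty)$, and $f,g\in C^\infty(\mathbb{R},\mathbb{R})$ satisfy $\sup_{x\in\mathbb{R}}(|f(x)|+|g(x)|)<\infty$, $f((-\infty,\tau_1))\subseteq(0,\infty)$, $f([\tau_1,\infty))=\{0\}$, $f'(\mathbb{R})\subseteq[-2,0]$, $f'((0,\tau))\subseteq[-2,-1)$, $g((-\infty,\tau_1])=\{0\}$, $g([\tau_2,\infty))=\{4\}$, $g'(\mathbb{R})\subseteq[0,\infty)$, and $\alpha=\int_0^{\tau_1}|f(s)|^2\,ds$. Let $(\Omega,\mathcal{F},\mathbb{P})$ be a probability space with a normal filtration $\mathbb{F}=(\mathbb{F}_t)_{t\in[0,T]}$, let $W\colon[0,T]\times\Omega\to\mathbb{R}$ be a standard $(\Omega,\mathcal{F},\mathbb{P},\mathbb{F})$-Brownian motion, and for every $\psi\in C^\infty(\mathbb{R},\mathbb{R})$ let $X^{\psi,(1)},X^{\psi,(2)}\colon[0,T]\times\Omega\to\mathbb{R}$ be continuous $\mathbb{F}$-adapted stochastic processes which satisfy for all $t\in[0,T]$ that $\mathbb{P}\big(X^{\psi,(1)}_t=\int_0^t f(X^{\psi,(2)}_s)\,dW_s\big)=1$ and $\mathbb{P}\big(X^{\psi,(2)}_t=t+\int_0^t g(X^{\psi,(2)}_s)[\cos(\psi(X^{\psi,(1)}_s))+1]\,ds\big)=1$. Conventions: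 $\mathbb{N}=\{1,2,\ldots\}$. A normal filtration is a right-continuous filtration such that $\mathbb{F}_0$ contains all $\mathbb{P}$-null sets of $\mathcal{F}$. A standard $(\Omega,\mathcal{F},\mathbb{P},\mathbb{F})$-Brownian motion is a Brownian motion with continuous sample paths started at $0$, adapted to $\mathbb{F}$, whose increments $W_t-W_s$, $s\le t$, are independent of $\mathbb{F}_s$. $C(K,\mathbb{R})$ (for compact $K\subseteq\mathbb{R}$) is the space of continuous real functions on $K$ with the supremum norm; measurability is with respect to Borel sigma-algebras. *)

theory Defs
  imports "HOL-Probability.Probability"
begin

definition smooth :: "(real \<Rightarrow> real) \<Rightarrow> bool" where
  "smooth f \<longleftrightarrow> (\<forall>n. (deriv ^^ n) f differentiable_on UNIV)"

text \<open>
  Processes and filtrations are indexed by the type \<^typ>\<open>real\<close>, but only the indices in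
  \<open>{0..T}\<close> are ever constrained or used.
\<close>

definition normal_filtration :: "'a measure \<Rightarrow> real \<Rightarrow> (real \<Rightarrow> 'a measure) \<Rightarrow> bool" where
  "normal_filtration M T F \<longleftrightarrow>
     (\<forall>t\<in>{0..T}. subalgebra M (F t)) \<and>
     (\<forall>s\<in>{0..T}. \<forall>t\<in>{s..T}. sets (F s) \<subseteq> sets (F t)) \<and>
     (\<forall>t\<in>{0..<T}. sets (F t) = (\<Inter>s\<in>{t<..T}. sets (F s))) \<and>
     null_sets M \<subseteq> sets (F 0)"

definition continuous_adapted ::
  "'a measure \<Rightarrow> real \<Rightarrow> (real \<Rightarrow> 'a measure) \<Rightarrow> (real \<Rightarrow> 'a \<Rightarrow> real) \<Rightarrow> bool" where
  "continuous_adapted M T F X \<longleftrightarrow>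
     (\<forall>\<omega>\<in>space M. continuous_on {0..T} (\<lambda>t. X t \<omega>)) \<and>
     (\<forall>t\<in>{0..T}. X t \<in> borel_measurable (F t))"

definition standard_brownian_motion ::
  "'a measure \<Rightarrow> real \<Rightarrow> (real \<Rightarrow> 'a measure) \<Rightarrow> (real \<Rightarrow> 'a \<Rightarrow> real) \<Rightarrow> bool" where
  "standard_brownian_motion M T F W \<longleftrightarrow>
     continuous_adapted M T F W \<and>
     (\<forall>\<omega>\<in>space M. W 0 \<omega> = 0) \<and>
     (\<forall>s t. 0 \<le> s \<and> s < t \<and> t \<le> T \<longrightarrow>
        distributed M lborel (\<lambda>\<omega>. W t \<omega> - W s \<omega>) (normal_density 0 (sqrt (t - s))) \<and>
        prob_space.indep_set M (sets (F s))
          {(\<lambda>\<omega>. W t \<omega> - W s \<omega>) -` A \<inter> space M | A. A \<in> sets borel})"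

text \<open>
  The stochastic integral over \<open>{0..t}\<close>, by the usual \<open>L\<^sup>2\<close> construction. An elementary
  integrand is \<open>\<Sum>i<N. \<xi>\<^sub>i 1\<^bsub>(p\<^sub>i, p\<^sub>i\<^sub>+\<^sub>1]\<^esub>\<close> with bounded coefficients, each
  \<open>\<xi>\<^sub>i\<close> being measurable with respect to the sigma-algebra at time \<open>p\<^sub>i\<close>.
\<close>

definition elementary_integrand ::
  "'a measure \<Rightarrow> (real \<Rightarrow> 'a measure) \<Rightarrow> real \<Rightarrow> nat \<Rightarrow> (nat \<Rightarrow> real) \<Rightarrow> (nat \<Rightarrow> 'a \<Rightarrow> real) \<Rightarrow> bool"
where
  "elementary_integrand M F t N p \<xi> \<longleftrightarrow>
     0 \<le> p 0 \<and> p N \<le> t \<and> (\<forall>i<N. p i \<le> p (Suc i)) \<and>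
     (\<forall>i<N. \<xi> i \<in> borel_measurable (F (p i))) \<and>
     (\<exists>C. \<forall>i<N. \<forall>\<omega>\<in>space M. \<bar>\<xi> i \<omega>\<bar> \<le> C)"

definition elementary_process ::
  "nat \<Rightarrow> (nat \<Rightarrow> real) \<Rightarrow> (nat \<Rightarrow> 'a \<Rightarrow> real) \<Rightarrow> real \<Rightarrow> 'a \<Rightarrow> real" where
  "elementary_process N p \<xi> s \<omega> = (\<Sum>i<N. \<xi> i \<omega> * indicator {p i<..p (Suc i)} s)"

definition elementary_ito_integral ::
  "(real \<Rightarrow> 'a \<Rightarrow> real) \<Rightarrow> nat \<Rightarrow> (nat \<Rightarrow> real) \<Rightarrow> (nat \<Rightarrow> 'a \<Rightarrow> real) \<Rightarrow> 'a \<Rightarrow> real" where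
  "elementary_ito_integral W N p \<xi> \<omega> = (\<Sum>i<N. \<xi> i \<omega> * (W (p (Suc i)) \<omega> - W (p i) \<omega>))"

definition progressively_measurable ::
  "(real \<Rightarrow> 'a measure) \<Rightarrow> real \<Rightarrow> (real \<Rightarrow> 'a \<Rightarrow> real) \<Rightarrow> bool" where
  "progressively_measurable F t H \<longleftrightarrow>
     (\<forall>s\<in>{0..t}. (\<lambda>(r, \<omega>). H r \<omega>) \<in>
        borel_measurable (restrict_space borel {0..s} \<Otimes>\<^sub>M F s))"

text \<open>
  \<open>has_ito_integral M F W t H I\<close>: the random variable \<open>I\<close> is a version of the Ito integral of
  \<open>H\<close> with respect to \<open>W\<close> over \<open>{0..t}\<close>. As Ito integrals are only defined up to null sets,
  this is a relation, and \<open>I\<close> is determined by it almost surely. Square-integrable integrands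
  are all that is needed for bounded coefficients.
\<close>

definition has_ito_integral ::
  "'a measure \<Rightarrow> (real \<Rightarrow> 'a measure) \<Rightarrow> (real \<Rightarrow> 'a \<Rightarrow> real) \<Rightarrow> real \<Rightarrow>
    (real \<Rightarrow> 'a \<Rightarrow> real) \<Rightarrow> ('a \<Rightarrow> real) \<Rightarrow> bool" where
  "has_ito_integral M F W t H I \<longleftrightarrow>
     progressively_measurable F t H \<and> I \<in> borel_measurable M \<and>
     (\<exists>N p \<xi>.
        (\<forall>k. elementary_integrand M F t (N k) (p k) (\<xi> k)) \<and>
        (\<lambda>k. \<integral>\<^sup>+\<omega>. (\<integral>\<^sup>+s\<in>{0..t}.
             ennreal ((H s \<omega> - elementary_process (N k) (p k) (\<xi> k) s \<omega>)\<^sup>2) \<partial>lborel) \<partial>M)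
          \<longlonglongrightarrow> 0 \<and>
        (\<lambda>k. \<integral>\<^sup>+\<omega>. ennreal ((I \<omega> - elementary_ito_integral W (N k) (p k) (\<xi> k) \<omega>)\<^sup>2) \<partial>M)
          \<longlonglongrightarrow> 0)"

text \<open>
  The Borel sigma-algebra of \<open>C(K,\<real>)\<close> with the supremum metric. Elements of
  \<^const>\<open>cfunspace\<close> are extensional, so the path of \<open>W\<close> over \<open>K\<close> is \<open>\<lambda>s\<in>K. W s \<omega>\<close>.
\<close>

definition C_borel :: "real set \<Rightarrow> (real \<Rightarrow> real) measure" where
  "C_borel K = sigma (mspace (cfunspace (top_of_set K) euclidean_metric))
     {U. openin (mtopology_of (cfunspace (top_of_set K) euclidean_metric)) U}"

end

theory Submission
  imports Defs
begin

text \<open>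
  Up to time \<open>\<tau>1\<close> the second component of the system is the identity, because \<open>g\<close> vanishes
  on \<open>{..\<tau>1}\<close>. Hence the first component at time \<open>\<tau>1\<close> is \<open>J\<close>, the Wiener integral of the
  deterministic function \<open>f\<close> over \<open>{0..\<tau>1}\<close>, and it stays there, because \<open>f\<close> vanishes on
  \<open>{\<tau>1..}\<close>. After
  \<open>\<tau>1\<close> the second component therefore moves with speed \<open>1 + g x * v\<close>, where
  \<open>v = 1 + cos (\<psi> J)\<close> is frozen. Its value at time \<open>T\<close> is a function \<open>arrival v\<close> that expands
  distances up to a constant (\<open>arrival_expansion\<close>). So \<open>Z = c * X2\<close> has the terminal value
  \<open>c * arrival (1 + cos (\<psi> J))\<close>, and \<open>\<psi>\<close> has to oscillate so fast that \<open>cos (\<psi> J)\<close> cannot be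
  predicted from the path on \<open>{0..a} \<union> {b..T}\<close>.

  The lower bound rests on a symmetry. Exchange the increments of the Brownian path over the two
  halves of \<open>{a..b}\<close>. The new path has the same law and agrees with the old one on the observed
  set. A predictor hence errs as much on the noise \<open>J'\<close> of the new path as on \<open>J\<close>, so its mean
  error on \<open>k J\<close>, for any function \<open>k\<close>, is at least half the mean of \<open>\<bar>k J - k J'\<bar>\<close> (\<open>swap_prediction_error\<close>).

  Write \<open>J = S - D\<close> and \<open>J' = S + D\<close>. Where \<open>\<psi>\<close> is affine with slope \<open>l\<close>, the two cosines differ
  by \<open>2 * sin (l * S + c) * sin (l * D)\<close>. The variable \<open>D\<close> is a limit of Gaussian sums whose
  variance is of order \<open>(b - a)^3\<close>, because \<open>f'\<close> is between \<open>-2\<close> and \<open>-1\<close> on \<open>{0<..<\<tau>}\<close>. So the mean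
  of \<open>sin (l * D)\<close> squared is bounded below as soon as \<open>l\<^sup>2 * ((b - a) / 2)^3\<close> is at least \<open>1\<close>.
  The variable \<open>S\<close> contains the noise collected over \<open>{\<tau>..\<tau>1}\<close>, which is Gaussian, independent
  of everything that happens before \<open>\<tau>\<close>, and has a variance that depends on \<open>f\<close> alone. It
  therefore hits a window at \<open>u\<close> with a probability that is bounded below independently of \<open>l\<close>,
  \<open>a\<close> and \<open>b\<close>. Together this gives a lower bound \<open>\<rho> u\<close> for the mean error
  (\<open>prediction_lower_bound\<close>).

  Finally, \<open>\<psi>\<close> is made affine on infinitely many windows, with slopes that may grow as fast as
  desired (\<open>smooth_affine_pieces\<close>). Since the limit superior of \<open>\<delta>\<close> is not positive, the windows
  can be assigned to the indices \<open>n\<close> so slowly that the bound of the window still dominates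
  \<open>\<delta> n\<close>, while the slope on that window is large enough for \<open>\<epsilon> n\<close> (\<open>choose_scales\<close>).
\<close>

section \<open>Increments of a Brownian motion\<close>

locale brownian_setting = prob_space M for M :: "'a measure" +
  fixes T :: real and F :: "real \<Rightarrow> 'a measure" and W :: "real \<Rightarrow> 'a \<Rightarrow> real"
  assumes T_pos: "0 < T"
    and filtration: "normal_filtration M T F"
    and brownian: "standard_brownian_motion M T F W"
begin

lemma subalgebra_F: "t \<in> {0..T} \<Longrightarrow> subalgebra M (F t)"
  using filtration by (auto simp: normal_filtration_def)

lemma space_F [simp]: "t \<in> {0..T} \<Longrightarrow> space (F t) = space M"
  using subalgebra_F by (auto simp: subalgebra_def)

lemma sets_F_mono: "0 \<le> s \<Longrightarrow> s \<le> t \<Longrightarrow> t \<le> T \<Longrightarrow> sets (F s) \<subseteq> sets (F t)"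
  using filtration by (auto simp: normal_filtration_def)

lemma measurable_F_mono:
  assumes "Z \<in> measurable (F s) N" "0 \<le> s" "s \<le> t" "t \<le> T"
  shows "Z \<in> measurable (F t) N"
proof -
  have "subalgebra (F t) (F s)"
    using assms sets_F_mono[of s t] by (simp add: subalgebra_def)
  then show ?thesis
    using assms(1) measurable_from_subalg by blast
qed

lemma measurable_F_M: "Z \<in> measurable (F t) N \<Longrightarrow> t \<in> {0..T} \<Longrightarrow> Z \<in> measurable M N"
  using measurable_from_subalg subalgebra_F by blast

lemma W_measurable_F: "0 \<le> s \<Longrightarrow> s \<le> t \<Longrightarrow> t \<le> T \<Longrightarrow> W s \<in> borel_measurable (F t)"
  using brownian measurable_F_mono[of "W s" s borel t]
  by (auto simp: standard_brownian_motion_def continuous_adapted_def)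

lemma W_measurable [measurable]: "s \<in> {0..T} \<Longrightarrow> W s \<in> borel_measurable M"
  using W_measurable_F[of s s] measurable_F_M by auto

lemma W_continuous: "\<omega> \<in> space M \<Longrightarrow> continuous_on {0..T} (\<lambda>s. W s \<omega>)"
  using brownian by (auto simp: standard_brownian_motion_def continuous_adapted_def)

lemma W_0: "\<omega> \<in> space M \<Longrightarrow> W 0 \<omega> = 0"
  using brownian by (auto simp: standard_brownian_motion_def)

lemma increment_distributed:
  "0 \<le> s \<Longrightarrow> s < t \<Longrightarrow> t \<le> T \<Longrightarrow>
    distributed M lborel (\<lambda>\<omega>. W t \<omega> - W s \<omega>) (normal_density 0 (sqrt (t - s)))"
  using brownian by (auto simp: standard_brownian_motion_def)

lemma increment_indep_event:
  assumes "0 \<le> s" "s \<le> t" "t \<le> T" "A \<in> sets (F s)" "B \<in> sets borel"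
  shows "prob (A \<inter> ((\<lambda>\<omega>. W t \<omega> - W s \<omega>) -` B \<inter> space M)) =
    prob A * prob ((\<lambda>\<omega>. W t \<omega> - W s \<omega>) -` B \<inter> space M)"
proof (cases "s = t")
  case True
  have "A \<subseteq> space M" using assms sets.sets_into_space[of A "F s"] by simp
  then show ?thesis using True by (cases "0 \<in> B") (auto simp: prob_space Int_absorb2)
next
  case False
  then have "indep_set (sets (F s)) {(\<lambda>\<omega>. W t \<omega> - W s \<omega>) -` A \<inter> space M | A. A \<in> sets borel}"
    using brownian assms by (auto simp: standard_brownian_motion_def)
  then show ?thesis
    using assms unfolding indep_sets2_eq by blast
qed

text \<open>
  The predicate \<open>indep_var\<close> relates variables with values in one and the same type. The map \<open>k\<close> carries the real increment into the value type of \<open>Z\<close>, for instance into \<open>complex\<close>.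
\<close>
lemma indep_var_increment:
  assumes s: "0 \<le> s" "s \<le> t" "t \<le> T"
    and Z: "Z \<in> measurable (F s) N" and k: "k \<in> measurable borel N'"
  shows "indep_var N Z N' (\<lambda>\<omega>. k (W t \<omega> - W s \<omega>))"
  unfolding indep_var_eq
proof safe
  let ?D = "{(\<lambda>\<omega>. W t \<omega> - W s \<omega>) -` A \<inter> space M |A. A \<in> sets borel}"
  let ?Z = "sigma_sets (space M) {Z -` A \<inter> space M |A. A \<in> sets N}"
  let ?K = "sigma_sets (space M) {(\<lambda>\<omega>. k (W t \<omega> - W s \<omega>)) -` A \<inter> space M |A. A \<in> sets N'}"
  show "Z \<in> measurable M N" using measurable_F_M[OF Z] s by simp
  have D: "random_variable borel (\<lambda>\<omega>. W t \<omega> - W s \<omega>)" using s by simp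
  then show "random_variable N' (\<lambda>\<omega>. k (W t \<omega> - W s \<omega>))" using measurable_compose[OF D k] by simp
  have 1: "sets (F s) \<subseteq> events"
    using s subalgebra_F[of s] by (auto simp: subalgebra_def)
  have "{Z -` A \<inter> space M |A. A \<in> sets N} \<subseteq> sets (F s)"
    using measurable_sets[OF Z] s by auto
  then have 2: "?Z \<subseteq> sets (F s)"
    using sets.sigma_sets_subset[of _ "F s"] s by simp
  have sD: "sigma_sets (space M) ?D = ?D"
    using sets_vimage_algebra2[of "\<lambda>\<omega>. W t \<omega> - W s \<omega>" "space M" borel]
    by (simp add: sets_vimage_algebra)
  have "{(\<lambda>\<omega>. k (W t \<omega> - W s \<omega>)) -` A \<inter> space M |A. A \<in> sets N'} \<subseteq> ?D"
  proof safe
    fix A assume "A \<in> sets N'"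
    then have "k -` A \<in> sets borel" using measurable_sets[OF k] by simp
    then show "\<exists>B. (\<lambda>\<omega>. k (W t \<omega> - W s \<omega>)) -` A \<inter> space M
        = (\<lambda>\<omega>. W t \<omega> - W s \<omega>) -` B \<inter> space M \<and> B \<in> sets borel"
      by (intro exI[of _ "k -` A"]) auto
  qed
  then have 3: "?K \<subseteq> ?D"
    by (subst sD[symmetric]) (rule sigma_sets_mono')
  have 4: "?D \<subseteq> events"
    using measurable_sets[OF D] by auto
  show "indep_set ?Z ?K"
  proof (rule indep_sets2_eq[THEN iffD2], intro conjI ballI)
    fix A B assume A: "A \<in> ?Z" and "B \<in> ?K"
    then obtain C where C: "C \<in> sets borel" "B = (\<lambda>\<omega>. W t \<omega> - W s \<omega>) -` C \<inter> space M"
      using 3 by blast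
    have "A \<in> sets (F s)" using A 2 by (rule subsetD[rotated])
    then show "prob (A \<inter> B) = prob A * prob B"
      unfolding C(2) by (rule increment_indep_event[OF s _ C(1)])
  qed (rule subset_trans[OF 2 1], rule subset_trans[OF 3 4])
qed

lemma
  assumes s: "0 \<le> s" "s \<le> t" "t \<le> T"
  shows increment_integrable: "integrable M (\<lambda>\<omega>. W t \<omega> - W s \<omega>)"
    and increment_mean: "expectation (\<lambda>\<omega>. W t \<omega> - W s \<omega>) = 0"
    and increment_square_integrable: "integrable M (\<lambda>\<omega>. (W t \<omega> - W s \<omega>)\<^sup>2)"
    and increment_variance: "expectation (\<lambda>\<omega>. (W t \<omega> - W s \<omega>)\<^sup>2) = t - s"
proof -
  have "integrable M (\<lambda>\<omega>. W t \<omega> - W s \<omega>) \<and> expectation (\<lambda>\<omega>. W t \<omega> - W s \<omega>) = 0 \<and>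
    integrable M (\<lambda>\<omega>. (W t \<omega> - W s \<omega>)\<^sup>2) \<and> expectation (\<lambda>\<omega>. (W t \<omega> - W s \<omega>)\<^sup>2) = t - s"
  proof (cases "s = t")
    case False
    then have st: "0 < sqrt (t - s)" using s by simp
    have D: "distributed M lborel (\<lambda>\<omega>. W t \<omega> - W s \<omega>) (normal_density 0 (sqrt (t - s)))"
      using increment_distributed s False by simp
    have e: "expectation (\<lambda>\<omega>. W t \<omega> - W s \<omega>) = 0"
      using normal_distributed_expectation[OF st D] .
    have v: "variance (\<lambda>\<omega>. W t \<omega> - W s \<omega>) = (sqrt (t - s))\<^sup>2"
      using normal_distributed_variance[OF st D] .
    have i1: "integrable M (\<lambda>\<omega>. W t \<omega> - W s \<omega>)"
      using distributed_integrable_var[OF D] integrable_normal_moment_nz_1[OF st, of 0] by simp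
    have i2: "integrable M (\<lambda>\<omega>. (W t \<omega> - W s \<omega>)\<^sup>2)"
      using distributed_integrable[OF D, of "\<lambda>x. x\<^sup>2"] integrable_normal_moment[OF st, of 0 2]
      by simp
    show ?thesis using e v i1 i2 st s by simp
  qed simp
  then show "integrable M (\<lambda>\<omega>. W t \<omega> - W s \<omega>)" "expectation (\<lambda>\<omega>. W t \<omega> - W s \<omega>) = 0"
    "integrable M (\<lambda>\<omega>. (W t \<omega> - W s \<omega>)\<^sup>2)" "expectation (\<lambda>\<omega>. (W t \<omega> - W s \<omega>)\<^sup>2) = t - s"
    by auto
qed

lemma increment_iexp:
  assumes s: "0 \<le> s" "s \<le> t" "t \<le> T"
  shows "(CLINT \<omega>|M. iexp (c * (W t \<omega> - W s \<omega>))) = exp (- (c\<^sup>2 * (t - s)) / 2)"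
proof (cases "s = t")
  case True
  then show ?thesis by (simp add: prob_space)
next
  case False
  then have st: "0 < sqrt (t - s)" using s by simp
  have D: "distributed M lborel (\<lambda>\<omega>. W t \<omega> - W s \<omega>) (normal_density 0 (sqrt (t - s)))"
    using increment_distributed s False by simp
  have D': "distributed M lborel (\<lambda>\<omega>. (W t \<omega> - W s \<omega>) / sqrt (t - s)) std_normal_density"
    using normal_standard_normal_convert[OF st, THEN iffD1, OF D] by simp
  have m [measurable]: "(\<lambda>\<omega>. (W t \<omega> - W s \<omega>) / sqrt (t - s)) \<in> borel_measurable M"
    using s by simp
  have eq: "distr M borel (\<lambda>\<omega>. (W t \<omega> - W s \<omega>) / sqrt (t - s)) = std_normal_distribution"
    using distributed_distr_eq_density[OF D'] by (simp cong: distr_cong)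
  have "(CLINT \<omega>|M. iexp (c * (W t \<omega> - W s \<omega>)))
     = (CLINT \<omega>|M. iexp ((c * sqrt (t - s)) * ((W t \<omega> - W s \<omega>) / sqrt (t - s))))"
    using st by simp
  also have "\<dots> = char (distr M borel (\<lambda>\<omega>. (W t \<omega> - W s \<omega>) / sqrt (t - s))) (c * sqrt (t - s))"
    unfolding char_def by (subst integral_distr) auto
  also have "\<dots> = exp (- (c\<^sup>2 * (t - s)) / 2)"
    unfolding eq char_std_normal_distribution using st
    by (simp add: power_mult_distrib)
  finally show ?thesis .
qed

text \<open>
  Moments of sums of increments are computed by peeling off the latest increment, which is
  independent of everything before it.
\<close>
lemma expectation_times_increment:
  assumes s: "0 \<le> s" "s \<le> t" "t \<le> T" and Z: "Z \<in> borel_measurable (F s)" "integrable M Z"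
  shows "integrable M (\<lambda>\<omega>. Z \<omega> * (W t \<omega> - W s \<omega>))"
    and "expectation (\<lambda>\<omega>. Z \<omega> * (W t \<omega> - W s \<omega>)) = 0"
    and "integrable M (\<lambda>\<omega>. Z \<omega> * (W t \<omega> - W s \<omega>)\<^sup>2)"
    and "expectation (\<lambda>\<omega>. Z \<omega> * (W t \<omega> - W s \<omega>)\<^sup>2) = expectation Z * (t - s)"
proof -
  have I: "indep_var borel Z borel (\<lambda>\<omega>. W t \<omega> - W s \<omega>)"
    using indep_var_increment[OF s Z(1), of "\<lambda>x. x"] by simp
  have I2: "indep_var borel Z borel (\<lambda>\<omega>. (W t \<omega> - W s \<omega>)\<^sup>2)"
    using indep_var_increment[OF s Z(1), of "\<lambda>x. x\<^sup>2"] by simp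
  note J = increment_integrable[OF s] increment_mean[OF s]
    increment_square_integrable[OF s] increment_variance[OF s]
  show "integrable M (\<lambda>\<omega>. Z \<omega> * (W t \<omega> - W s \<omega>))"
    "expectation (\<lambda>\<omega>. Z \<omega> * (W t \<omega> - W s \<omega>)) = 0"
    using indep_var_integrable[OF I Z(2) J(1)] indep_var_lebesgue_integral[OF I Z(2) J(1)] J by auto
  show "integrable M (\<lambda>\<omega>. Z \<omega> * (W t \<omega> - W s \<omega>)\<^sup>2)"
    "expectation (\<lambda>\<omega>. Z \<omega> * (W t \<omega> - W s \<omega>)\<^sup>2) = expectation Z * (t - s)"
    using indep_var_integrable[OF I2 Z(2) J(3)] indep_var_lebesgue_integral[OF I2 Z(2) J(3)] J by auto
qed

end

section \<open>The Borel sets of a space of continuous functions\<close>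

abbreviation C_space :: "real set \<Rightarrow> (real \<Rightarrow> real) set" where
  "C_space K \<equiv> mspace (cfunspace (top_of_set K) euclidean_metric)"

lemma C_space_eq:
  "compact K \<Longrightarrow> C_space K = {v. continuous_on K v \<and> v \<in> extensional K}"
  by (subst compactin_mspace_cfunspace) (auto simp: mtopology_of_euclidean)

lemma open_sets_C_borel_subset:
  "{U. openin (mtopology_of (cfunspace (top_of_set K) euclidean_metric)) U} \<subseteq> Pow (C_space K)"
  using openin_subset[of "mtopology_of (cfunspace (top_of_set K) euclidean_metric)"]
  by (auto simp del: mspace_cfunspace)

lemma space_C_borel [simp]: "space (C_borel K) = C_space K"
  unfolding C_borel_def using open_sets_C_borel_subset by (intro space_measure_of)

lemma sets_C_borel:
  "sets (C_borel K) = sigma_sets (C_space K)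
     {U. openin (mtopology_of (cfunspace (top_of_set K) euclidean_metric)) U}"
  unfolding C_borel_def using open_sets_C_borel_subset by (intro sets_measure_of)

lemma (in Metric_space) openin_mtopology_dist:
  "openin mtopology U \<longleftrightarrow> U \<subseteq> M \<and> (\<forall>v\<in>U. \<exists>r>0. \<forall>u\<in>M. d v u < r \<longrightarrow> u \<in> U)"
proof -
  have "mball v r \<subseteq> U \<longleftrightarrow> (\<forall>u\<in>M. d v u < r \<longrightarrow> u \<in> U)" if "v \<in> M" for v r
    using that by auto
  then show ?thesis
    unfolding openin_mtopology by (metis subsetD)
qed

lemma openin_C_space_iff:
  "openin (mtopology_of (cfunspace (top_of_set K) euclidean_metric)) U \<longleftrightarrow>
     U \<subseteq> C_space K \<and> (\<forall>v\<in>U. \<exists>r>0. \<forall>u\<in>C_space K.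
        mdist (cfunspace (top_of_set K) euclidean_metric) v u < r \<longrightarrow> u \<in> U)"
  unfolding mtopology_of_def
  by (rule Metric_space.openin_mtopology_dist[OF Metric_space_mspace_mdist])

lemma C_space_sup_dist_le:
  "0 \<le> r \<Longrightarrow> (\<And>x. x \<in> K \<Longrightarrow> \<bar>v x - u x\<bar> \<le> r) \<Longrightarrow>
    mdist (cfunspace (top_of_set K) euclidean_metric) v u \<le> r"
  by (rule mdist_cfunspace_le) (auto simp: dist_real_def)

lemma C_space_dist_at:
  assumes "compact K" "v \<in> C_space K" "u \<in> C_space K"
    "mdist (cfunspace (top_of_set K) euclidean_metric) v u < r" "x \<in> K"
  shows "\<bar>v x - u x\<bar> < r"
  using cfunspace_mdist_lt[of "top_of_set K" v euclidean_metric u r x] assms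
  by (simp add: dist_real_def del: mspace_cfunspace)

lemma eval_C_borel [measurable (raw)]:
  assumes K: "compact K" "s \<in> K"
  shows "(\<lambda>v. v s) \<in> borel_measurable (C_borel K)"
proof (rule borel_measurableI)
  fix S :: "real set" assume S: "open S"
  let ?U = "(\<lambda>v. v s) -` S \<inter> C_space K"
  have "openin (mtopology_of (cfunspace (top_of_set K) euclidean_metric)) ?U"
    unfolding openin_C_space_iff
  proof (intro conjI ballI)
    fix v assume v: "v \<in> ?U"
    then obtain e where e: "e > 0" "ball (v s) e \<subseteq> S" using S by (auto simp: open_contains_ball)
    show "\<exists>r>0. \<forall>u\<in>C_space K. mdist (cfunspace (top_of_set K) euclidean_metric) v u < r \<longrightarrow> u \<in> ?U"
    proof (intro exI[of _ e] conjI ballI impI e(1))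
      fix u assume "u \<in> C_space K" "mdist (cfunspace (top_of_set K) euclidean_metric) v u < e"
      then show "u \<in> ?U"
        using C_space_dist_at[OF K(1) _ _ _ K(2), of v u e] v e(2)
        by (auto simp: subset_eq dist_real_def simp del: mspace_cfunspace)
    qed
  qed simp
  then show "(\<lambda>v. v s) -` S \<inter> space (C_borel K) \<in> sets (C_borel K)"
    unfolding sets_C_borel by (auto simp del: mspace_cfunspace)
qed

definition rat_poly :: "rat list \<Rightarrow> real \<Rightarrow> real" where
  "rat_poly l x = (\<Sum>i<length l. of_rat (l ! i) * x ^ i)"

lemma rat_poly_dense:
  assumes K: "compact K" and v: "continuous_on K v" and e: "0 < e"
  obtains l where "\<And>x. x \<in> K \<Longrightarrow> \<bar>v x - rat_poly l x\<bar> < e"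
proof -
  obtain g where g: "real_polynomial_function g" "\<And>x. x \<in> K \<Longrightarrow> \<bar>v x - g x\<bar> < e / 2"
    using Stone_Weierstrass_real_polynomial_function[OF K v half_gt_zero[OF e]] by blast
  then obtain a n where a: "g = (\<lambda>x. \<Sum>i\<le>n. a i * x ^ i)"
    by (auto simp: real_polynomial_function_iff_sum)
  obtain B where B: "\<And>x. x \<in> K \<Longrightarrow> \<bar>x\<bar> \<le> B" "0 < B"
    using compact_imp_bounded[OF K] by (auto simp: bounded_pos)
  define C where "C = (\<Sum>i\<le>n. B ^ i) + 1"
  have C: "0 < C" unfolding C_def using B(2) by (intro add_nonneg_pos sum_nonneg) auto
  have "\<exists>q::rat. \<bar>a i - of_rat q\<bar> < e / (2 * C)" for i
  proof -
    have "0 < e / (2 * C)" using e C by simp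
    then obtain q where "a i - e / (2 * C) < of_rat q" "of_rat q < a i"
      using of_rat_dense[of "a i - e / (2 * C)" "a i"] by auto
    then show ?thesis by (intro exI[of _ q]) (simp add: abs_less_iff)
  qed
  then obtain q :: "nat \<Rightarrow> rat" where q: "\<And>i. \<bar>a i - of_rat (q i)\<bar> < e / (2 * C)"
    by metis
  define l where "l = map q [0..<Suc n]"
  have l: "rat_poly l x = (\<Sum>i\<le>n. of_rat (q i) * x ^ i)" for x
    unfolding rat_poly_def l_def
    by (rule sum.cong) (auto simp del: upt_Suc)
  show thesis
  proof (rule that[of l])
    fix x assume x: "x \<in> K"
    have "\<bar>g x - rat_poly l x\<bar> = \<bar>\<Sum>i\<le>n. (a i - of_rat (q i)) * x ^ i\<bar>"
      unfolding a l by (simp add: sum_subtractf algebra_simps)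
    also have "\<dots> \<le> (\<Sum>i\<le>n. \<bar>(a i - of_rat (q i)) * x ^ i\<bar>)" by (rule sum_abs)
    also have "\<dots> \<le> (\<Sum>i\<le>n. e / (2 * C) * B ^ i)"
      unfolding abs_mult power_abs
      using q B x e C by (intro sum_mono mult_mono power_mono) (auto intro: less_imp_le)
    also have "\<dots> = e / (2 * C) * (C - 1)" by (simp add: C_def sum_distrib_left)
    also have "\<dots> \<le> e / 2" using C e by (simp add: field_simps)
    finally show "\<bar>v x - rat_poly l x\<bar> < e" using g(2)[OF x] by linarith
  qed
qed

text \<open>
  Balls of rational radius around polynomials with rational coefficients form a countable base of the uniform
  topology, and a closed ball is a countable intersection of conditions on the values at points
  of \<open>D\<close>. Hence the Borel sets of the uniform topology are generated by evaluations in \<open>D\<close>.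
\<close>
lemma C_borel_cylinder:
  assumes K: "compact K" and D: "countable D" "D \<subseteq> K" "K \<subseteq> closure D"
    and A: "A \<in> sets (C_borel K)"
  obtains B where "B \<in> sets (PiM D (\<lambda>_. borel :: real measure))"
    "A = {v \<in> C_space K. restrict v D \<in> B}"
proof -
  let ?d = "mdist (cfunspace (top_of_set K) euclidean_metric)"
  define N where "N = vimage_algebra (C_space K) (\<lambda>v. restrict v D) (PiM D (\<lambda>_. borel :: real measure))"
  have fn: "(\<lambda>v. restrict v D) \<in> C_space K \<rightarrow> space (PiM D (\<lambda>_. borel :: real measure))"
    by (auto simp: space_PiM)
  have spN [simp]: "space N = C_space K" by (simp add: N_def)
  have m: "(\<lambda>v. restrict v D) \<in> measurable N (PiM D (\<lambda>_. borel :: real measure))"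
    unfolding N_def by (rule measurable_vimage_algebra1[OF fn])
  have ev: "(\<lambda>v. v q) \<in> borel_measurable N" if "q \<in> D" for q
    using measurable_compose[OF m measurable_component_singleton[OF that]] that by simp
  define cb where "cb l r = {v \<in> C_space K. \<forall>q\<in>D. \<bar>v q - rat_poly l q\<bar> \<le> real_of_rat r}" for l r
  have cb_sets: "cb l r \<in> sets N" for l r
  proof -
    have "{v \<in> space N. \<forall>q\<in>D. \<bar>v q - rat_poly l q\<bar> \<le> real_of_rat r} \<in> sets N"
    proof (rule sets.sets_Collect_countable_All'[OF _ D(1)])
      fix q assume "q \<in> D"
      note [measurable] = ev[OF this]
      show "{v \<in> space N. \<bar>v q - rat_poly l q\<bar> \<le> real_of_rat r} \<in> sets N" by measurable
    qed
    then show ?thesis unfolding cb_def spN .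
  qed
  have "U \<in> sets N" if U: "openin (mtopology_of (cfunspace (top_of_set K) euclidean_metric)) U" for U
  proof -
    have "U = (\<Union>(l, r)\<in>{(l, r). cb l r \<subseteq> U}. cb l r)"
    proof (rule subset_antisym; rule subsetI)
      fix v assume v: "v \<in> U"
      then have vC: "v \<in> C_space K" using U unfolding openin_C_space_iff by blast
      obtain e where e: "e > 0" "\<And>u. u \<in> C_space K \<Longrightarrow> ?d v u < e \<Longrightarrow> u \<in> U"
        using U v unfolding openin_C_space_iff by blast
      have vc: "continuous_on K v" using vC unfolding C_space_eq[OF K] by simp
      obtain l where l: "\<And>x. x \<in> K \<Longrightarrow> \<bar>v x - rat_poly l x\<bar> < e / 4"
        using rat_poly_dense[OF K vc, of "e / 4"] e(1) by auto
      \<comment> \<open>a ball of radius \<open>r\<close> around the polynomial contains \<open>v\<close> and has diameter less than \<open>e\<close>\<close>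
      obtain r where r: "e / 4 < real_of_rat r" "real_of_rat r < e / 2"
        using of_rat_dense[of "e / 4" "e / 2"] e(1) by auto
      have "cb l r \<subseteq> U"
      proof
        fix u assume u: "u \<in> cb l r"
        then have uC: "u \<in> C_space K" and uD: "\<And>q. q \<in> D \<Longrightarrow> \<bar>u q - rat_poly l q\<bar> \<le> of_rat r"
          by (auto simp: cb_def simp del: mspace_cfunspace)
        have uc: "continuous_on K u" using uC unfolding C_space_eq[OF K] by simp
        have "continuous_on K (\<lambda>x. \<bar>u x - rat_poly l x\<bar>)"
          unfolding rat_poly_def by (intro continuous_intros uc)
        moreover have cl: "closure D = K"
          using D compact_imp_closed[OF K] by (simp add: closure_minimal subset_antisym)
        ultimately have uK: "\<bar>u x - rat_poly l x\<bar> \<le> of_rat r" if "x \<in> K" for x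
          using continuous_le_on_closure[of D "\<lambda>x. \<bar>u x - rat_poly l x\<bar>" x "of_rat r"] that uD by simp
        have "?d v u \<le> e / 4 + of_rat r"
        proof (rule C_space_sup_dist_le)
          fix x assume "x \<in> K"
          then show "\<bar>v x - u x\<bar> \<le> e / 4 + of_rat r" using l[of x] uK[of x] by linarith
        qed (use e r in linarith)
        also have "\<dots> < e" using r e by linarith
        finally show "u \<in> U" using e(2)[OF uC] by simp
      qed
      moreover have "v \<in> cb l r"
        unfolding cb_def
      proof (intro CollectI conjI ballI vC)
        fix q assume "q \<in> D"
        then have "\<bar>v q - rat_poly l q\<bar> < e / 4" using l D(2) by blast
        then show "\<bar>v q - rat_poly l q\<bar> \<le> real_of_rat r" using r(1) by linarith
      qed
      ultimately show "v \<in> (\<Union>(l, r)\<in>{(l, r). cb l r \<subseteq> U}. cb l r)" by blast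
    qed blast
    also have "\<dots> \<in> sets N"
    proof (rule sets.countable_UN'')
      show "countable {(l, r). cb l r \<subseteq> U}" by (rule countableI_type)
      show "(case x of (l, r) \<Rightarrow> cb l r) \<in> sets N" for x by (cases x) (simp add: cb_sets)
    qed
    finally show ?thesis .
  qed
  then have "sets (C_borel K) \<subseteq> sets N"
    unfolding sets_C_borel spN[symmetric] by (intro sets.sigma_sets_subset subsetI) simp
  then have "A \<in> sets N" using A by auto
  then obtain B where B: "B \<in> sets (PiM D (\<lambda>_. borel :: real measure))"
    "A = (\<lambda>v. restrict v D) -` B \<inter> C_space K"
    unfolding N_def sets_vimage_algebra2[OF fn] by blast
  have "A = {v \<in> C_space K. restrict v D \<in> B}" unfolding B(2) by blast
  with B(1) show thesis by (rule that)
qed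

lemma path_measurable_C_borel:
  assumes K: "compact K" and D: "countable D" "D \<subseteq> K" "K \<subseteq> closure D"
    and X: "\<And>\<omega>. \<omega> \<in> space N \<Longrightarrow> continuous_on K (\<lambda>s. X s \<omega>)"
      "\<And>s. s \<in> D \<Longrightarrow> X s \<in> borel_measurable N"
  shows "(\<lambda>\<omega>. \<lambda>s\<in>K. X s \<omega>) \<in> measurable N (C_borel K)"
proof (rule measurableI)
  have inC: "(\<lambda>s\<in>K. X s \<omega>) \<in> C_space K" if "\<omega> \<in> space N" for \<omega>
    unfolding C_space_eq[OF K] using X(1)[OF that] by (simp cong: continuous_on_cong)
  then show "(\<lambda>s\<in>K. X s \<omega>) \<in> space (C_borel K)" if "\<omega> \<in> space N" for \<omega>
    using that by (simp del: mspace_cfunspace)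
  fix A assume A: "A \<in> sets (C_borel K)"
  obtain B where B: "B \<in> sets (PiM D (\<lambda>_. borel :: real measure))"
    "A = {v \<in> C_space K. restrict v D \<in> B}"
    by (rule C_borel_cylinder[OF K D A])
  have m: "(\<lambda>\<omega>. \<lambda>s\<in>D. X s \<omega>) \<in> measurable N (PiM D (\<lambda>_. borel))"
    by (rule measurable_restrict) (rule X(2))
  have eq: "restrict (\<lambda>s\<in>K. X s \<omega>) D = (\<lambda>s\<in>D. X s \<omega>)" for \<omega>
    using D(2) by (auto simp: restrict_def fun_eq_iff)
  have "(\<lambda>s\<in>K. X s \<omega>) \<in> A \<longleftrightarrow> (\<lambda>s\<in>D. X s \<omega>) \<in> B" if "\<omega> \<in> space N" for \<omega>
    unfolding B(2) mem_Collect_eq eq using inC[OF that] by (simp only: simp_thms)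
  then have "(\<lambda>\<omega>. \<lambda>s\<in>K. X s \<omega>) -` A \<inter> space N = (\<lambda>\<omega>. \<lambda>s\<in>D. X s \<omega>) -` B \<inter> space N"
    by blast
  then show "(\<lambda>\<omega>. \<lambda>s\<in>K. X s \<omega>) -` A \<inter> space N \<in> sets N"
    using measurable_sets[OF m B(1)] by (simp only:)
qed

section \<open>Stieltjes sums\<close>

lemma steps_imp_le:
  fixes p :: "nat \<Rightarrow> real"
  assumes "\<And>i. i < n \<Longrightarrow> p i \<le> p (Suc i)" "i \<le> j" "j \<le> n"
  shows "p i \<le> p j"
  using assms(2,3)
proof (induction j)
  case (Suc j)
  then show ?case using assms(1)[of j] by (cases "i = Suc j") auto
qed simp

text \<open>
  Partial summation along the grid: each step contributes the integral of \<open>\<phi>'\<close> against the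
  difference of \<open>w\<close> and its value at the right end point, and \<open>\<eta>\<close> bounds this difference.
\<close>
lemma stieltjes_sum_bound:
  fixes w \<phi> \<phi>' :: "real \<Rightarrow> real" and p :: "nat \<Rightarrow> real"
  assumes w: "continuous_on {a..b} w" and \<phi>': "continuous_on {a..b} \<phi>'"
    and der: "\<And>x. x \<in> {a..b} \<Longrightarrow> (\<phi> has_real_derivative \<phi>' x) (at x within {a..b})"
    and K: "\<And>x. x \<in> {a..b} \<Longrightarrow> \<bar>\<phi>' x\<bar> \<le> K" "0 \<le> K"
    and p0: "p 0 = a" and pb: "\<And>i. i \<le> n \<Longrightarrow> p i \<le> b" and mono: "\<And>i. i < n \<Longrightarrow> p i \<le> p (Suc i)"
    and osc: "\<And>i s. i < n \<Longrightarrow> s \<in> {p i..p (Suc i)} \<Longrightarrow> \<bar>w s - w (p (Suc i))\<bar> \<le> \<eta>" and \<eta>: "0 \<le> \<eta>"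
  shows "a \<le> p n \<and> \<bar>(\<Sum>i<n. \<phi> (p i) * (w (p (Suc i)) - w (p i)))
    - (\<phi> (p n) * w (p n) - \<phi> a * w a - integral {a..p n} (\<lambda>s. \<phi>' s * w s))\<bar> \<le> \<eta> * K * (p n - a)"
  using pb mono osc
proof (induction n)
  case 0
  then show ?case by (simp add: p0)
next
  case (Suc n)
  let ?q = "p n" and ?r = "p (Suc n)"
  have IH: "a \<le> ?q" "\<bar>(\<Sum>i<n. \<phi> (p i) * (w (p (Suc i)) - w (p i)))
    - (\<phi> ?q * w ?q - \<phi> a * w a - integral {a..?q} (\<lambda>s. \<phi>' s * w s))\<bar> \<le> \<eta> * K * (?q - a)"
    using Suc by auto
  have qr: "?q \<le> ?r" "?r \<le> b" using Suc.prems by auto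
  have sub: "{?q..?r} \<subseteq> {a..b}" "{a..?r} \<subseteq> {a..b}" using IH(1) qr by auto
  have ftc: "(\<phi>' has_integral (\<phi> ?r - \<phi> ?q)) {?q..?r}"
    using sub(1) qr by (intro fundamental_theorem_of_calculus)
      (auto simp flip: has_real_derivative_iff_has_vector_derivative intro: DERIV_subset[OF der])
  have cw: "continuous_on {?q..?r} w" "continuous_on {?q..?r} \<phi>'"
    using w \<phi>' sub(1) by (blast intro: continuous_on_subset)+
  have int: "(\<lambda>s. \<phi>' s * w s) integrable_on {?q..?r}" "(\<lambda>s. \<phi>' s * w s) integrable_on {a..?r}"
    using sub by (auto intro!: integrable_continuous_real continuous_intros
        continuous_on_subset[OF w] continuous_on_subset[OF \<phi>'])
  have comb: "integral {a..?r} (\<lambda>s. \<phi>' s * w s)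
    = integral {a..?q} (\<lambda>s. \<phi>' s * w s) + integral {?q..?r} (\<lambda>s. \<phi>' s * w s)"
    by (rule Henstock_Kurzweil_Integration.integral_combine[OF IH(1) qr(1) int(2), symmetric])
  have "((\<lambda>s. \<phi>' s * w s - \<phi>' s * w ?r) has_integral
      (integral {?q..?r} (\<lambda>s. \<phi>' s * w s) - (\<phi> ?r - \<phi> ?q) * w ?r)) {?q..?r}"
    using int(1) ftc by (intro has_integral_diff has_integral_mult_left) (auto simp: has_integral_integral)
  note hi = this
  have "norm (integral {?q..?r} (\<lambda>s. \<phi>' s * w s) - (\<phi> ?r - \<phi> ?q) * w ?r) \<le> (K * \<eta>) * measure lborel {?q..?r}"
  proof (rule has_integral_bound_real[OF _ finite.emptyI hi])
    fix s assume "s \<in> {?q..?r} - {}"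
    then have s: "s \<in> {?q..?r}" by simp
    have "\<bar>\<phi>' s\<bar> * \<bar>w s - w ?r\<bar> \<le> K * \<eta>"
      using s sub Suc.prems(3)[of n s] K by (intro mult_mono) auto
    then show "norm (\<phi>' s * w s - \<phi>' s * w ?r) \<le> K * \<eta>"
      by (simp add: abs_mult flip: right_diff_distrib)
  qed (use K \<eta> in auto)
  then have "\<bar>integral {?q..?r} (\<lambda>s. \<phi>' s * w s) - (\<phi> ?r - \<phi> ?q) * w ?r\<bar> \<le> \<eta> * K * (?r - ?q)"
    using qr by (simp add: mult_ac)
  with IH(2) have "\<bar>(\<Sum>i<n. \<phi> (p i) * (w (p (Suc i)) - w (p i)))
    - (\<phi> ?q * w ?q - \<phi> a * w a - integral {a..?q} (\<lambda>s. \<phi>' s * w s))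
    + (integral {?q..?r} (\<lambda>s. \<phi>' s * w s) - (\<phi> ?r - \<phi> ?q) * w ?r)\<bar> \<le> \<eta> * K * (?q - a) + \<eta> * K * (?r - ?q)"
    by linarith
  then show ?case
    using IH(1) qr by (simp add: comb algebra_simps)
qed

text \<open>
  Integration by parts moves the roughness of \<open>w\<close> into a Riemann integral, so the sums converge
  along every continuous path, of whatever variation.
\<close>
lemma stieltjes_sums_tendsto:
  fixes w \<phi> \<phi>' :: "real \<Rightarrow> real" and p :: "nat \<Rightarrow> nat \<Rightarrow> real"
  assumes ab: "a \<le> b"
    and w: "continuous_on {a..b} w" and \<phi>': "continuous_on {a..b} \<phi>'"
    and der: "\<And>x. x \<in> {a..b} \<Longrightarrow> (\<phi> has_real_derivative \<phi>' x) (at x within {a..b})"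
    and p: "\<And>N. p N 0 = a" "\<And>N. p N (L N) = b" "\<And>N i. i < L N \<Longrightarrow> p N i \<le> p N (Suc i)"
    and mesh: "\<And>N i. i < L N \<Longrightarrow> p N (Suc i) - p N i \<le> d N" "d \<longlonglongrightarrow> 0"
  shows "(\<lambda>N. \<Sum>i<L N. \<phi> (p N i) * (w (p N (Suc i)) - w (p N i)))
    \<longlonglongrightarrow> \<phi> b * w b - \<phi> a * w a - integral {a..b} (\<lambda>s. \<phi>' s * w s)"
proof (rule LIMSEQ_I)
  fix e :: real assume e: "0 < e"
  have "bounded (\<phi>' ` {a..b})"
    by (intro compact_imp_bounded compact_continuous_image \<phi>') auto
  then obtain K where K: "0 < K" "\<And>x. x \<in> {a..b} \<Longrightarrow> \<bar>\<phi>' x\<bar> \<le> K"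
    by (auto simp: bounded_pos)
  define \<eta> where "\<eta> = e / (2 * K * (b - a + 1))"
  have \<eta>: "0 < \<eta>" using e K ab by (simp add: \<eta>_def)
  have "uniformly_continuous_on {a..b} w" by (intro compact_uniformly_continuous w) auto
  then obtain \<delta> where \<delta>: "\<delta> > 0" "\<And>s r. s \<in> {a..b} \<Longrightarrow> r \<in> {a..b} \<Longrightarrow> \<bar>s - r\<bar> < \<delta> \<Longrightarrow> \<bar>w s - w r\<bar> < \<eta>"
    using \<eta> unfolding uniformly_continuous_on_def dist_real_def by metis
  obtain N0 where N0: "\<And>N. N \<ge> N0 \<Longrightarrow> \<bar>d N\<bar> < \<delta>"
    using LIMSEQ_D[OF mesh(2) \<delta>(1)] by auto
  show "\<exists>N0. \<forall>N\<ge>N0. norm ((\<Sum>i<L N. \<phi> (p N i) * (w (p N (Suc i)) - w (p N i)))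
      - (\<phi> b * w b - \<phi> a * w a - integral {a..b} (\<lambda>s. \<phi>' s * w s))) < e"
  proof (intro exI allI impI)
    fix N assume N: "N0 \<le> N"
    have mono: "p N i \<le> p N j" if "i \<le> j" "j \<le> L N" for i j
      by (rule steps_imp_le[of "L N" "p N" i j]) (use p(3) that in auto)
    have in_ab: "p N i \<in> {a..b}" if "i \<le> L N" for i
      using mono[of 0 i] mono[of i "L N"] that p by simp
    have "a \<le> p N (L N) \<and> \<bar>(\<Sum>i<L N. \<phi> (p N i) * (w (p N (Suc i)) - w (p N i)))
      - (\<phi> (p N (L N)) * w (p N (L N)) - \<phi> a * w a - integral {a..p N (L N)} (\<lambda>s. \<phi>' s * w s))\<bar>
      \<le> \<eta> * K * (p N (L N) - a)"
    proof (rule stieltjes_sum_bound[OF w \<phi>' der K(2)])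
      fix i s assume i: "i < L N" and s: "s \<in> {p N i..p N (Suc i)}"
      have "\<bar>s - p N (Suc i)\<bar> < \<delta>" using s mesh(1)[OF i] N0[OF N] by auto
      then show "\<bar>w s - w (p N (Suc i))\<bar> \<le> \<eta>"
        using \<delta>(2)[of s "p N (Suc i)"] s in_ab[of i] in_ab[of "Suc i"] i by fastforce
    qed (use K \<eta> p in_ab in auto)
    moreover have "\<eta> * K * (b - a) < e"
    proof -
      have "\<eta> * K * (b - a + 1) = e / 2" using K(1) ab unfolding \<eta>_def by (simp add: divide_simps)
      moreover have "\<eta> * K * (b - a) \<le> \<eta> * K * (b - a + 1)"
        using \<eta> K(1) by (intro mult_left_mono) auto
      ultimately show ?thesis using e by linarith
    qed
    ultimately show "norm ((\<Sum>i<L N. \<phi> (p N i) * (w (p N (Suc i)) - w (p N i)))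
      - (\<phi> b * w b - \<phi> a * w a - integral {a..b} (\<lambda>s. \<phi>' s * w s))) < e"
      using p by simp
  qed
qed

section \<open>The Ito integral of a deterministic integrand\<close>

lemma bounded_times_integrable:
  fixes Z :: "'a \<Rightarrow> real"
  assumes "integrable M Z" "Y \<in> borel_measurable M" "\<And>\<omega>. \<omega> \<in> space M \<Longrightarrow> \<bar>Y \<omega>\<bar> \<le> C"
  shows "integrable M (\<lambda>\<omega>. Y \<omega> * Z \<omega>)"
proof (rule Bochner_Integration.integrable_bound[of M "\<lambda>\<omega>. C * Z \<omega>"])
  show "AE \<omega> in M. norm (Y \<omega> * Z \<omega>) \<le> norm (C * Z \<omega>)"
    using assms(3) by (intro AE_I2) (auto simp: abs_mult intro!: mult_right_mono intro: order_trans[OF _ abs_ge_self])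
qed (use assms in auto)

lemma uniform_steps_indicator:
  fixes q :: "nat \<Rightarrow> real"
  assumes "\<And>i. q i \<le> q (Suc i)"
  shows "q 0 \<le> q n \<and> (\<Sum>i<n. indicator {q i<..q (Suc i)} s) = (indicator {q 0<..q n} s :: real)"
proof (induction n)
  case (Suc n)
  then show ?case using assms[of n] by (auto simp: indicator_def)
qed simp

lemma square_sum_le: "(x - z)\<^sup>2 \<le> 2 * (x - y)\<^sup>2 + 2 * (y - z)\<^sup>2" for x y z :: real
  using zero_le_power2[of "(x - y) - (y - z)"] by (simp add: power2_eq_square algebra_simps)

context brownian_setting begin

lemma bounded_product:
  assumes "\<xi> \<in> borel_measurable (F p)" "\<eta> \<in> borel_measurable (F q)" "0 \<le> p" "p \<le> q" "q \<le> T"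
    "\<And>\<omega>. \<omega> \<in> space M \<Longrightarrow> \<bar>\<xi> \<omega>\<bar> \<le> C" "\<And>\<omega>. \<omega> \<in> space M \<Longrightarrow> \<bar>\<eta> \<omega>\<bar> \<le> (C::real)"
  shows "(\<lambda>\<omega>. \<xi> \<omega> * \<eta> \<omega>) \<in> borel_measurable (F q)"
    "\<omega> \<in> space M \<Longrightarrow> \<bar>\<xi> \<omega> * \<eta> \<omega>\<bar> \<le> C * C"
  using measurable_F_mono[OF assms(1,3,4,5)] assms(2)
  by (simp, simp add: abs_mult, intro mult_mono assms) (auto intro: order_trans[OF abs_ge_zero assms(6)])

text \<open>
  The first interval is cut at \<open>q\<close>. Its part before \<open>q\<close> is known when the second increment
  starts and so contributes nothing. After \<open>q\<close> both intervals start together, and the longer one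
  is the shorter one followed by an independent increment.
\<close>
lemma increment_cross_moment_ordered:
  assumes p: "0 \<le> p" "p \<le> p'" "p' \<le> T" and q: "p \<le> q" "q \<le> q'" "q' \<le> T"
    and \<xi>: "\<xi> \<in> borel_measurable (F p)" "\<And>\<omega>. \<omega> \<in> space M \<Longrightarrow> \<bar>\<xi> \<omega>\<bar> \<le> C"
    and \<eta>: "\<eta> \<in> borel_measurable (F q)" "\<And>\<omega>. \<omega> \<in> space M \<Longrightarrow> \<bar>\<eta> \<omega>\<bar> \<le> C"
  shows "has_bochner_integral M
    (\<lambda>\<omega>. (\<xi> \<omega> * (W p' \<omega> - W p \<omega>)) * (\<eta> \<omega> * (W q' \<omega> - W q \<omega>)))
    (expectation (\<lambda>\<omega>. \<xi> \<omega> * \<eta> \<omega>) * max 0 (min p' q' - max p q))"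
proof -
  define \<zeta> where "\<zeta> \<omega> = \<xi> \<omega> * \<eta> \<omega>" for \<omega>
  have qT: "0 \<le> q" "q \<le> T" using p q by auto
  have \<zeta>: "\<zeta> \<in> borel_measurable (F q)" "\<And>\<omega>. \<omega> \<in> space M \<Longrightarrow> \<bar>\<zeta> \<omega>\<bar> \<le> C * C"
    using bounded_product[OF \<xi>(1) \<eta>(1) p(1) q(1) qT(2) \<xi>(2) \<eta>(2)] unfolding \<zeta>_def by auto
  have \<zeta>F: "\<zeta> \<in> borel_measurable (F r)" if "q \<le> r" "r \<le> T" for r
    using measurable_F_mono[OF \<zeta>(1)] that qT by auto
  have \<zeta>M: "\<zeta> \<in> borel_measurable M" using measurable_F_M[OF \<zeta>(1)] qT by auto
  have \<zeta>i: "integrable M \<zeta>"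
    by (rule integrable_const_bound[OF _ \<zeta>M, of "C * C"]) (auto simp: \<zeta>(2))
  \<comment> \<open>the part of the first interval before \<open>q\<close> contributes nothing\<close>
  have before: "has_bochner_integral M (\<lambda>\<omega>. \<zeta> \<omega> * (W r \<omega> - W p \<omega>) * (W q' \<omega> - W q \<omega>)) 0"
    if r: "p \<le> r" "r \<le> q" for r
  proof -
    have Zi: "integrable M (\<lambda>\<omega>. \<zeta> \<omega> * (W r \<omega> - W p \<omega>))"
      using p q r \<zeta>(2) by (intro bounded_times_integrable[OF _ \<zeta>M] increment_integrable) auto
    have Zm: "(\<lambda>\<omega>. \<zeta> \<omega> * (W r \<omega> - W p \<omega>)) \<in> borel_measurable (F q)"
      using \<zeta>(1) W_measurable_F[of r q] W_measurable_F[of p q] p q r qT by simp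
    show ?thesis
      using expectation_times_increment(1,2)[OF qT(1) q(2,3) Zm Zi] by (simp add: has_bochner_integral_iff)
  qed
  show ?thesis
  proof (cases "p' \<le> q")
    case True
    have "max 0 (min p' q' - max p q) = 0" using True q by (auto simp: max_def min_def)
    then show ?thesis
      using before[of p'] True p by (simp add: \<zeta>_def mult_ac)
  next
    case False
    define r where "r = min p' q'"
    define R where "R = max p' q'"
    have r: "q \<le> r" "r \<le> R" "R \<le> T" "0 \<le> r" "r \<le> T" using False p q by (auto simp: r_def R_def)
    have sq: "has_bochner_integral M (\<lambda>\<omega>. \<zeta> \<omega> * (W r \<omega> - W q \<omega>)\<^sup>2) (expectation \<zeta> * (r - q))"
      using expectation_times_increment(3,4)[OF qT(1) r(1,5) \<zeta>(1) \<zeta>i] by (simp add: has_bochner_integral_iff)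
    have Zi: "integrable M (\<lambda>\<omega>. \<zeta> \<omega> * (W r \<omega> - W q \<omega>))"
      using qT r \<zeta>(2) by (intro bounded_times_integrable[OF _ \<zeta>M] increment_integrable) auto
    have Zm: "(\<lambda>\<omega>. \<zeta> \<omega> * (W r \<omega> - W q \<omega>)) \<in> borel_measurable (F r)"
      using \<zeta>F[of r] W_measurable_F[of r r] W_measurable_F[of q r] r qT by simp
    have after: "has_bochner_integral M (\<lambda>\<omega>. \<zeta> \<omega> * (W r \<omega> - W q \<omega>) * (W R \<omega> - W r \<omega>)) 0"
      using expectation_times_increment(1,2)[OF r(4,2,3) Zm Zi] by (simp add: has_bochner_integral_iff)
    have prod: "(W p' \<omega> - W q \<omega>) * (W q' \<omega> - W q \<omega>)
      = (W r \<omega> - W q \<omega>)\<^sup>2 + (W r \<omega> - W q \<omega>) * (W R \<omega> - W r \<omega>)" for \<omega>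
      by (cases "p' \<le> q'") (simp_all add: r_def R_def power2_eq_square algebra_simps)
    have "(\<xi> \<omega> * (W p' \<omega> - W p \<omega>)) * (\<eta> \<omega> * (W q' \<omega> - W q \<omega>))
      = \<zeta> \<omega> * (W q \<omega> - W p \<omega>) * (W q' \<omega> - W q \<omega>) + \<zeta> \<omega> * ((W p' \<omega> - W q \<omega>) * (W q' \<omega> - W q \<omega>))" for \<omega>
      by (simp add: \<zeta>_def algebra_simps)
    then have eq: "(\<xi> \<omega> * (W p' \<omega> - W p \<omega>)) * (\<eta> \<omega> * (W q' \<omega> - W q \<omega>))
      = \<zeta> \<omega> * (W q \<omega> - W p \<omega>) * (W q' \<omega> - W q \<omega>)
        + (\<zeta> \<omega> * (W r \<omega> - W q \<omega>)\<^sup>2 + \<zeta> \<omega> * (W r \<omega> - W q \<omega>) * (W R \<omega> - W r \<omega>))" for \<omega>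
      unfolding prod by (simp add: distrib_left mult.assoc)
    have "max 0 (min p' q' - max p q) = r - q" using r q by (auto simp: r_def max_def)
    then show ?thesis
      unfolding eq using has_bochner_integral_add[OF before[of q] has_bochner_integral_add[OF sq after]] q(1)
      by (simp add: \<zeta>_def[abs_def])
  qed
qed

lemma increment_cross_moment:
  assumes p: "0 \<le> p" "p \<le> p'" "p' \<le> T" and q: "0 \<le> q" "q \<le> q'" "q' \<le> T"
    and \<xi>: "\<xi> \<in> borel_measurable (F p)" "\<And>\<omega>. \<omega> \<in> space M \<Longrightarrow> \<bar>\<xi> \<omega>\<bar> \<le> C"
    and \<eta>: "\<eta> \<in> borel_measurable (F q)" "\<And>\<omega>. \<omega> \<in> space M \<Longrightarrow> \<bar>\<eta> \<omega>\<bar> \<le> C"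
  shows "has_bochner_integral M
    (\<lambda>\<omega>. (\<xi> \<omega> * (W p' \<omega> - W p \<omega>)) * (\<eta> \<omega> * (W q' \<omega> - W q \<omega>)))
    (expectation (\<lambda>\<omega>. \<xi> \<omega> * \<eta> \<omega>) * max 0 (min p' q' - max p q))"
proof (cases "p \<le> q")
  case True
  then show ?thesis by (rule increment_cross_moment_ordered[OF p _ q(2,3) \<xi> \<eta>])
next
  case False
  then have "q \<le> p" by simp
  from increment_cross_moment_ordered[OF q this p(2,3) \<eta> \<xi>] show ?thesis
    by (simp add: mult.commute min.commute max.commute)
qed

text \<open>
  The intervals may overlap in any way. In this form the isometry applies directly to the difference
  of two elementary processes on unrelated grids.
\<close>
lemma ito_isometry:
  assumes A: "finite A" and t: "t \<le> T"
    and lr: "\<And>a. a \<in> A \<Longrightarrow> 0 \<le> l a" "\<And>a. a \<in> A \<Longrightarrow> l a \<le> r a" "\<And>a. a \<in> A \<Longrightarrow> r a \<le> t"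
    and \<xi>: "\<And>a. a \<in> A \<Longrightarrow> \<xi> a \<in> borel_measurable (F (l a))"
      "\<And>a \<omega>. a \<in> A \<Longrightarrow> \<omega> \<in> space M \<Longrightarrow> \<bar>\<xi> a \<omega>\<bar> \<le> C"
  shows "(\<integral>\<^sup>+\<omega>. ennreal ((\<Sum>a\<in>A. \<xi> a \<omega> * (W (r a) \<omega> - W (l a) \<omega>))\<^sup>2) \<partial>M) =
    (\<integral>\<^sup>+\<omega>. (\<integral>\<^sup>+s\<in>{0..t}. ennreal ((\<Sum>a\<in>A. \<xi> a \<omega> * indicator {l a<..r a} s)\<^sup>2) \<partial>lborel) \<partial>M)"
proof -
  define ov where "ov a b = max 0 (min (r a) (r b) - max (l a) (l b))" for a b
  have sq: "(\<Sum>a\<in>A. u a)\<^sup>2 = (\<Sum>a\<in>A. \<Sum>b\<in>A. u a * u b)" for u :: "_ \<Rightarrow> real"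
    by (simp add: power2_eq_square sum_product)
  have \<xi>M: "\<xi> a \<in> borel_measurable M" if "a \<in> A" for a
    using measurable_F_M[OF \<xi>(1)[OF that]] lr[OF that] t by auto
  have \<xi>i: "integrable M (\<lambda>\<omega>. \<xi> a \<omega> * \<xi> b \<omega>)" if "a \<in> A" "b \<in> A" for a b
  proof (rule integrable_const_bound[of _ "C * C"])
    show "AE \<omega> in M. norm (\<xi> a \<omega> * \<xi> b \<omega>) \<le> C * C"
      using \<xi>(2)[OF that(1)] \<xi>(2)[OF that(2)]
      by (intro AE_I2) (simp add: abs_mult, intro mult_mono, auto intro: order_trans[OF abs_ge_zero])
  qed (use \<xi>M that in auto)
  have L: "has_bochner_integral M (\<lambda>\<omega>. (\<Sum>a\<in>A. \<xi> a \<omega> * (W (r a) \<omega> - W (l a) \<omega>))\<^sup>2)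
    (\<Sum>a\<in>A. \<Sum>b\<in>A. expectation (\<lambda>\<omega>. \<xi> a \<omega> * \<xi> b \<omega>) * ov a b)"
    unfolding sq ov_def using lr t \<xi>
    by (intro has_bochner_integral_sum increment_cross_moment) (auto intro: order_trans)
  define G where "G \<omega> = (\<Sum>a\<in>A. \<Sum>b\<in>A. \<xi> a \<omega> * \<xi> b \<omega> * ov a b)" for \<omega>
  have ind: "has_bochner_integral lborel (\<lambda>s. indicator {u<..v} s :: real) (max 0 (v - u))" for u v :: real
    by (cases "u \<le> v") (auto simp: has_bochner_integral_iff)
  have "has_bochner_integral lborel (\<lambda>s. (\<Sum>a\<in>A. \<xi> a \<omega> * indicator {l a<..r a} s)\<^sup>2) (G \<omega>)" for \<omega>
  proof -
    have e: "\<xi> a \<omega> * indicator {l a<..r a} s * (\<xi> b \<omega> * indicator {l b<..r b} s)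
      = \<xi> a \<omega> * \<xi> b \<omega> * indicator {max (l a) (l b)<..min (r a) (r b)} s" for a b s
      by (auto simp: indicator_def)
    show ?thesis
      unfolding sq e G_def ov_def by (intro has_bochner_integral_sum has_bochner_integral_mult_right ind)
  qed
  note B = this
  have "(\<integral>\<^sup>+s\<in>{0..t}. ennreal ((\<Sum>a\<in>A. \<xi> a \<omega> * indicator {l a<..r a} s)\<^sup>2) \<partial>lborel) = ennreal (G \<omega>)" for \<omega>
  proof -
    have "(\<Sum>a\<in>A. \<xi> a \<omega> * indicator {l a<..r a} s) = 0" if "s \<notin> {0..t}" for s
    proof (intro sum.neutral ballI)
      fix a assume "a \<in> A"
      then have "s \<notin> {l a<..r a}" using lr[of a] that by auto
      then show "\<xi> a \<omega> * indicator {l a<..r a} s = 0" by simp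
    qed
    then have "ennreal ((\<Sum>a\<in>A. \<xi> a \<omega> * indicator {l a<..r a} s)\<^sup>2) * indicator {0..t} s
        = ennreal ((\<Sum>a\<in>A. \<xi> a \<omega> * indicator {l a<..r a} s)\<^sup>2)" for s
      by (cases "s \<in> {0..t}") simp_all
    then have "(\<integral>\<^sup>+s\<in>{0..t}. ennreal ((\<Sum>a\<in>A. \<xi> a \<omega> * indicator {l a<..r a} s)\<^sup>2) \<partial>lborel)
      = (\<integral>\<^sup>+s. ennreal ((\<Sum>a\<in>A. \<xi> a \<omega> * indicator {l a<..r a} s)\<^sup>2) \<partial>lborel)"
      by simp
    also have "\<dots> = ennreal (G \<omega>)"
      using B[of \<omega>] by (subst nn_integral_eq_integral) (auto simp: has_bochner_integral_iff)
    finally show ?thesis .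
  qed
  moreover have "0 \<le> G \<omega>" for \<omega>
    unfolding has_bochner_integral_integral_eq[OF B[of \<omega>], symmetric]
    by (rule Bochner_Integration.integral_nonneg) simp
  moreover have "has_bochner_integral M G (\<Sum>a\<in>A. \<Sum>b\<in>A. expectation (\<lambda>\<omega>. \<xi> a \<omega> * \<xi> b \<omega>) * ov a b)"
    unfolding G_def using \<xi>i
    by (intro has_bochner_integral_sum has_bochner_integral_mult_left) (auto simp: has_bochner_integral_iff)
  ultimately show ?thesis
    using L by (simp add: nn_integral_eq_integral has_bochner_integral_iff)
qed

text \<open>
  The isometry compares the elementary integrals that define the Ito integral with the Riemann sums
  of \<open>\<phi>\<close>. These sums therefore converge to the Ito integral in the mean square, and a pathwise limit
  of them must be a version of it by Fatou's lemma.
\<close>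
lemma ito_integral_deterministic:
  fixes t :: real
  assumes t: "t \<in> {0..T}" and \<phi>: "continuous_on UNIV \<phi>"
    and lip: "\<And>r s. r \<in> {0..t} \<Longrightarrow> s \<in> {0..t} \<Longrightarrow> \<bar>\<phi> s - \<phi> r\<bar> \<le> C * \<bar>s - r\<bar>" "0 \<le> C"
    and I: "has_ito_integral M F W t H I"
    and H: "AE \<omega> in M. \<forall>s\<in>{0..t}. H s \<omega> = \<phi> s"
    and J: "\<And>\<omega>. \<omega> \<in> space M \<Longrightarrow> (\<lambda>N. \<Sum>i<Suc N. \<phi> (t * real i / real (Suc N)) *
        (W (t * real (Suc i) / real (Suc N)) \<omega> - W (t * real i / real (Suc N)) \<omega>)) \<longlonglongrightarrow> J \<omega>"
  shows "AE \<omega> in M. I \<omega> = J \<omega>"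
proof -
  obtain n p \<xi> where el: "\<And>k. elementary_integrand M F t (n k) (p k) (\<xi> k)"
    and Hlim: "(\<lambda>k. \<integral>\<^sup>+\<omega>. (\<integral>\<^sup>+s\<in>{0..t}.
             ennreal ((H s \<omega> - elementary_process (n k) (p k) (\<xi> k) s \<omega>)\<^sup>2) \<partial>lborel) \<partial>M) \<longlonglongrightarrow> 0"
    and Ilim: "(\<lambda>k. \<integral>\<^sup>+\<omega>. ennreal ((I \<omega> - elementary_ito_integral W (n k) (p k) (\<xi> k) \<omega>)\<^sup>2) \<partial>M) \<longlonglongrightarrow> 0"
    and IM [measurable]: "I \<in> borel_measurable M"
    using I unfolding has_ito_integral_def by blast
  define q where "q N i = t * real i / real (Suc N)" for N i
  define RS where "RS N \<omega> = (\<Sum>i<Suc N. \<phi> (q N i) * (W (q N (Suc i)) \<omega> - W (q N i) \<omega>))" for N \<omega>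
  define st where "st N s = (\<Sum>i<Suc N. \<phi> (q N i) * indicator {q N i<..q N (Suc i)} s)" for N s
  have \<phi>m [measurable]: "\<phi> \<in> borel_measurable borel"
    using \<phi> by (rule borel_measurable_continuous_onI)
  have qmono: "q N i \<le> q N (Suc i)" "q N 0 = 0" "q N (Suc N) = t" "0 \<le> q N i" for N i
    using t by (auto simp: q_def divide_right_mono mult_left_mono)
  have qt: "q N i \<le> t" if "i \<le> Suc N" for N i
    using that t by (auto simp: q_def divide_le_eq mult_left_mono)
  have W_q: "W (q N i) \<in> borel_measurable M" if "i \<le> Suc N" for N i
    using qt[OF that] qmono(4)[of N i] t by (intro W_measurable) auto
  have RSm [measurable]: "RS N \<in> borel_measurable M" for N
    unfolding RS_def using W_q by (intro borel_measurable_sum borel_measurable_times borel_measurable_diff) auto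
  have stm [measurable]: "st N \<in> borel_measurable borel" for N
    unfolding st_def by measurable
  let ?EI = "\<lambda>k. elementary_ito_integral W (n k) (p k) (\<xi> k)"
  let ?EP = "\<lambda>k. elementary_process (n k) (p k) (\<xi> k)"
  have pk: "0 \<le> p k 0" "p k (n k) \<le> t" "\<And>i. i < n k \<Longrightarrow> p k i \<le> p k (Suc i)"
    "\<And>i. i < n k \<Longrightarrow> \<xi> k i \<in> borel_measurable (F (p k i))" for k
    using el[of k] by (auto simp: elementary_integrand_def)
  have pmono: "p k i \<le> p k j" if "i \<le> j" "j \<le> n k" for k i j
    by (rule steps_imp_le[of "n k" "p k" i j]) (use pk(3) that in auto)
  have p0t: "0 \<le> p k i" "p k i \<le> t" if "i \<le> n k" for k i
    using pmono[of 0 i k] pmono[of i "n k" k] pk(1,2)[of k] that by auto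
  have \<xi>M: "\<xi> k i \<in> borel_measurable M" if "i < n k" for k i
    using measurable_F_M[OF pk(4)[OF that]] p0t[of i k] that t by auto
  have Wp: "W (p k i) \<in> borel_measurable M" if "i \<le> n k" for k i
    using p0t[OF that] t by (intro W_measurable) auto
  have EIm [measurable]: "?EI k \<in> borel_measurable M" for k
    unfolding elementary_ito_integral_def[abs_def] using \<xi>M Wp
    by (intro borel_measurable_sum borel_measurable_times borel_measurable_diff) auto
  have EPm [measurable]: "(\<lambda>(\<omega>, s). ?EP k s \<omega>) \<in> borel_measurable (M \<Otimes>\<^sub>M lborel)" for k
    unfolding elementary_process_def case_prod_beta
    by (intro borel_measurable_sum borel_measurable_times)
       (auto intro!: measurable_compose[OF measurable_fst \<xi>M] measurable_compose[OF measurable_snd])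
  have EPs [measurable]: "\<omega> \<in> space M \<Longrightarrow> (\<lambda>s. ?EP k s \<omega>) \<in> borel_measurable lborel" for k \<omega>
    unfolding elementary_process_def by measurable
  have iso: "(\<integral>\<^sup>+\<omega>. ennreal ((?EI k \<omega> - RS N \<omega>)\<^sup>2) \<partial>M) =
    (\<integral>\<^sup>+\<omega>. (\<integral>\<^sup>+s\<in>{0..t}. ennreal ((?EP k s \<omega> - st N s)\<^sup>2) \<partial>lborel) \<partial>M)" for k N
  proof -
    obtain C1 where C1: "\<And>i \<omega>. i < n k \<Longrightarrow> \<omega> \<in> space M \<Longrightarrow> \<bar>\<xi> k i \<omega>\<bar> \<le> C1"
      using el[of k] unfolding elementary_integrand_def by blast
    define C2 where "C2 = max C1 (Max ((\<lambda>i. \<bar>\<phi> (q N i)\<bar>) ` {..<Suc N}))"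
    have C2: "\<bar>\<phi> (q N i)\<bar> \<le> C2" if "i < Suc N" for i
      unfolding C2_def using that by (intro max.coboundedI2 Max_ge) auto
    \<comment> \<open>both elementary processes together form one family of intervals, indexed by a disjoint union\<close>
    define A where "A = {..<n k} <+> {..<Suc N}"
    define l where "l = case_sum (p k) (q N)"
    define r where "r = case_sum (\<lambda>i. p k (Suc i)) (\<lambda>i. q N (Suc i))"
    define \<zeta> where "\<zeta> = case_sum (\<xi> k) (\<lambda>i (\<omega>::'a). - \<phi> (q N i))"
    have sums: "(\<Sum>a\<in>A. \<zeta> a \<omega> * (W (r a) \<omega> - W (l a) \<omega>)) = ?EI k \<omega> - RS N \<omega>"
      "(\<Sum>a\<in>A. \<zeta> a \<omega> * indicator {l a<..r a} s) = ?EP k s \<omega> - st N s" for \<omega> s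
      unfolding A_def sum.Plus[OF finite_lessThan finite_lessThan] \<zeta>_def l_def r_def
        elementary_ito_integral_def elementary_process_def RS_def st_def
      by (simp_all add: sum_negf)
    have "(\<integral>\<^sup>+\<omega>. ennreal ((\<Sum>a\<in>A. \<zeta> a \<omega> * (W (r a) \<omega> - W (l a) \<omega>))\<^sup>2) \<partial>M) =
      (\<integral>\<^sup>+\<omega>. (\<integral>\<^sup>+s\<in>{0..t}. ennreal ((\<Sum>a\<in>A. \<zeta> a \<omega> * indicator {l a<..r a} s)\<^sup>2) \<partial>lborel) \<partial>M)"
    proof (rule ito_isometry[where C = C2])
      show "\<zeta> a \<in> borel_measurable (F (l a))" if "a \<in> A" for a
        using that pk(4) by (auto simp: A_def \<zeta>_def l_def)
      show "\<bar>\<zeta> a \<omega>\<bar> \<le> C2" if "a \<in> A" "\<omega> \<in> space M" for a \<omega>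
        using that C1 C2 by (auto simp: A_def \<zeta>_def C2_def intro: max.coboundedI1)
    qed (use t pk qmono qt p0t in \<open>auto simp: A_def l_def r_def\<close>)
    then show ?thesis unfolding sums .
  qed
  have st_close: "(\<phi> s - st N s)\<^sup>2 \<le> (C * t / Suc N)\<^sup>2" if s: "s \<in> {0<..t}" for N s
  proof -
    have one: "(\<Sum>i<Suc N. indicator {q N i<..q N (Suc i)} s) = (1::real)"
      using uniform_steps_indicator[of "q N" "Suc N" s] qmono s by (auto simp: indicator_def)
    have "\<phi> s - st N s = (\<Sum>i<Suc N. (\<phi> s - \<phi> (q N i)) * indicator {q N i<..q N (Suc i)} s)"
      unfolding st_def left_diff_distrib sum_subtractf sum_distrib_left[symmetric] one by simp
    also have "\<bar>\<dots>\<bar> \<le> (\<Sum>i<Suc N. (C * t / Suc N) * indicator {q N i<..q N (Suc i)} s)"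
    proof (intro order_trans[OF sum_abs] sum_mono)
      fix i assume i: "i \<in> {..<Suc N}"
      show "\<bar>(\<phi> s - \<phi> (q N i)) * indicator {q N i<..q N (Suc i)} s\<bar>
        \<le> (C * t / Suc N) * indicator {q N i<..q N (Suc i)} s"
      proof (cases "s \<in> {q N i<..q N (Suc i)}")
        case True
        have "\<bar>\<phi> s - \<phi> (q N i)\<bar> \<le> C * \<bar>s - q N i\<bar>"
          using s qmono(4)[of N i] qt[of i N] i by (intro lip) auto
        also have "\<dots> \<le> C * (t / Suc N)"
        proof (rule mult_left_mono[OF _ lip(2)])
          have "q N (Suc i) = q N i + t / Suc N"
            unfolding q_def by (simp add: distrib_left add_divide_distrib)
          then show "\<bar>s - q N i\<bar> \<le> t / Suc N" using True by auto
        qed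
        finally show ?thesis using True by simp
      qed simp
    qed
    also have "\<dots> = C * t / Suc N" unfolding sum_distrib_left[symmetric] one by simp
    finally show ?thesis using t lip(2) by (intro abs_le_square_iff[THEN iffD1]) auto
  qed
  define K where "K N = (C * t / Suc N)\<^sup>2 * t" for N :: nat
  have stK: "(\<integral>\<^sup>+s\<in>{0..t}. ennreal ((\<phi> s - st N s)\<^sup>2) \<partial>lborel) \<le> ennreal (K N)" for N
  proof -
    have "(\<integral>\<^sup>+s\<in>{0..t}. ennreal ((\<phi> s - st N s)\<^sup>2) \<partial>lborel)
      \<le> (\<integral>\<^sup>+s\<in>{0..t}. ennreal ((C * t / Suc N)\<^sup>2) \<partial>lborel)"
    proof (rule nn_integral_mono_AE)
      \<comment> \<open>the step function vanishes at \<open>0\<close>, where no interval has begun\<close>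
      have "AE s in lborel. s \<noteq> (0::real)" by (rule AE_lborel_singleton)
      then show "AE s in lborel. ennreal ((\<phi> s - st N s)\<^sup>2) * indicator {0..t} s
        \<le> ennreal ((C * t / Suc N)\<^sup>2) * indicator {0..t} s"
        by eventually_elim (use st_close[of _ N] in \<open>auto simp: indicator_def intro!: ennreal_leI\<close>)
    qed
    also have "\<dots> = ennreal (K N)"
      using t by (simp add: nn_integral_cmult_indicator K_def ennreal_mult)
    finally show ?thesis .
  qed
  define eI where "eI k = (\<integral>\<^sup>+\<omega>. ennreal ((I \<omega> - ?EI k \<omega>)\<^sup>2) \<partial>M)" for k
  define eH where "eH k = (\<integral>\<^sup>+\<omega>. (\<integral>\<^sup>+s\<in>{0..t}. ennreal ((\<phi> s - ?EP k s \<omega>)\<^sup>2) \<partial>lborel) \<partial>M)" for k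
  have eH_lim: "eH \<longlonglongrightarrow> 0"
  proof -
    have "eH k = (\<integral>\<^sup>+\<omega>. (\<integral>\<^sup>+s\<in>{0..t}. ennreal ((H s \<omega> - ?EP k s \<omega>)\<^sup>2) \<partial>lborel) \<partial>M)" for k
      unfolding eH_def
    proof (rule nn_integral_cong_AE)
      show "AE \<omega> in M. (\<integral>\<^sup>+s\<in>{0..t}. ennreal ((\<phi> s - ?EP k s \<omega>)\<^sup>2) \<partial>lborel)
        = (\<integral>\<^sup>+s\<in>{0..t}. ennreal ((H s \<omega> - ?EP k s \<omega>)\<^sup>2) \<partial>lborel)"
        using H by eventually_elim (auto intro!: nn_integral_cong simp: indicator_def)
    qed
    then show ?thesis using Hlim by (simp add: eH_def[abs_def])
  qed
  have bound: "(\<integral>\<^sup>+\<omega>. ennreal ((I \<omega> - RS N \<omega>)\<^sup>2) \<partial>M) \<le> 2 * eI k + 2 * (2 * eH k + 2 * ennreal (K N))" for k N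
  proof -
    have sq: "ennreal ((x - z)\<^sup>2) \<le> 2 * ennreal ((x - y)\<^sup>2) + 2 * ennreal ((y - z)\<^sup>2)" for x y z :: real
    proof -
      have "ennreal ((x - z)\<^sup>2) \<le> ennreal (2 * (x - y)\<^sup>2 + 2 * (y - z)\<^sup>2)"
        by (intro ennreal_leI square_sum_le)
      then show ?thesis by (simp add: ennreal_plus ennreal_mult)
    qed
    have in1: "(\<integral>\<^sup>+s\<in>{0..t}. ennreal ((?EP k s \<omega> - st N s)\<^sup>2) \<partial>lborel)
      \<le> 2 * (\<integral>\<^sup>+s\<in>{0..t}. ennreal ((\<phi> s - ?EP k s \<omega>)\<^sup>2) \<partial>lborel) + 2 * ennreal (K N)"
      if \<omega>: "\<omega> \<in> space M" for \<omega>
    proof -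
      note [measurable] = EPs[OF \<omega>, of k]
      have "(\<integral>\<^sup>+s\<in>{0..t}. ennreal ((?EP k s \<omega> - st N s)\<^sup>2) \<partial>lborel)
        \<le> (\<integral>\<^sup>+s. 2 * (ennreal ((\<phi> s - ?EP k s \<omega>)\<^sup>2) * indicator {0..t} s)
            + 2 * (ennreal ((\<phi> s - st N s)\<^sup>2) * indicator {0..t} s) \<partial>lborel)"
        using sq[of "?EP k _ \<omega>" "st N _" "\<phi> _"]
        by (intro nn_integral_mono) (auto simp: indicator_def power2_commute)
      also have "\<dots> = 2 * (\<integral>\<^sup>+s\<in>{0..t}. ennreal ((\<phi> s - ?EP k s \<omega>)\<^sup>2) \<partial>lborel)
          + 2 * (\<integral>\<^sup>+s\<in>{0..t}. ennreal ((\<phi> s - st N s)\<^sup>2) \<partial>lborel)"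
        by (subst nn_integral_add) (auto simp: nn_integral_cmult)
      also have "\<dots> \<le> 2 * (\<integral>\<^sup>+s\<in>{0..t}. ennreal ((\<phi> s - ?EP k s \<omega>)\<^sup>2) \<partial>lborel) + 2 * ennreal (K N)"
        by (intro add_mono mult_left_mono stK) auto
      finally show ?thesis .
    qed
    have m1: "(\<lambda>\<omega>. \<integral>\<^sup>+s\<in>{0..t}. ennreal ((\<phi> s - ?EP k s \<omega>)\<^sup>2) \<partial>lborel) \<in> borel_measurable M"
    proof (rule lborel.borel_measurable_nn_integral)
      show "(\<lambda>(\<omega>, s). ennreal ((\<phi> s - ?EP k s \<omega>)\<^sup>2) * indicator {0..t} s) \<in> borel_measurable (M \<Otimes>\<^sub>M lborel)"
        using EPm[of k] unfolding case_prod_beta by measurable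
    qed
    have "(\<integral>\<^sup>+\<omega>. ennreal ((I \<omega> - RS N \<omega>)\<^sup>2) \<partial>M)
      \<le> (\<integral>\<^sup>+\<omega>. 2 * ennreal ((I \<omega> - ?EI k \<omega>)\<^sup>2) + 2 * ennreal ((?EI k \<omega> - RS N \<omega>)\<^sup>2) \<partial>M)"
      by (intro nn_integral_mono sq)
    also have "\<dots> = 2 * eI k + 2 * (\<integral>\<^sup>+\<omega>. ennreal ((?EI k \<omega> - RS N \<omega>)\<^sup>2) \<partial>M)"
      unfolding eI_def by (subst nn_integral_add) (auto simp: nn_integral_cmult)
    also have "\<dots> = 2 * eI k + 2 * (\<integral>\<^sup>+\<omega>. (\<integral>\<^sup>+s\<in>{0..t}. ennreal ((?EP k s \<omega> - st N s)\<^sup>2) \<partial>lborel) \<partial>M)"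
      unfolding iso ..
    also have "\<dots> \<le> 2 * eI k + 2 * (\<integral>\<^sup>+\<omega>. 2 * (\<integral>\<^sup>+s\<in>{0..t}. ennreal ((\<phi> s - ?EP k s \<omega>)\<^sup>2) \<partial>lborel)
        + 2 * ennreal (K N) \<partial>M)"
      by (intro add_left_mono mult_left_mono nn_integral_mono in1) auto
    also have "(\<integral>\<^sup>+\<omega>. 2 * (\<integral>\<^sup>+s\<in>{0..t}. ennreal ((\<phi> s - ?EP k s \<omega>)\<^sup>2) \<partial>lborel) + 2 * ennreal (K N) \<partial>M)
      = 2 * eH k + 2 * ennreal (K N)"
      unfolding eH_def using m1
      by (subst nn_integral_add) (auto simp: nn_integral_cmult emeasure_space_1)
    finally show ?thesis .
  qed
  have boundN: "(\<integral>\<^sup>+\<omega>. ennreal ((I \<omega> - RS N \<omega>)\<^sup>2) \<partial>M) \<le> 4 * ennreal (K N)" for N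
  proof -
    have "(\<lambda>k. 2 * eI k + 2 * (2 * eH k + 2 * ennreal (K N))) \<longlonglongrightarrow> 2 * 0 + 2 * (2 * 0 + 2 * ennreal (K N))"
      using Ilim eH_lim unfolding eI_def[abs_def]
      by (intro tendsto_add ennreal_tendsto_cmult tendsto_const) auto
    then have "(\<integral>\<^sup>+\<omega>. ennreal ((I \<omega> - RS N \<omega>)\<^sup>2) \<partial>M) \<le> 2 * 0 + 2 * (2 * 0 + 2 * ennreal (K N))"
      by (rule LIMSEQ_le_const) (use bound in blast)
    then show ?thesis by (simp add: mult.assoc[symmetric])
  qed
  have Jm [measurable]: "J \<in> borel_measurable M"
  proof (rule borel_measurable_LIMSEQ_metric[of RS])
    show "(\<lambda>N. RS N \<omega>) \<longlonglongrightarrow> J \<omega>" if "\<omega> \<in> space M" for \<omega>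
      using J[OF that] unfolding RS_def q_def .
  qed (rule RSm)
  have "(\<integral>\<^sup>+\<omega>. ennreal ((I \<omega> - J \<omega>)\<^sup>2) \<partial>M) = (\<integral>\<^sup>+\<omega>. liminf (\<lambda>N. ennreal ((I \<omega> - RS N \<omega>)\<^sup>2)) \<partial>M)"
  proof (rule nn_integral_cong)
    fix \<omega> assume "\<omega> \<in> space M"
    then have "(\<lambda>N. RS N \<omega>) \<longlonglongrightarrow> J \<omega>" using J[of \<omega>] unfolding RS_def q_def by blast
    then have "(\<lambda>N. ennreal ((I \<omega> - RS N \<omega>)\<^sup>2)) \<longlonglongrightarrow> ennreal ((I \<omega> - J \<omega>)\<^sup>2)"
      by (intro tendsto_ennrealI tendsto_intros)
    then show "ennreal ((I \<omega> - J \<omega>)\<^sup>2) = liminf (\<lambda>N. ennreal ((I \<omega> - RS N \<omega>)\<^sup>2))"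
      by (rule lim_imp_Liminf[OF trivial_limit_sequentially, symmetric])
  qed
  also have "\<dots> \<le> liminf (\<lambda>N. \<integral>\<^sup>+\<omega>. ennreal ((I \<omega> - RS N \<omega>)\<^sup>2) \<partial>M)"
    by (rule nn_integral_liminf) simp
  also have "\<dots> \<le> liminf (\<lambda>N. 4 * ennreal (K N))"
    by (intro Liminf_mono always_eventually allI boundN)
  also have "\<dots> = 0"
  proof -
    have "(\<lambda>N. C * t / Suc N) \<longlonglongrightarrow> 0" by (rule LIMSEQ_Suc[OF lim_const_over_n])
    then have "K \<longlonglongrightarrow> 0\<^sup>2 * t"
      unfolding K_def by (intro tendsto_mult tendsto_power tendsto_const)
    then have "(\<lambda>N. 4 * ennreal (K N)) \<longlonglongrightarrow> 4 * ennreal (0\<^sup>2 * t)"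
      by (intro ennreal_tendsto_cmult tendsto_ennrealI) auto
    from lim_imp_Liminf[OF trivial_limit_sequentially this] show ?thesis by simp
  qed
  finally have "(\<integral>\<^sup>+\<omega>. ennreal ((I \<omega> - J \<omega>)\<^sup>2) \<partial>M) = 0" by simp
  then have "AE \<omega> in M. ennreal ((I \<omega> - J \<omega>)\<^sup>2) = 0"
    by (subst (asm) nn_integral_0_iff_AE) auto
  then show ?thesis by eventually_elim (simp add: ennreal_eq_0_iff)
qed

end

section \<open>Characteristic functions of weighted sums of increments\<close>

context brownian_setting begin

lemma expectation_times_iexp:
  fixes Z :: "'a \<Rightarrow> complex"
  assumes s: "0 \<le> s" "s \<le> t" "t \<le> T" and Z: "Z \<in> borel_measurable (F s)" "integrable M Z"
  shows "(CLINT \<omega>|M. Z \<omega> * iexp (c * (W t \<omega> - W s \<omega>))) = (CLINT \<omega>|M. Z \<omega>) * exp (- (c\<^sup>2 * (t - s)) / 2)"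
proof -
  have I: "indep_var borel Z borel (\<lambda>\<omega>. iexp (c * (W t \<omega> - W s \<omega>)))"
    by (rule indep_var_increment[OF s Z(1)]) measurable
  have "integrable M (\<lambda>\<omega>. iexp (c * (W t \<omega> - W s \<omega>)))"
    by (rule integrable_const_bound[of _ 1]) (use s in auto)
  from indep_var_lebesgue_integral[OF I Z(2) this] show ?thesis
    using increment_iexp[OF s, of c] by simp
qed

definition increment_sum :: "(nat \<Rightarrow> real) \<Rightarrow> (nat \<Rightarrow> real) \<Rightarrow> nat \<Rightarrow> 'a \<Rightarrow> real" where
  "increment_sum c p n \<omega> = (\<Sum>i<n. c i * (W (p (Suc i)) \<omega> - W (p i) \<omega>))"

text \<open>
  The variance of the corresponding weighted sum of increments.
\<close>
definition increment_energy :: "(nat \<Rightarrow> real) \<Rightarrow> (nat \<Rightarrow> real) \<Rightarrow> nat \<Rightarrow> real" where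
  "increment_energy c p n = (\<Sum>i<n. (c i)\<^sup>2 * (p (Suc i) - p i))"

lemma increment_sum_measurable_F:
  assumes "0 \<le> p 0" "\<And>i. i < n \<Longrightarrow> p i \<le> p (Suc i)" "p n \<le> t" "t \<le> T"
  shows "increment_sum c p n \<in> borel_measurable (F t)"
proof -
  have "0 \<le> p i \<and> p i \<le> t" if "i \<le> n" for i
    using steps_imp_le[of n p 0 i] steps_imp_le[of n p i n] assms that by auto
  then have "W (p i) \<in> borel_measurable (F t)" if "i \<le> n" for i
    using that assms(4) by (intro W_measurable_F) auto
  then show ?thesis
    unfolding increment_sum_def
    by (intro borel_measurable_sum borel_measurable_times borel_measurable_diff) auto
qed

text \<open>
  Carrying the event \<open>A\<close> along yields not only the law of the sum but also its independence of the
  past up to time \<open>p 0\<close>.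
\<close>
lemma increment_sum_iexp:
  assumes p: "0 \<le> p 0" "\<And>i. i < n \<Longrightarrow> p i \<le> p (Suc i)" "p n \<le> T" and A: "A \<in> sets (F (p 0))"
  shows "(CLINT \<omega>|M. indicator A \<omega> * iexp (\<theta> * increment_sum c p n \<omega>))
    = prob A * exp (- (\<theta>\<^sup>2 * increment_energy c p n) / 2)"
  using p(2,3)
proof (induction n)
  case 0
  have "A \<in> events" using A p(1) 0 subalgebra_F[of "p 0"] by (auto simp: subalgebra_def)
  then have "(CLINT \<omega>|M. complex_of_real (indicator A \<omega>)) = complex_of_real (prob A)"
    by (subst integral_complex_of_real) simp
  moreover have "(\<lambda>\<omega>. complex_of_real (indicator A \<omega>)) = indicator A"
    by (auto simp: indicator_def)
  ultimately show ?case
    by (simp add: increment_sum_def increment_energy_def)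
next
  case (Suc n)
  define Z where "Z \<omega> = indicator A \<omega> * iexp (\<theta> * increment_sum c p n \<omega>)" for \<omega>
  have pn: "0 \<le> p n" "p n \<le> p (Suc n)" "p (Suc n) \<le> T" "p 0 \<le> p n" "p n \<le> T"
    using Suc.prems steps_imp_le[of n p 0 n] p(1) Suc.prems(1)[of n] by (auto intro: order_trans)
  have S: "increment_sum c p n \<in> borel_measurable (F (p n))"
    using Suc.prems pn p(1) by (intro increment_sum_measurable_F) auto
  have "A \<in> sets (F (p n))" using A sets_F_mono[of "p 0" "p n"] pn p(1) by auto
  then have Zm: "Z \<in> borel_measurable (F (p n))"
    unfolding Z_def using S by measurable
  then have ZM: "Z \<in> borel_measurable M" using measurable_F_M[OF Zm] pn by auto
  have Zi: "integrable M Z"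
    by (rule integrable_const_bound[OF _ ZM, of 1]) (auto simp: Z_def norm_mult indicator_def)
  have "(CLINT \<omega>|M. indicator A \<omega> * iexp (\<theta> * increment_sum c p (Suc n) \<omega>))
    = (CLINT \<omega>|M. Z \<omega> * iexp (\<theta> * c n * (W (p (Suc n)) \<omega> - W (p n) \<omega>)))"
    by (rule Bochner_Integration.integral_cong[OF refl])
       (simp add: Z_def increment_sum_def distrib_left exp_add mult_ac)
  also have "\<dots> = (CLINT \<omega>|M. Z \<omega>) * exp (- ((\<theta> * c n)\<^sup>2 * (p (Suc n) - p n)) / 2)"
    using pn by (intro expectation_times_iexp Zm Zi) auto
  also have "(CLINT \<omega>|M. Z \<omega>) = prob A * exp (- (\<theta>\<^sup>2 * increment_energy c p n) / 2)"
    unfolding Z_def using Suc.prems pn by (intro Suc.IH) auto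
  also have "complex_of_real (prob A * exp (- (\<theta>\<^sup>2 * increment_energy c p n) / 2))
      * complex_of_real (exp (- ((\<theta> * c n)\<^sup>2 * (p (Suc n) - p n)) / 2))
    = complex_of_real (prob A * exp (- (\<theta>\<^sup>2 * increment_energy c p (Suc n)) / 2))"
  proof -
    have e: "- (\<theta>\<^sup>2 * increment_energy c p (Suc n)) / 2
      = - (\<theta>\<^sup>2 * increment_energy c p n) / 2 + - ((\<theta> * c n)\<^sup>2 * (p (Suc n) - p n)) / 2"
      unfolding increment_energy_def sum.lessThan_Suc power_mult_distrib by (simp add: field_simps)
    show ?thesis unfolding e exp_add by (simp only: of_real_mult mult.assoc)
  qed
  finally show ?case .
qed

lemma increment_sum_limit_iexp:
  assumes p: "\<And>N. p N 0 = s" "\<And>N i. i < n N \<Longrightarrow> p N i \<le> p N (Suc i)" "\<And>N. p N (n N) \<le> T"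
    and s: "0 \<le> s" and A: "A \<in> sets (F s)"
    and lim: "\<And>\<omega>. \<omega> \<in> space M \<Longrightarrow> (\<lambda>N. increment_sum (c N) (p N) (n N) \<omega>) \<longlonglongrightarrow> X \<omega>"
  shows "(\<lambda>N. complex_of_real (prob A * exp (- (\<theta>\<^sup>2 * increment_energy (c N) (p N) (n N)) / 2)))
    \<longlonglongrightarrow> (CLINT \<omega>|M. indicator A \<omega> * iexp (\<theta> * X \<omega>))"
proof -
  have m: "increment_sum (c N) (p N) (n N) \<in> borel_measurable M" for N
    using increment_sum_measurable_F[of "p N" "n N" T] measurable_F_M[of _ T] p s T_pos by auto
  have "s \<le> T" using p(1)[of 0] p(3)[of 0] steps_imp_le[of "n 0" "p 0" 0 "n 0"] p(2)[of _ 0] by auto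
  then have AM: "A \<in> events" using A s subalgebra_F[of s] by (auto simp: subalgebra_def)
  have X: "X \<in> borel_measurable M"
    using lim m by (rule borel_measurable_LIMSEQ_metric[rotated])
  have "(\<lambda>N. CLINT \<omega>|M. indicator A \<omega> * iexp (\<theta> * increment_sum (c N) (p N) (n N) \<omega>))
    \<longlonglongrightarrow> (CLINT \<omega>|M. indicator A \<omega> * iexp (\<theta> * X \<omega>))"
  proof (rule integral_dominated_convergence[where w = "\<lambda>_. 1"])
    show "AE \<omega> in M. (\<lambda>N. indicator A \<omega> * iexp (\<theta> * increment_sum (c N) (p N) (n N) \<omega>))
        \<longlonglongrightarrow> indicator A \<omega> * iexp (\<theta> * X \<omega>)"
      using lim by (intro AE_I2 tendsto_intros) auto
  qed (use m AM X in \<open>auto simp: norm_mult indicator_def\<close>)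
  then show ?thesis
    using increment_sum_iexp[of "p _" "n _" A \<theta> "c _"] p s A by simp
qed

text \<open>
  Conditionally on \<open>A\<close>, the variable \<open>X / sqrt v\<close> has the characteristic function of the standard
  normal law, whatever the event \<open>A\<close> is. By Levy's uniqueness theorem all these conditional laws
  agree, and that is independence of the sigma-algebra at time \<open>s\<close>.
\<close>
lemma indep_normal_if_iexp:
  assumes X: "X \<in> borel_measurable M" and s: "s \<in> {0..T}" and v: "0 < v"
    and ch: "\<And>A \<theta>. A \<in> sets (F s) \<Longrightarrow>
      (CLINT \<omega>|M. indicator A \<omega> * iexp (\<theta> * X \<omega>)) = prob A * exp (- (\<theta>\<^sup>2 * v) / 2)"
  shows "distr M borel (\<lambda>\<omega>. X \<omega> / sqrt v) = std_normal_distribution"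
    and "Y \<in> measurable (F s) N \<Longrightarrow>
      distr M (N \<Otimes>\<^sub>M borel) (\<lambda>\<omega>. (Y \<omega>, X \<omega> / sqrt v)) = distr M N Y \<Otimes>\<^sub>M std_normal_distribution"
proof -
  let ?X = "\<lambda>\<omega>. X \<omega> / sqrt v"
  have Xm [measurable]: "?X \<in> borel_measurable M" using X by simp
  have FM: "sets (F s) \<subseteq> events" using s subalgebra_F[of s] by (auto simp: subalgebra_def)
  have law: "distr (uniform_measure M A) borel ?X = std_normal_distribution"
    if A: "A \<in> sets (F s)" "prob A \<noteq> 0" for A
  proof -
    have AM: "A \<in> events" using A FM by auto
    have A0: "emeasure M A \<noteq> 0" using A(2) by (simp add: emeasure_eq_measure)
    interpret A: prob_space "uniform_measure M A"
      by (rule prob_space_uniform_measure[OF A0]) simp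
    have XA: "?X \<in> borel_measurable (uniform_measure M A)"
      using Xm by (simp add: measurable_def)
    have um: "uniform_measure M A = density M (\<lambda>\<omega>. ennreal (indicator A \<omega> / prob A))"
      unfolding uniform_measure_def
    proof (rule density_cong)
      show "AE \<omega> in M. indicator A \<omega> / emeasure M A = ennreal (indicator A \<omega> / prob A)"
        using A(2) by (auto simp: indicator_def emeasure_eq_measure divide_ennreal[symmetric] zero_less_measure_iff)
    qed (use AM in auto)
    have "char (distr (uniform_measure M A) borel ?X) \<theta> = char std_normal_distribution \<theta>" for \<theta>
    proof -
      have "char (distr (uniform_measure M A) borel ?X) \<theta> = (CLINT \<omega>|uniform_measure M A. iexp (\<theta> * ?X \<omega>))"
        unfolding char_def by (subst integral_distr[OF XA]) auto
      also have "\<dots> = (CLINT \<omega>|M. (indicator A \<omega> / prob A) *\<^sub>R iexp (\<theta> * ?X \<omega>))"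
        unfolding um using AM X by (subst integral_density) auto
      also have "\<dots> = (CLINT \<omega>|M. (1 / prob A) *\<^sub>R (indicator A \<omega> * iexp ((\<theta> / sqrt v) * X \<omega>)))"
        by (rule Bochner_Integration.integral_cong[OF refl]) (auto simp: indicator_def scaleR_conv_of_real)
      also have "\<dots> = (1 / prob A) *\<^sub>R (CLINT \<omega>|M. indicator A \<omega> * iexp ((\<theta> / sqrt v) * X \<omega>))"
        by simp
      also have "\<dots> = complex_of_real (exp (- ((\<theta> / sqrt v)\<^sup>2 * v) / 2))"
        unfolding ch[OF A(1)] using A(2) by (simp add: scaleR_conv_of_real)
      also have "\<dots> = char std_normal_distribution \<theta>"
        using v by (simp add: char_std_normal_distribution power_divide)
      finally show ?thesis .
    qed
    then show ?thesis
      using A.real_distribution_distr[OF XA] real_dist_normal_dist by (intro Levy_uniqueness) auto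
  qed
  have prob_eq: "prob (A \<inter> (?X -` B \<inter> space M)) = prob A * measure std_normal_distribution B"
    if A: "A \<in> sets (F s)" and B: "B \<in> sets borel" for A B
  proof (cases "prob A = 0")
    case True
    have "prob (A \<inter> (?X -` B \<inter> space M)) \<le> prob A"
      using A FM by (intro finite_measure_mono) auto
    then show ?thesis using True measure_nonneg[of M "A \<inter> (?X -` B \<inter> space M)"] by simp
  next
    case False
    have AM: "A \<in> events" using A FM by auto
    have XA: "?X \<in> borel_measurable (uniform_measure M A)"
      using Xm by (simp add: measurable_def)
    have XB: "?X -` B \<inter> space M \<in> events" using measurable_sets[OF Xm B] .
    have "measure std_normal_distribution B = measure (uniform_measure M A) (?X -` B \<inter> space M)"
      unfolding law[OF A False, symmetric] using B XA by (simp add: measure_distr)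
    also have "\<dots> = prob (A \<inter> (?X -` B \<inter> space M)) / prob A"
      using AM XB False by (intro measure_uniform_measure) (auto simp: emeasure_eq_measure)
    finally show ?thesis using False by simp
  qed
  have spF: "space M \<in> sets (F s)" using sets.top[of "F s"] unfolding space_F[OF s] .
  have marg: "prob (?X -` B \<inter> space M) = measure std_normal_distribution B" if "B \<in> sets borel" for B
    using prob_eq[OF spF that] by (simp add: prob_space Int_assoc[symmetric] Int_commute)
  interpret N: prob_space std_normal_distribution
    using real_dist_normal_dist by (simp add: real_distribution_def)
  show "distr M borel ?X = std_normal_distribution"
  proof (rule measure_eqI)
    fix B assume "B \<in> sets (distr M borel ?X)"
    then have B: "B \<in> sets borel" by simp
    show "emeasure (distr M borel ?X) B = emeasure std_normal_distribution B"
      using marg[OF B] B by (simp add: emeasure_distr emeasure_eq_measure N.emeasure_eq_measure)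
  qed simp
  assume Y: "Y \<in> measurable (F s) N"
  have YM [measurable]: "random_variable N Y" using measurable_F_M[OF Y s] .
  interpret Y: prob_space "distr M N Y" by (rule prob_space_distr) (rule YM)
  show "distr M (N \<Otimes>\<^sub>M borel) (\<lambda>\<omega>. (Y \<omega>, ?X \<omega>)) = distr M N Y \<Otimes>\<^sub>M std_normal_distribution"
  proof (rule pair_measure_eqI[symmetric])
    show "sigma_finite_measure (distr M N Y)" "sigma_finite_measure std_normal_distribution"
      by unfold_locales
    show "sets (distr M N Y \<Otimes>\<^sub>M std_normal_distribution) = sets (distr M (N \<Otimes>\<^sub>M borel) (\<lambda>\<omega>. (Y \<omega>, ?X \<omega>)))"
      by (simp cong: sets_pair_measure_cong)
    fix A B assume "A \<in> sets (distr M N Y)" "B \<in> sets std_normal_distribution"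
    then have A: "A \<in> sets N" and B: "B \<in> sets borel" by auto
    have "Y -` A \<inter> space M \<in> sets (F s)" using measurable_sets[OF Y A] s by simp
    from prob_eq[OF this B]
    have "prob ((\<lambda>\<omega>. (Y \<omega>, ?X \<omega>)) -` (A \<times> B) \<inter> space M)
        = prob (Y -` A \<inter> space M) * measure std_normal_distribution B"
      by (simp add: vimage_def Int_def conj_ac)
    then show "emeasure (distr M N Y) A * emeasure std_normal_distribution B
        = emeasure (distr M (N \<Otimes>\<^sub>M borel) (\<lambda>\<omega>. (Y \<omega>, ?X \<omega>))) (A \<times> B)"
      using A B by (simp add: emeasure_distr emeasure_eq_measure N.emeasure_eq_measure ennreal_mult)
  qed
qed

end

section \<open>Arrival points of travellers with controlled speed\<close>

locale speed_profile =
  fixes g :: "real \<Rightarrow> real" and a :: real and d :: real and T :: real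
  assumes g_cont: "continuous_on UNIV g" and g_nonneg: "\<And>x. 0 \<le> g x" and g_le: "\<And>x. g x \<le> 4"
    and g_low: "\<And>x. x \<le> a \<Longrightarrow> g x = 0" and g_high: "\<And>x. d \<le> x \<Longrightarrow> g x = 4"
    and ad: "0 < a" "a < d" "d < T"
begin

text \<open>
  The time in which a traveller of speed \<open>1 + g x * v\<close> gets from \<open>a\<close> to \<open>x\<close>. The parameter \<open>v\<close>
  enters through the integrand only, so inverting this function gives direct access to the
  dependence of the position on \<open>v\<close>.
\<close>
definition travel_time :: "real \<Rightarrow> real \<Rightarrow> real" where
  "travel_time v x = integral {a..x} (\<lambda>y. 1 / (1 + g y * v))"

lemma denom_ge: "0 \<le> v \<Longrightarrow> 1 \<le> 1 + g y * v"
  using g_nonneg[of y] by simp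

lemma denom_le: "0 \<le> v \<Longrightarrow> 1 + g y * v \<le> 1 + 4 * v"
  using g_le[of y] by (simp add: mult_right_mono)

lemma pace_continuous:
  assumes "0 \<le> v"
  shows "continuous_on A (\<lambda>y. 1 / (1 + g y * v))"
proof -
  have "1 + g y * v \<noteq> 0" for y using denom_ge[OF assms, of y] by linarith
  then show ?thesis
    using continuous_on_subset[OF g_cont subset_UNIV, of A] by (intro continuous_intros) auto
qed

lemma pace_integrable: "0 \<le> v \<Longrightarrow> (\<lambda>y. 1 / (1 + g y * v)) integrable_on {x..y}"
  by (intro integrable_continuous_real pace_continuous)

lemma pace_bounds: "0 \<le> v \<Longrightarrow> 1 / (1 + 4 * v) \<le> 1 / (1 + g y * v)" "0 \<le> v \<Longrightarrow> 1 / (1 + g y * v) \<le> 1"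
  using denom_ge[of v y] denom_le[of v y] by (auto simp: divide_simps)

lemma travel_time_diff:
  assumes "0 \<le> v" "a \<le> x" "x \<le> y"
  shows "travel_time v y - travel_time v x = integral {x..y} (\<lambda>y. 1 / (1 + g y * v))"
  using Henstock_Kurzweil_Integration.integral_combine[OF assms(2,3) pace_integrable[OF assms(1)]]
  by (simp add: travel_time_def)

lemma travel_time_diff_bounds:
  assumes "0 \<le> v" "a \<le> x" "x \<le> y"
  shows "(y - x) / (1 + 4 * v) \<le> travel_time v y - travel_time v x"
    "travel_time v y - travel_time v x \<le> y - x"
proof -
  have "integral {x..y} (\<lambda>_. 1 / (1 + 4 * v)) \<le> integral {x..y} (\<lambda>y. 1 / (1 + g y * v))"
    using assms(1) pace_bounds by (intro integral_le pace_integrable) auto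
  then show "(y - x) / (1 + 4 * v) \<le> travel_time v y - travel_time v x"
    using travel_time_diff[OF assms] assms(3) by simp
  have "integral {x..y} (\<lambda>y. 1 / (1 + g y * v)) \<le> integral {x..y} (\<lambda>_. 1)"
    using assms(1) pace_bounds by (intro integral_le pace_integrable) auto
  then show "travel_time v y - travel_time v x \<le> y - x"
    using travel_time_diff[OF assms] assms(3) by simp
qed

lemma travel_time_at_start [simp]: "travel_time v a = 0"
  by (simp add: travel_time_def)

lemma travel_time_continuous: "0 \<le> v \<Longrightarrow> continuous_on {a..x} (travel_time v)"
  unfolding travel_time_def by (intro indefinite_integral_continuous_1 pace_integrable)

lemma travel_time_has_derivative:
  "0 \<le> v \<Longrightarrow> x \<in> {a..b} \<Longrightarrow>
    (travel_time v has_real_derivative 1 / (1 + g x * v)) (at x within {a..b})"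
  unfolding travel_time_def by (rule integral_has_real_derivative[OF pace_continuous])

lemma travel_time_inj:
  assumes v: "0 \<le> v" and "a \<le> x" "a \<le> y" "travel_time v x = travel_time v y"
  shows "x = y"
proof -
  have False if r: "a \<le> r" "r < s" and eq: "travel_time v r = travel_time v s" for r s
  proof -
    have "0 < (s - r) / (1 + 4 * v)" using r v by simp
    then show False using travel_time_diff_bounds(1)[OF v r(1), of s] r eq by simp
  qed
  then show ?thesis using assms(2-4) by (metis linorder_neqE_linordered_idom)
qed

text \<open>
  The position at time \<open>T\<close> of a traveller who is at \<open>a\<close> at time \<open>a\<close>.
\<close>
definition arrival :: "real \<Rightarrow> real" where
  "arrival v = (THE x. a \<le> x \<and> travel_time v x = T - a)"

lemma arrival_eqI: "0 \<le> v \<Longrightarrow> a \<le> x \<Longrightarrow> travel_time v x = T - a \<Longrightarrow> arrival v = x"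
  unfolding arrival_def using travel_time_inj by (intro the_equality) auto

lemma arrival:
  assumes v: "0 \<le> v"
  shows "a \<le> arrival v" "travel_time v (arrival v) = T - a" "T \<le> arrival v"
proof -
  let ?b = "a + (T - a) * (1 + 4 * v)"
  have b: "a \<le> ?b" using v ad by simp
  have "T - a \<le> travel_time v ?b"
    using travel_time_diff_bounds(1)[OF v order_refl b] v by simp
  then obtain x where "a \<le> x" "x \<le> ?b" "travel_time v x = T - a"
    using IVT'[of "travel_time v" a "T - a" ?b] b travel_time_continuous[OF v] ad by auto
  then show 1: "a \<le> arrival v" "travel_time v (arrival v) = T - a"
    using arrival_eqI[OF v] by auto
  show "T \<le> arrival v" using travel_time_diff_bounds(2)[OF v order_refl 1(1)] 1 by simp
qed

text \<open>
  On the way to the slower traveller's arrival point, the faster one gains the integral of the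
  difference of the two paces. On \<open>{d..T}\<close>, where \<open>g\<close> equals \<open>4\<close>, this difference is at least
  \<open>4 * (v - w) / 81\<close>, because both denominators are at most \<open>9\<close>. In the time gained the faster
  traveller proceeds at least at unit speed.
\<close>
lemma arrival_expansion:
  assumes w: "0 \<le> w" "w \<le> v" "v \<le> 2"
  shows "4 * (T - d) / 81 * (v - w) \<le> arrival v - arrival w"
proof -
  have v: "0 \<le> v" using w by simp
  let ?x = "arrival v" and ?y = "arrival w"
  note X = arrival[OF v] and Y = arrival[OF w(1)]
  define e where "e y = (if d \<le> y \<and> y \<le> T then 4 * (v - w) / 81 else 0)" for y
  have ptw: "e y \<le> 1 / (1 + g y * w) - 1 / (1 + g y * v)" for y
  proof -
    have 1: "1 \<le> 1 + g y * w" "1 + g y * w \<le> 1 + g y * v" "1 + g y * v \<le> 9"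
      using denom_ge[OF w(1), of y] denom_le[OF v, of y] w g_nonneg[of y] by (auto intro: mult_left_mono)
    have eq: "1 / (1 + g y * w) - 1 / (1 + g y * v) = g y * (v - w) / ((1 + g y * w) * (1 + g y * v))"
      using 1 by (simp add: field_simps)
    have nn: "0 \<le> g y * (v - w)" using g_nonneg w by simp
    have "(1 + g y * w) * (1 + g y * v) \<le> 9 * 9" using 1 by (intro mult_mono) auto
    then have "g y * (v - w) / 81 \<le> g y * (v - w) / ((1 + g y * w) * (1 + g y * v))"
      using 1 nn by (intro divide_left_mono) auto
    moreover have "0 \<le> g y * (v - w) / ((1 + g y * w) * (1 + g y * v))"
      using 1 by (intro divide_nonneg_nonneg[OF nn] mult_nonneg_nonneg) auto
    ultimately show ?thesis using g_high[of y] unfolding eq e_def by auto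
  qed
  have "((\<lambda>y. 4 * (v - w) / 81) has_integral 4 * (v - w) / 81 * (T - d)) {d..T}"
    using has_integral_const_real[of "4 * (v - w) / 81" d T] ad by (simp add: mult_ac)
  then have "(e has_integral 4 * (v - w) / 81 * (T - d)) {a..?y}"
    unfolding e_def using has_integral_restrict[of "{d..T}" "{a..?y}" "\<lambda>_. 4 * (v - w) / 81"] Y(3) ad
    by (simp add: subset_eq)
  moreover have "((\<lambda>y. 1 / (1 + g y * w) - 1 / (1 + g y * v)) has_integral
      (travel_time w ?y - travel_time v ?y)) {a..?y}"
    unfolding travel_time_def
    by (intro has_integral_diff integrable_integral pace_integrable w v)
  ultimately have gain: "4 * (v - w) / 81 * (T - d) \<le> travel_time w ?y - travel_time v ?y"
    using ptw by (rule has_integral_le)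
  have le: "travel_time v ?y \<le> travel_time v ?x"
  proof -
    have "0 \<le> 4 * (v - w) / 81 * (T - d)" using w ad by simp
    then show ?thesis using X Y gain by linarith
  qed
  have "?y \<le> ?x"
  proof (rule ccontr)
    assume "\<not> ?y \<le> ?x"
    then have "0 < (?y - ?x) / (1 + 4 * v)" using v by simp
    then show False using travel_time_diff_bounds(1)[OF v X(1), of ?y] \<open>\<not> ?y \<le> ?x\<close> le by linarith
  qed
  from travel_time_diff_bounds(2)[OF v Y(1) this] gain X(2) Y(2)
  show ?thesis by (simp add: field_simps)
qed

text \<open>
  The path is increasing, so a position of at most \<open>a\<close> keeps the whole past in the zone where \<open>g\<close>
  vanishes, and there the path moves at unit speed. By the intermediate value theorem it cannot
  have passed \<open>a\<close> before time \<open>a\<close>.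
\<close>
lemma path_starts_as_identity:
  fixes x y :: "real \<Rightarrow> real"
  assumes x: "continuous_on {0..T} x" and y: "continuous_on {0..T} y" "\<And>s. 0 \<le> y s"
    and eq: "\<And>t. t \<in> {0..T} \<Longrightarrow> x t = t + integral {0..t} (\<lambda>s. g (x s) * y s)"
  shows "t \<in> {0..a} \<Longrightarrow> x t = t" and "t \<in> {a..T} \<Longrightarrow> a \<le> x t"
proof -
  have gx: "continuous_on {0..T} (\<lambda>s. g (x s) * y s)"
    by (intro continuous_intros y continuous_on_compose2[OF g_cont x]) auto
  have int: "(\<lambda>s. g (x s) * y s) integrable_on {r..t}" if "0 \<le> r" "t \<le> T" for r t
    using that by (intro integrable_continuous_real continuous_on_subset[OF gx]) auto
  have mono: "x r \<le> x t" if "0 \<le> r" "r \<le> t" "t \<le> T" for r t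
  proof -
    have "integral {0..r} (\<lambda>s. g (x s) * y s) + integral {r..t} (\<lambda>s. g (x s) * y s)
        = integral {0..t} (\<lambda>s. g (x s) * y s)"
      using that int by (intro Henstock_Kurzweil_Integration.integral_combine) auto
    moreover have "0 \<le> integral {r..t} (\<lambda>s. g (x s) * y s)"
      using that int y(2) g_nonneg by (intro integral_nonneg) auto
    ultimately show ?thesis using eq[of r] eq[of t] that by simp
  qed
  have id: "x t = t" if "t \<in> {0..T}" "x t \<le> a" for t
  proof -
    have "integral {0..t} (\<lambda>s. g (x s) * y s) = integral {0..t} (\<lambda>s. 0)"
      using that mono g_low by (intro Henstock_Kurzweil_Integration.integral_cong) (auto, meson order_trans)
    then show ?thesis using eq[OF that(1)] by simp
  qed
  have *: "x t = t" if t: "t \<in> {0..a}" for t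
  proof (cases "x t \<le> a")
    case True
    then show ?thesis using id t ad by auto
  next
    case False
    have "x 0 = 0" using eq[of 0] ad by simp
    then obtain s where s: "0 \<le> s" "s \<le> t" "x s = a"
      using IVT'[of x 0 a t] False t ad continuous_on_subset[OF x, of "{0..t}"] by auto
    then have "s = a" using id[of s] t ad by auto
    then show ?thesis using s t False by auto
  qed
  show "t \<in> {0..a} \<Longrightarrow> x t = t" by (rule *)
  show "a \<le> x t" if "t \<in> {a..T}"
    using mono[of a t] *[of a] that ad by simp
qed

text \<open>
  The chain rule shows that the travel time to the current position increases at unit rate.
\<close>
lemma path_arrival:
  assumes x: "continuous_on {a..T} x" and v: "0 \<le> v" and ge: "\<And>t. t \<in> {a..T} \<Longrightarrow> a \<le> x t"
    and eq: "\<And>t. t \<in> {a..T} \<Longrightarrow> x t = a + integral {a..t} (\<lambda>s. 1 + g (x s) * v)"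
  shows "x T = arrival v"
proof -
  have cont: "continuous_on {a..T} (\<lambda>s. 1 + g (x s) * v)"
    by (intro continuous_intros continuous_on_compose2[OF g_cont x]) auto
  have dx: "(x has_real_derivative 1 + g (x t) * v) (at t within {a..T})" if "t \<in> {a..T}" for t
  proof -
    have "((\<lambda>t. a + integral {a..t} (\<lambda>s. 1 + g (x s) * v)) has_real_derivative 1 + g (x t) * v)
        (at t within {a..T})"
      using DERIV_add[OF DERIV_const integral_has_real_derivative[OF cont that]] by simp
    then show ?thesis
      unfolding has_field_derivative_def by (rule has_derivative_transform[OF that, rotated]) (rule eq)
  qed
  obtain B where "\<forall>y\<in>x ` {a..T}. \<bar>y\<bar> \<le> B"
    using compact_imp_bounded[OF compact_continuous_image[OF x compact_Icc]]
    unfolding bounded_real by blast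
  then have B: "x t \<le> B" if "t \<in> {a..T}" for t
    using that by (simp add: abs_le_iff)
  have dh: "((\<lambda>t. travel_time v (x t) - t) has_real_derivative 0) (at t within {a..T})"
    if t: "t \<in> {a..T}" for t
  proof -
    have xt: "x t \<in> {a..B}" using ge B t by auto
    have "x ` {a..T} \<subseteq> {a..B}" using ge B by auto
    then have "(travel_time v has_real_derivative 1 / (1 + g (x t) * v)) (at (x t) within x ` {a..T})"
      by (rule DERIV_subset[OF travel_time_has_derivative[OF v xt]])
    from DERIV_image_chain[OF this dx[OF t]]
    have "(travel_time v \<circ> x has_real_derivative 1) (at t within {a..T})"
      using denom_ge[OF v, of "x t"] by simp
    from DERIV_diff[OF this DERIV_ident]
    show ?thesis by (simp add: o_def)
  qed
  obtain c where c: "\<And>t. t \<in> {a..T} \<Longrightarrow> travel_time v (x t) - t = c"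
    using has_field_derivative_zero_constant[OF convex_real_interval(5)[of a T] dh] by blast
  have "travel_time v (x T) - T = travel_time v (x a) - a"
    using c[of T] c[of a] ad by simp
  moreover have "x a = a" using eq[of a] ad by simp
  ultimately have "travel_time v (x T) = T - a" by simp
  then show ?thesis using arrival_eqI[OF v ge[of T]] ad by simp
qed

end

section \<open>Smooth functions that are affine on prescribed windows\<close>

lemma smooth_deriv:
  assumes "smooth f"
  shows "((deriv ^^ n) f has_real_derivative (deriv ^^ Suc n) f x) (at x)"
proof -
  have "(deriv ^^ n) f field_differentiable at x"
    using assms by (auto simp: smooth_def differentiable_on_def field_differentiable_def
        real_differentiable_def)
  then show ?thesis by (simp add: DERIV_deriv_iff_field_differentiable)
qed

lemma smoothI:
  assumes h: "\<And>n x. (h n has_real_derivative h (Suc n) x) (at x)"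
  shows "smooth (h 0)"
proof -
  have "(deriv ^^ n) (h 0) = h n" for n
  proof (induction n)
    case (Suc n)
    then show ?case using DERIV_imp_deriv[OF h[of n]] by (simp add: ext)
  qed simp
  then show ?thesis
    unfolding smooth_def differentiable_on_def
    using h real_differentiable_def by (metis UNIV_I)
qed

lemma deriv_zero_left:
  assumes "smooth g" and z: "\<And>x. x < c \<Longrightarrow> g x = (0::real)"
  shows "x < c \<Longrightarrow> (deriv ^^ n) g x = 0"
proof (induction n arbitrary: x)
  case (Suc n)
  have "\<forall>\<^sub>F y in nhds x. y < c"
    using Suc.prems by (rule order_tendstoD(2)[OF filterlim_ident])
  then have "\<forall>\<^sub>F y in nhds x. (deriv ^^ n) g y = 0"
    by eventually_elim (rule Suc.IH)
  then have "((deriv ^^ n) g has_real_derivative 0) (at x) \<longleftrightarrow> ((\<lambda>_. 0) has_real_derivative (0::real)) (at x)"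
    using Suc.IH Suc.prems by (intro DERIV_cong_ev) auto
  then have "((deriv ^^ n) g has_real_derivative 0) (at x)" by simp
  then show ?case using smooth_deriv[OF assms(1), of n x] DERIV_unique by blast
qed (simp add: z)

text \<open>
  The function \<open>g\<close> is itself a smooth step, so its antiderivative is a smooth ramp: it vanishes up
  to \<open>a\<close> and is affine with slope \<open>4\<close> beyond \<open>d\<close>. The function \<open>\<psi>\<close> superposes the ramps shifted by
  \<open>k * L\<close> with weights \<open>\<nu> k\<close>. On the window number \<open>k\<close> the ramps up to \<open>k\<close> are affine already and the
  later ones have not begun, so the slope is \<open>4\<close> times the sum of the weights up to \<open>k\<close>.
\<close>
lemma smooth_affine_pieces:
  fixes \<nu> :: "nat \<Rightarrow> real"
  assumes g: "smooth g" and low: "\<And>x. x \<le> a \<Longrightarrow> g x = 0" and high: "\<And>x. d \<le> x \<Longrightarrow> g x = 4"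
    and ad: "0 < a" "a < d" and L: "1 \<le> L" and \<nu>: "\<And>k. 0 \<le> \<nu> k"
  obtains \<psi> where "smooth \<psi>"
    "\<And>k. \<exists>l c. \<nu> k \<le> l \<and> (\<forall>x\<in>{real k * L + d..real (Suc k) * L}. \<psi> x = l * x + c)"
proof -
  have gc: "continuous_on A g" for A
    using smooth_deriv[OF g, of 0] by (intro continuous_at_imp_continuous_on ballI)
      (auto intro: DERIV_isCont)
  define G where "G x = integral {a - 1..x} g" for x
  have G0: "G x = 0" if "x \<le> a" for x
  proof -
    have "integral {a - 1..x} g = integral {a - 1..x} (\<lambda>_. 0)"
      using that low by (intro Henstock_Kurzweil_Integration.integral_cong) auto
    then show ?thesis by (simp add: G_def)
  qed
  have dG: "(G has_real_derivative g x) (at x)" for x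
  proof (cases "x < a")
    case True
    have "\<forall>\<^sub>F y in nhds x. y < a" using True by (rule order_tendstoD(2)[OF filterlim_ident])
    then have "\<forall>\<^sub>F y in nhds x. G y = 0" by eventually_elim (simp add: G0)
    then have "(G has_real_derivative g x) (at x) \<longleftrightarrow> ((\<lambda>_. 0) has_real_derivative g x) (at x)"
      using G0[of x] True by (intro DERIV_cong_ev) auto
    then show ?thesis using low[of x] True by simp
  next
    case False
    have "(G has_real_derivative g x) (at x within {a - 1..x + 1})"
      unfolding G_def using False by (intro integral_has_real_derivative gc) auto
    moreover have "at x within {a - 1..x + 1} = at x"
      using False by (intro at_within_interior) auto
    ultimately show ?thesis by simp
  qed
  have G_high: "G x = G d + 4 * (x - d)" if "d \<le> x" for x
  proof -
    have "G x = G d + integral {d..x} g"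
      unfolding G_def using that ad gc
      by (intro Henstock_Kurzweil_Integration.integral_combine[symmetric] integrable_continuous_real) auto
    also have "integral {d..x} g = integral {d..x} (\<lambda>_. 4)"
      using high by (intro Henstock_Kurzweil_Integration.integral_cong) auto
    finally show ?thesis using that by simp
  qed
  \<comment> \<open>the iterated derivatives of the ramp\<close>
  define D where "D n = (case n of 0 \<Rightarrow> G | Suc m \<Rightarrow> (deriv ^^ m) g)" for n
  have D_der: "(D n has_real_derivative D (Suc n) x) (at x)" for n x
    using dG smooth_deriv[OF g] by (cases n) (simp_all add: D_def)
  have D_zero: "D n x = 0" if "x < a" for n x
    using that G0[of x] deriv_zero_left[OF g, of a x] low by (cases n) (simp_all add: D_def)
  \<comment> \<open>ramps with \<open>k \<ge> x\<close> vanish at \<open>x\<close> since \<open>L\<close> is at least \<open>1\<close>, so finite sums suffice\<close>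
  define h where "h n x = (\<Sum>k<nat \<lceil>x\<rceil>. \<nu> k * D n (x - real k * L))" for n x
  have h_eq: "h n x = (\<Sum>k<N. \<nu> k * D n (x - real k * L))" if "x \<le> real N" for n x N
    unfolding h_def
  proof (rule sum.mono_neutral_left)
    show "{..<nat \<lceil>x\<rceil>} \<subseteq> {..<N}" using that by (auto simp: ceiling_le_iff)
    show "\<forall>k\<in>{..<N} - {..<nat \<lceil>x\<rceil>}. \<nu> k * D n (x - real k * L) = 0"
    proof
      fix k assume "k \<in> {..<N} - {..<nat \<lceil>x\<rceil>}"
      then have "x \<le> real k" by auto
      also have "\<dots> \<le> real k * L" using L by (simp add: mult_le_cancel_left1)
      finally show "\<nu> k * D n (x - real k * L) = 0" using D_zero[of "x - real k * L" n] ad by simp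
    qed
  qed simp
  have h_der: "(h n has_real_derivative h (Suc n) x) (at x)" for n x
  proof -
    obtain N where N: "x + 1 \<le> real N" using real_arch_simple by blast
    have "\<forall>\<^sub>F y in nhds x. y < x + 1" by (rule order_tendstoD(2)[OF filterlim_ident]) simp
    then have "\<forall>\<^sub>F y in nhds x. h n y = (\<Sum>k<N. \<nu> k * D n (y - real k * L))"
      by eventually_elim (rule h_eq, use N in linarith)
    moreover have "((\<lambda>y. \<Sum>k<N. \<nu> k * D n (y - real k * L)) has_real_derivative
        (\<Sum>k<N. \<nu> k * D (Suc n) (x - real k * L))) (at x)"
    proof (intro DERIV_sum DERIV_cmult)
      fix k
      show "((\<lambda>y. D n (y - real k * L)) has_real_derivative D (Suc n) (x - real k * L)) (at x)"
        using D_der[of n "x + - (real k * L)"] DERIV_shift[of "D n" _ x "- (real k * L)"] by simp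
    qed
    moreover have "h (Suc n) x = (\<Sum>k<N. \<nu> k * D (Suc n) (x - real k * L))"
      using N by (intro h_eq) simp
    ultimately show ?thesis
      by (subst DERIV_cong_ev[OF refl _ refl]) auto
  qed
  show thesis
  proof (rule that[of "h 0"])
    show "smooth (h 0)" by (rule smoothI[of h, OF h_der])
    fix k
    define l where "l = 4 * (\<Sum>j\<le>k. \<nu> j)"
    define c where "c = (\<Sum>j\<le>k. \<nu> j * (G d - 4 * d - 4 * (real j * L)))"
    have "\<nu> k \<le> (\<Sum>j\<le>k. \<nu> j)" using \<nu> by (intro member_le_sum) auto
    moreover have "0 \<le> (\<Sum>j\<le>k. \<nu> j)" using \<nu> by (intro sum_nonneg) auto
    ultimately have "\<nu> k \<le> l" unfolding l_def by linarith
    moreover have "h 0 x = l * x + c" if x: "x \<in> {real k * L + d..real (Suc k) * L}" for x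
    proof -
      obtain N where N: "x \<le> real N" "Suc k \<le> N"
        using real_arch_simple[of "max x (real (Suc k))"] by auto
      have "h 0 x = (\<Sum>j<N. \<nu> j * G (x - real j * L))"
        using h_eq[OF N(1), of 0] by (simp add: D_def)
      also have "\<dots> = (\<Sum>j\<le>k. \<nu> j * G (x - real j * L))"
      proof (rule sum.mono_neutral_right)
        show "{..k} \<subseteq> {..<N}" using N(2) by auto
        show "\<forall>j\<in>{..<N} - {..k}. \<nu> j * G (x - real j * L) = 0"
        proof
          fix j assume "j \<in> {..<N} - {..k}"
          then have "real (Suc k) * L \<le> real j * L" using L by (intro mult_right_mono) auto
          then show "\<nu> j * G (x - real j * L) = 0" using G0[of "x - real j * L"] x ad by simp
        qed
      qed simp
      also have "\<dots> = (\<Sum>j\<le>k. \<nu> j * (4 * x) + \<nu> j * (G d - 4 * d - 4 * (real j * L)))"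
      proof (rule sum.cong[OF refl])
        fix j assume "j \<in> {..k}"
        then have "real j * L \<le> real k * L" using L by (intro mult_right_mono) auto
        then have "G (x - real j * L) = G d + 4 * (x - real j * L - d)" using x by (intro G_high) auto
        then have "G (x - real j * L) = 4 * x + (G d - 4 * d - 4 * (real j * L))" by simp
        then show "\<nu> j * G (x - real j * L) = \<nu> j * (4 * x) + \<nu> j * (G d - 4 * d - 4 * (real j * L))"
          by (simp only: distrib_left)
      qed
      also have "\<dots> = l * x + c"
        by (simp add: l_def c_def sum.distrib sum_distrib_left sum_distrib_right mult_ac)
      finally show ?thesis .
    qed
    ultimately show "\<exists>l c. \<nu> k \<le> l \<and> (\<forall>x\<in>{real k * L + d..real (Suc k) * L}. h 0 x = l * x + c)"
      by blast
  qed
qed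

section \<open>Gaussian windows and the choice of scales\<close>

lemma rational_dense_interval:
  assumes "u < (v::real)"
  shows "{u..v} \<subseteq> closure (\<rat> \<inter> {u<..<v})"
proof -
  have "{u<..<v} \<inter> closure \<rat> \<subseteq> closure ({u<..<v} \<inter> \<rat>)"
    by (rule open_Int_closure_subset) simp
  moreover have "closure \<rat> = (UNIV :: real set)"
  proof -
    have "x \<in> closure \<rat>" for x :: real
      unfolding closure_approachable
    proof (intro allI impI)
      fix e :: real assume "0 < e"
      then obtain q :: rat where "x - e < of_rat q" "of_rat q < x"
        using of_rat_dense[of "x - e" x] by auto
      then show "\<exists>y\<in>\<rat>. dist y x < e"
        by (intro bexI[of _ "of_rat q"]) (auto simp: dist_real_def)
    qed
    then show ?thesis by auto
  qed
  ultimately have "{u<..<v} \<subseteq> closure (\<rat> \<inter> {u<..<v})" by (simp add: Int_commute)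
  then have "closure {u<..<v} \<subseteq> closure (\<rat> \<inter> {u<..<v})" by (rule closure_minimal) simp
  then show ?thesis using assms by simp
qed

lemma zero_on_rationals_imp_zero:
  fixes h :: "real \<Rightarrow> real"
  assumes "continuous_on {u..v} h" "u < v" "\<And>t. t \<in> \<rat> \<inter> {u<..<v} \<Longrightarrow> h t = 0" "t \<in> {u..v}"
  shows "h t = 0"
proof -
  have "closure (\<rat> \<inter> {u<..<v}) = {u..v}"
  proof (rule antisym)
    show "closure (\<rat> \<inter> {u<..<v}) \<subseteq> {u..v}" by (rule closure_minimal) auto
  qed (rule rational_dense_interval[OF assms(2)])
  then show ?thesis
    using continuous_constant_on_closure[of "\<rat> \<inter> {u<..<v}" h 0 t] assms by simp
qed

lemma sin_squared_integral:
  fixes l c u :: real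
  assumes l: "2 \<le> l"
  shows "ennreal (1 / 4) \<le> (\<integral>\<^sup>+y. ennreal ((sin (l * y + c))\<^sup>2) * indicator {u..u + 1} y \<partial>lborel)"
proof -
  define G where "G y = y / 2 - sin (2 * (l * y + c)) / (4 * l)" for y
  have dG: "(G has_real_derivative (sin (l * y + c))\<^sup>2) (at y)" for y
  proof -
    have "(G has_real_derivative 1 / 2 - cos (2 * (l * y + c)) * (2 * l) / (4 * l)) (at y)"
      unfolding G_def by (auto intro!: derivative_eq_intros simp: mult_ac)
    moreover have "1 / 2 - cos (2 * (l * y + c)) * (2 * l) / (4 * l) = (sin (l * y + c))\<^sup>2"
      using l unfolding cos_double_sin by (simp add: field_simps)
    ultimately show ?thesis by simp
  qed
  have "(\<integral>\<^sup>+y. ennreal ((sin (l * y + c))\<^sup>2) * indicator {u..u + 1} y \<partial>lborel) = ennreal (G (u + 1) - G u)"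
    using dG by (intro nn_integral_FTC_Icc) auto
  moreover have "1 / 4 \<le> G (u + 1) - G u"
  proof -
    have "\<bar>sin (2 * (l * (u + 1) + c)) - sin (2 * (l * u + c))\<bar> \<le> 2"
      using abs_sin_le_one[of "2 * (l * (u + 1) + c)"] abs_sin_le_one[of "2 * (l * u + c)"] by linarith
    then have "(sin (2 * (l * (u + 1) + c)) - sin (2 * (l * u + c))) / (4 * l) \<le> 2 / (4 * l)"
      using l by (intro divide_right_mono) auto
    also have "\<dots> \<le> 1 / 4" using l by (simp add: field_simps)
    finally show ?thesis unfolding G_def by (simp add: diff_divide_distrib add_divide_distrib)
  qed
  ultimately show ?thesis by (simp add: ennreal_leI)
qed

lemma std_normal_density_mono: "0 \<le> x \<Longrightarrow> x \<le> y \<Longrightarrow> std_normal_density y \<le> std_normal_density x"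
  unfolding std_normal_density_def by (intro mult_left_mono) (auto intro: power_mono)

text \<open>
  On the window the density of the shifted Gaussian is at least its value at the far end, which is
  independent of the frequency \<open>l\<close>; averaging the squared sine over the window only costs the
  factor \<open>1 / 4\<close>.
\<close>
lemma gaussian_window_sin_squared:
  fixes v q :: real
  assumes v: "0 < v" and l: "2 \<le> l" and q: "\<bar>q\<bar> \<le> R" "R \<le> u"
  shows "ennreal (std_normal_density ((u + 1 + R) / sqrt v) / sqrt v / 4) \<le>
    (\<integral>\<^sup>+x. ennreal ((sin (l * (sqrt v * x + q) + c))\<^sup>2) * indicator {u..u + 1} (sqrt v * x + q)
      \<partial>std_normal_distribution)"
proof -
  define s where "s = sqrt v"
  have s: "0 < s" using v by (simp add: s_def)
  define d where "d = std_normal_density ((u + 1 + R) / s)"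
  define h where "h y = ennreal ((sin (l * y + c))\<^sup>2) * indicator {u..u + 1} y" for y
  have hm [measurable]: "h \<in> borel_measurable borel" unfolding h_def by measurable
  have d: "0 \<le> d" by (simp add: d_def)
  have "ennreal (d / s / 4) = ennreal (d / s) * ennreal (1 / 4)"
    using d s by (subst ennreal_mult[symmetric]) auto
  also have "\<dots> \<le> ennreal (d / s) * (\<integral>\<^sup>+y. h y \<partial>lborel)"
    unfolding h_def by (intro mult_left_mono sin_squared_integral l) auto
  also have "\<dots> = ennreal (1 / s) * (\<integral>\<^sup>+y. ennreal d * h y \<partial>lborel)"
    using d s by (subst nn_integral_cmult) (auto simp: ennreal_mult[symmetric] mult.assoc[symmetric])
  also have "\<dots> \<le> ennreal (1 / s) * (\<integral>\<^sup>+y. ennreal (std_normal_density ((y - q) / s)) * h y \<partial>lborel)"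
  proof (intro mult_left_mono nn_integral_mono)
    fix y
    show "ennreal d * h y \<le> ennreal (std_normal_density ((y - q) / s)) * h y"
    proof (cases "y \<in> {u..u + 1}")
      case True
      then have "0 \<le> (y - q) / s" "(y - q) / s \<le> (u + 1 + R) / s"
        using q s by (auto intro!: divide_right_mono)
      then show ?thesis unfolding d_def by (intro mult_right_mono ennreal_leI std_normal_density_mono) auto
    qed (simp add: h_def)
  qed simp
  also have "(\<integral>\<^sup>+y. ennreal (std_normal_density ((y - q) / s)) * h y \<partial>lborel)
    = ennreal \<bar>s\<bar> * (\<integral>\<^sup>+x. ennreal (std_normal_density ((q + s * x - q) / s)) * h (q + s * x) \<partial>lborel)"
    using s by (intro nn_integral_real_affine) auto
  also have "ennreal (1 / s) * (ennreal \<bar>s\<bar> * (\<integral>\<^sup>+x. ennreal (std_normal_density ((q + s * x - q) / s)) * h (q + s * x) \<partial>lborel))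
    = (\<integral>\<^sup>+x. ennreal (std_normal_density x) * h (s * x + q) \<partial>lborel)"
    using s by (simp add: mult.assoc[symmetric] ennreal_mult[symmetric] add.commute)
  also have "\<dots> = (\<integral>\<^sup>+x. h (s * x + q) \<partial>std_normal_distribution)"
    by (subst nn_integral_density) auto
  finally show ?thesis unfolding h_def d_def s_def .
qed

text \<open>
  Windows are assigned slowly: an index \<open>n\<close> moves on to window \<open>k + 1\<close> only when \<open>\<delta>\<close> stays at
  or below \<open>\<eta> (k + 1)\<close> from \<open>n\<close> on. Each window then serves finitely many indices, so \<open>\<nu> k\<close> can dominate
  the values \<open>m n\<close> of all of them. The constant \<open>c\<close> takes care of the indices on window \<open>0\<close>.
\<close>
lemma choose_scales:
  fixes \<delta> m \<eta> :: "nat \<Rightarrow> real"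
  assumes \<delta>: "limsup (\<lambda>n. ereal (\<delta> n)) \<le> 0" and \<eta>: "\<And>k. 0 < \<eta> k"
  obtains c \<nu> where "0 < c" "\<And>k. 2 \<le> \<nu> k" "\<And>n. \<exists>k. m n \<le> \<nu> k \<and> \<delta> n \<le> c * \<eta> k"
proof -
  have "\<exists>N. \<forall>n\<ge>N. \<delta> n \<le> \<eta> (Suc k)" for k
  proof -
    have "limsup (\<lambda>n. ereal (\<delta> n)) < ereal (\<eta> (Suc k))"
      using \<delta> \<eta>[of "Suc k"] by (auto intro: le_less_trans)
    from Limsup_lessD[OF this] have "\<forall>\<^sub>F n in sequentially. \<delta> n < \<eta> (Suc k)" by simp
    then show ?thesis unfolding eventually_sequentially by (auto intro: less_imp_le)
  qed
  then obtain N0 where N0: "\<And>k n. N0 k \<le> n \<Longrightarrow> \<delta> n \<le> \<eta> (Suc k)" by metis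
  define N where "N k = max k (N0 k)" for k
  define c where "c = Max (insert 1 ((\<lambda>n. \<delta> n / \<eta> 0) ` {..N 0}))"
  define \<nu> where "\<nu> k = Max (insert 2 (m ` {..N k}))" for k
  have c1: "1 \<le> c" unfolding c_def by (intro Max_ge) auto
  show thesis
  proof (rule that[of c \<nu>])
    show "0 < c" using c1 by simp
    show "2 \<le> \<nu> k" for k unfolding \<nu>_def by (intro Max_ge) auto
    fix n
    define k where "k = (LEAST k. n \<le> N k)"
    have "n \<le> N n" by (simp add: N_def)
    then have k: "n \<le> N k" unfolding k_def by (rule LeastI)
    have "m n \<le> \<nu> k" unfolding \<nu>_def using k by (intro Max_ge) auto
    moreover have "\<delta> n \<le> c * \<eta> k"
    proof (cases k)
      case 0
      have "\<delta> n / \<eta> 0 \<le> c" unfolding c_def using k 0 by (intro Max_ge) auto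
      then show ?thesis using \<eta>[of 0] 0 by (simp add: divide_le_eq)
    next
      case (Suc j)
      then have "\<not> n \<le> N j" using not_less_Least[of j "\<lambda>k. n \<le> N k"] unfolding k_def by auto
      then have "\<delta> n \<le> \<eta> k" using N0[of j n] Suc by (auto simp: N_def)
      also have "\<dots> \<le> c * \<eta> k" using c1 \<eta>[of k] by simp
      finally show ?thesis .
    qed
    ultimately show "\<exists>k. m n \<le> \<nu> k \<and> \<delta> n \<le> c * \<eta> k" by blast
  qed
qed

section \<open>Exchanging the increments over two adjacent intervals\<close>

text \<open>
  The path that performs the increments of \<open>w\<close> over the two halves of \<open>{a..b}\<close> in the opposite
  order and agrees with \<open>w\<close> elsewhere.
\<close>
definition swap_path :: "real \<Rightarrow> real \<Rightarrow> (real \<Rightarrow> real) \<Rightarrow> real \<Rightarrow> real" where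
  "swap_path a b w s =
    (if s \<le> a \<or> b \<le> s then w s
     else if s \<le> (a + b) / 2 then w a + w (s + (b - a) / 2) - w ((a + b) / 2)
     else w b - w ((a + b) / 2) + w (s - (b - a) / 2))"

lemma swap_path_continuous:
  assumes w: "continuous_on {0..T} w" and abT: "0 \<le> a" "a < b" "b \<le> T"
  shows "continuous_on {0..T} (swap_path a b w)"
proof -
  define m where "m = (a + b) / 2"
  define h where "h = (b - a) / 2"
  have mh: "a + h = m" "m + h = b" "a < m" "m < b" "0 < h"
    using abT by (auto simp: m_def h_def field_simps)
  have sub: "continuous_on S w" if "S \<subseteq> {0..T}" for S using continuous_on_subset[OF w that] .
  have 1: "continuous_on {0..a} (swap_path a b w)"
    using sub[of "{0..a}"] abT by (subst continuous_on_cong[OF refl, of _ _ w]) (auto simp: swap_path_def)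
  have 4: "continuous_on {b..T} (swap_path a b w)"
    using sub[of "{b..T}"] abT by (subst continuous_on_cong[OF refl, of _ _ w]) (auto simp: swap_path_def)
  have 2: "continuous_on {a..m} (swap_path a b w)"
  proof (subst continuous_on_cong[OF refl])
    show "swap_path a b w s = w a + w (s + h) - w m" if "s \<in> {a..m}" for s
      using that mh unfolding swap_path_def m_def[symmetric] h_def[symmetric] by (cases "s = a") auto
    show "continuous_on {a..m} (\<lambda>s. w a + w (s + h) - w m)"
      using mh abT by (intro continuous_intros continuous_on_compose2[OF w]) auto
  qed
  have 3: "continuous_on {m..b} (swap_path a b w)"
  proof (subst continuous_on_cong[OF refl])
    show "swap_path a b w s = w b - w m + w (s - h)" if "s \<in> {m..b}" for s
    proof -
      have e: "b - h = m" "m - h = a" "m + h = b" using mh by auto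
      have ne: "\<not> m \<le> a" "\<not> b \<le> m" using mh by auto
      have "m \<le> s" "s \<le> b" using that by auto
      then consider "s = m" | "s = b" | "m < s" "s < b" by linarith
      then show ?thesis
      proof cases
        case 1
        show ?thesis unfolding 1 swap_path_def m_def[symmetric] h_def[symmetric] e using ne by simp
      next
        case 2
        show ?thesis unfolding 2 swap_path_def m_def[symmetric] h_def[symmetric] e by simp
      next
        case 3
        then have "\<not> s \<le> a" "\<not> b \<le> s" "\<not> s \<le> m" using mh by auto
        then show ?thesis unfolding swap_path_def m_def[symmetric] h_def[symmetric] by simp
      qed
    qed
    show "continuous_on {m..b} (\<lambda>s. w b - w m + w (s - h))"
      using mh abT by (intro continuous_intros continuous_on_compose2[OF w]) auto
  qed
  have "continuous_on ({0..a} \<union> {a..m} \<union> {m..b} \<union> {b..T}) (swap_path a b w)"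
    by (intro continuous_on_closed_Un 1 2 3 4 closed_Un) auto
  moreover have "{0..a} \<union> {a..m} \<union> {m..b} \<union> {b..T} = {0..T}" using abT mh by auto
  ultimately show ?thesis by simp
qed

text \<open>
  There are \<open>n\<close> equal steps on \<open>{0..a}\<close>, on each half of \<open>{a..b}\<close>, and on \<open>{b..T}\<close>. In this way the
  exchange of increments becomes the permutation \<open>swap_index\<close> of the steps.
\<close>
definition grid :: "real \<Rightarrow> real \<Rightarrow> real \<Rightarrow> nat \<Rightarrow> nat \<Rightarrow> real" where
  "grid a b T n j =
    (if j \<le> n then a * real j / real n
     else if j \<le> 3 * n then a + (b - a) * (real j - real n) / (2 * real n)
     else b + (T - b) * (real j - 3 * real n) / real n)"

definition swap_index :: "nat \<Rightarrow> nat \<Rightarrow> nat" where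
  "swap_index n j = (if n \<le> j \<and> j < 2 * n then j + n else if 2 * n \<le> j \<and> j < 3 * n then j - n else j)"

locale swap_grid =
  fixes a b T :: real and n :: nat
  assumes abT: "0 \<le> a" "a < b" "b \<le> T" and n: "0 < n"
begin

abbreviation "p \<equiv> grid a b T n"

lemma grid_first: "j \<le> n \<Longrightarrow> p j = a * real j / real n"
  by (simp add: grid_def)

lemma grid_middle: "n \<le> j \<Longrightarrow> j \<le> 3 * n \<Longrightarrow> p j = a + (b - a) * (real j - real n) / (2 * real n)"
  using n by (cases "j = n") (auto simp: grid_def)

lemma grid_last: "3 * n \<le> j \<Longrightarrow> p j = b + (T - b) * (real j - 3 * real n) / real n"
  using n by (cases "j = 3 * n") (auto simp: grid_def)

lemma grid_0 [simp]: "p 0 = 0" by (simp add: grid_first)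

lemma grid_at: "p n = a" "p (2 * n) = (a + b) / 2" "p (3 * n) = b" "p (4 * n) = T"
proof -
  show "p n = a" using n by (simp add: grid_first)
  have "p (2 * n) = a + (b - a) * (real n) / (2 * real n)" using n by (simp add: grid_middle)
  also have "(b - a) * real n / (2 * real n) = (b - a) / 2" using n by simp
  finally show "p (2 * n) = (a + b) / 2" by (simp add: field_simps)
  show "p (3 * n) = b" using n by (simp add: grid_last)
  show "p (4 * n) = T" using n by (simp add: grid_last)
qed

lemma grid_step:
  "p (Suc j) - p j = (if j < n then a / real n else if j < 3 * n then (b - a) / (2 * real n) else (T - b) / real n)"
proof -
  consider "j < n" | "n \<le> j" "j < 3 * n" | "3 * n \<le> j" by linarith
  then show ?thesis
  proof cases
    case 1
    then show ?thesis by (simp add: grid_first diff_divide_distrib[symmetric] algebra_simps)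
  next
    case 2
    then show ?thesis
      using grid_middle[of j] grid_middle[of "Suc j"] n
      by (simp add: diff_divide_distrib[symmetric] right_diff_distrib[symmetric])
  next
    case 3
    then show ?thesis
      using grid_last[of j] grid_last[of "Suc j"] n
      by (simp add: diff_divide_distrib[symmetric] right_diff_distrib[symmetric])
  qed
qed

lemma grid_mono_step: "p j \<le> p (Suc j)"
proof -
  have "0 \<le> p (Suc j) - p j" unfolding grid_step using abT by auto
  then show ?thesis by simp
qed

lemma grid_mono: "i \<le> j \<Longrightarrow> p i \<le> p j"
  using grid_mono_step by (rule lift_Suc_mono_le)

lemma grid_mesh: "p (Suc j) - p j \<le> T / real n"
  unfolding grid_step using abT n by (auto simp: divide_simps)

lemma grid_nonneg: "0 \<le> p j" using grid_mono[of 0 j] by simp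

lemma grid_le_T: "j \<le> 4 * n \<Longrightarrow> p j \<le> T" using grid_mono[of j "4 * n"] grid_at by simp

lemma grid_shift:
  assumes "n \<le> j" "j \<le> 2 * n"
  shows "p (j + n) = p j + (b - a) / 2"
proof -
  have "p (j + n) = a + (b - a) * ((real j - real n) + real n) / (2 * real n)"
    using grid_middle[of "j + n"] assms by simp
  also have "\<dots> = a + (b - a) * (real j - real n) / (2 * real n) + (b - a) / 2"
    using n unfolding distrib_left add_divide_distrib by simp
  finally show ?thesis using grid_middle[of j] assms by simp
qed

lemma swap_path_grid:
  "j \<le> n \<Longrightarrow> swap_path a b w (p j) = w (p j)"
  "n \<le> j \<Longrightarrow> j \<le> 2 * n \<Longrightarrow> swap_path a b w (p j) = w a + w (p (j + n)) - w ((a + b) / 2)"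
  "2 * n \<le> j \<Longrightarrow> j \<le> 3 * n \<Longrightarrow> swap_path a b w (p j) = w b - w ((a + b) / 2) + w (p (j - n))"
  "3 * n \<le> j \<Longrightarrow> swap_path a b w (p j) = w (p j)"
proof -
  show "j \<le> n \<Longrightarrow> swap_path a b w (p j) = w (p j)"
    using grid_mono[of j n] grid_at by (simp add: swap_path_def)
  show "3 * n \<le> j \<Longrightarrow> swap_path a b w (p j) = w (p j)"
    using grid_mono[of "3 * n" j] grid_at by (simp add: swap_path_def)
  show "swap_path a b w (p j) = w a + w (p (j + n)) - w ((a + b) / 2)" if j: "n \<le> j" "j \<le> 2 * n"
  proof (cases "p j = a")
    case True
    have e: "p (j + n) = (a + b) / 2" using grid_shift[OF j] True by (simp add: field_simps)
    show ?thesis unfolding e using True by (simp add: swap_path_def)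
  next
    case False
    then have "a < p j" "p j \<le> (a + b) / 2"
      using grid_mono[OF j(1)] grid_mono[OF j(2)] grid_at by auto
    then show ?thesis using grid_shift[OF j] abT by (simp add: swap_path_def)
  qed
  show "swap_path a b w (p j) = w b - w ((a + b) / 2) + w (p (j - n))" if j: "2 * n \<le> j" "j \<le> 3 * n"
  proof -
    have "n \<le> j - n" "j - n \<le> 2 * n" "j - n + n = j" using j by auto
    then have s: "p (j - n) = p j - (b - a) / 2" using grid_shift[of "j - n"] by simp
    have le: "(a + b) / 2 \<le> p j" "p j \<le> b"
      using grid_mono[OF j(1)] grid_mono[OF j(2)] grid_at by auto
    consider "p j = (a + b) / 2" | "p j = b" | "(a + b) / 2 < p j" "p j < b" using le by linarith
    then show ?thesis
    proof cases
      case 1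
      then have e: "p (j - n) = a" using s by (simp add: field_simps)
      have m: "(a + b) / 2 + (b - a) / 2 = b" by (simp add: field_simps)
      have "\<not> (a + b) / 2 \<le> a" "\<not> b \<le> (a + b) / 2" using abT by (auto simp: field_simps)
      then have "swap_path a b w ((a + b) / 2) = w a + w b - w ((a + b) / 2)"
        unfolding swap_path_def m by (simp only: if_False simp_thms order_refl if_True)
      then show ?thesis unfolding e 1 by simp
    next
      case 2
      then have e: "p (j - n) = (a + b) / 2" using s by (simp add: field_simps)
      show ?thesis unfolding e using 2 by (simp add: swap_path_def)
    next
      case 3
      then have "\<not> p j \<le> a" "\<not> b \<le> p j" "\<not> p j \<le> (a + b) / 2"
        using abT by auto
      then show ?thesis by (simp only: swap_path_def s if_False simp_thms)
    qed
  qed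
qed

lemma swap_path_increment:
  "swap_path a b w (p (Suc j)) - swap_path a b w (p j)
    = w (p (Suc (swap_index n j))) - w (p (swap_index n j))"
proof -
  consider "j < n" | "n \<le> j" "j < 2 * n" | "2 * n \<le> j" "j < 3 * n" | "3 * n \<le> j" by linarith
  then show ?thesis
  proof cases
    case 3
    then show ?thesis
      using swap_path_grid(3)[of j w] swap_path_grid(3)[of "Suc j" w]
      by (simp add: swap_index_def Suc_diff_le)
  qed (use swap_path_grid[of j w] swap_path_grid[of "Suc j" w] in \<open>simp_all add: swap_index_def\<close>)
qed

lemma swap_index_lt: "j < 4 * n \<Longrightarrow> swap_index n j < 4 * n"
  by (auto simp: swap_index_def)

lemma swap_index_involution: "swap_index n (swap_index n j) = j"
  by (auto simp: swap_index_def)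

lemma swap_index_bij: "bij_betw (swap_index n) {..<4 * n} {..<4 * n}"
  by (rule bij_betw_byWitness[of _ "swap_index n"])
     (auto simp: swap_index_involution swap_index_lt)

lemma swap_index_step: "p (Suc (swap_index n j)) - p (swap_index n j) = p (Suc j) - p j"
  unfolding grid_step by (auto simp: swap_index_def)

lemma path_as_sum: "(w :: real \<Rightarrow> real) 0 = 0 \<Longrightarrow> w (p j) = (\<Sum>i<j. w (p (Suc i)) - w (p i))"
  using sum_lessThan_telescope[of "\<lambda>i. w (p i)" j] by simp

lemma swap_path_as_sum:
  assumes "w 0 = 0"
  shows "swap_path a b w (p j) = (\<Sum>i<j. w (p (Suc (swap_index n i))) - w (p (swap_index n i)))"
proof -
  have "swap_path a b w (p 0) = 0" using assms abT by (simp add: swap_path_def)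
  then show ?thesis
    unfolding swap_path_increment[symmetric]
    using sum_lessThan_telescope[of "\<lambda>i. swap_path a b w (p i)" j] by simp
qed

lemma grid_refine: "grid a b T (2 * n) (2 * j) = p j"
proof -
  have "(b - a) * (real (2 * j) - real (2 * n)) / (2 * real (2 * n)) = (b - a) * (real j - real n) / (2 * real n)"
    "(T - b) * (real (2 * j) - 3 * real (2 * n)) / real (2 * n) = (T - b) * (real j - 3 * real n) / real n"
    "a * real (2 * j) / real (2 * n) = a * real j / real n"
    using n by (simp_all add: frac_eq_eq algebra_simps)
  then show ?thesis unfolding grid_def by simp
qed

end

definition grid_points :: "real \<Rightarrow> real \<Rightarrow> real \<Rightarrow> real set" where
  "grid_points a b T = (\<Union>N. grid a b T (2 ^ N) ` {..4 * 2 ^ N})"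

lemma countable_grid_points: "countable (grid_points a b T)"
  unfolding grid_points_def by (intro countable_UN countable_image) auto

lemma equidistant_approx:
  fixes u v s :: real
  assumes "u \<le> s" "s \<le> v" "0 < n"
  obtains j where "j \<le> n" "\<bar>s - (u + (v - u) * real j / real n)\<bar> \<le> (v - u) / real n"
proof (cases "u = v")
  case True
  then show ?thesis using that[of 0] assms by simp
next
  case False
  then have uv: "0 < v - u" using assms by simp
  define x where "x = (s - u) * real n / (v - u)"
  define j where "j = nat \<lfloor>x\<rfloor>"
  have x: "0 \<le> x" "x \<le> real n" using assms uv by (auto simp: x_def divide_simps mult_right_mono)
  have j: "real j \<le> x" "x < real j + 1" unfolding j_def using x(1) by linarith+
  have s: "s = u + (v - u) * x / real n" using assms uv by (simp add: x_def)
  have "s - (u + (v - u) * real j / real n) = (v - u) * (x - real j) / real n"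
    by (subst s) (simp add: diff_divide_distrib right_diff_distrib)
  moreover have "0 \<le> (v - u) * (x - real j) / real n" using uv j by simp
  moreover have "(v - u) * (x - real j) / real n \<le> (v - u) * 1 / real n"
    using uv j by (intro divide_right_mono mult_left_mono) auto
  moreover have "j \<le> n" using j x by linarith
  ultimately show ?thesis using that[of j] by simp
qed

lemma grid_points_dense:
  assumes abT: "0 \<le> a" "a < b" "b \<le> T"
  defines "K \<equiv> {0..a} \<union> {b..T}"
  shows "K \<subseteq> closure (grid_points a b T \<inter> K)"
proof
  fix s assume s: "s \<in> K"
  show "s \<in> closure (grid_points a b T \<inter> K)"
    unfolding closure_approachable
  proof (intro allI impI)
    fix e :: real assume e: "0 < e"
    obtain N where N: "T / e < 2 ^ N" using real_arch_pow[of 2 "T / e"] by auto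
    interpret swap_grid a b T "2 ^ N" by unfold_locales (use abT in auto)
    have Te: "T / 2 ^ N < e" using N e by (simp add: field_simps)
    show "\<exists>y\<in>grid_points a b T \<inter> K. dist y s < e"
    proof (cases "s \<le> a")
      case True
      then obtain j where j: "j \<le> 2 ^ N" "\<bar>s - (0 + (a - 0) * real j / real (2 ^ N))\<bar> \<le> (a - 0) / real (2 ^ N)"
        using equidistant_approx[of 0 s a "2 ^ N"] s abT by (auto simp: K_def)
      have "\<bar>s - p j\<bar> \<le> a / 2 ^ N" using j by (simp add: grid_first)
      also have "\<dots> \<le> T / 2 ^ N" using abT by (intro divide_right_mono) auto
      finally have "dist (p j) s < e" using Te by (simp add: dist_real_def)
      moreover have "p j \<in> grid_points a b T" using j(1) unfolding grid_points_def by (intro UN_I[of N] imageI) auto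
      moreover have "p j \<in> K" using grid_mono[OF j(1)] grid_at grid_nonneg by (simp add: K_def)
      ultimately show ?thesis by blast
    next
      case False
      then have "b \<le> s" "s \<le> T" using s by (auto simp: K_def)
      then obtain i where i: "i \<le> 2 ^ N" "\<bar>s - (b + (T - b) * real i / real (2 ^ N))\<bar> \<le> (T - b) / real (2 ^ N)"
        using equidistant_approx[of b s T "2 ^ N"] by auto
      define j where "j = 3 * 2 ^ N + i"
      have j: "3 * 2 ^ N \<le> j" "j \<le> 4 * 2 ^ N" using i(1) by (auto simp: j_def)
      have "\<bar>s - p j\<bar> \<le> (T - b) / 2 ^ N" using i(2) grid_last[OF j(1)] by (simp add: j_def)
      also have "\<dots> \<le> T / 2 ^ N" using abT by (intro divide_right_mono) auto
      finally have "dist (p j) s < e" using Te by (simp add: dist_real_def)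
      moreover have "p j \<in> grid_points a b T" using j(2) unfolding grid_points_def by (intro UN_I[of N] imageI) auto
      moreover have "p j \<in> K" using grid_mono[OF j(1)] grid_le_T[OF j(2)] grid_at by (simp add: K_def)
      ultimately show ?thesis by blast
    qed
  qed
qed

text \<open>
  Doubling \<open>n\<close> refines the grid, so finitely many grid points always lie on a single grid.
\<close>
lemma finite_subset_grid:
  assumes abT: "0 \<le> a" "a < b" "b \<le> T" and J: "finite J" "J \<subseteq> grid_points a b T"
  shows "\<exists>N idx. \<forall>s\<in>J. idx s \<le> 4 * 2 ^ N \<and> grid a b T (2 ^ N) (idx s) = s"
proof -
  have step: "grid a b T (2 ^ N) ` {..4 * 2 ^ N} \<subseteq> grid a b T (2 ^ Suc N) ` {..4 * 2 ^ Suc N}" for N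
  proof
    interpret swap_grid a b T "2 ^ N" by unfold_locales (use abT in auto)
    fix s assume "s \<in> grid a b T (2 ^ N) ` {..4 * 2 ^ N}"
    then obtain j where j: "j \<le> 4 * 2 ^ N" "s = p j" by auto
    then have "s = grid a b T (2 ^ Suc N) (2 * j)" using grid_refine[of j] by simp
    then show "s \<in> grid a b T (2 ^ Suc N) ` {..4 * 2 ^ Suc N}" using j(1) by auto
  qed
  have mono: "grid a b T (2 ^ N) ` {..4 * 2 ^ N} \<subseteq> grid a b T (2 ^ N') ` {..4 * 2 ^ N'}" if "N \<le> N'" for N N'
    using lift_Suc_mono_le[of "\<lambda>N. grid a b T (2 ^ N) ` {..4 * 2 ^ N}", OF step that] .
  have "\<exists>N. J \<subseteq> grid a b T (2 ^ N) ` {..4 * 2 ^ N}"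
    using J
  proof (induction J)
    case (insert s J)
    then obtain N1 where "J \<subseteq> grid a b T (2 ^ N1) ` {..4 * 2 ^ N1}" by auto
    moreover obtain N2 where "s \<in> grid a b T (2 ^ N2) ` {..4 * 2 ^ N2}"
      using insert.prems by (auto simp: grid_points_def)
    ultimately show ?case
      using mono[of N1 "max N1 N2"] mono[of N2 "max N1 N2"] by (intro exI[of _ "max N1 N2"]) auto
  qed simp
  then obtain N where N: "J \<subseteq> grid a b T (2 ^ N) ` {..4 * 2 ^ N}" by blast
  have "\<forall>s\<in>J. \<exists>j. j \<le> 4 * 2 ^ N \<and> grid a b T (2 ^ N) j = s"
    using N by auto
  then have "\<exists>idx. \<forall>s\<in>J. idx s \<le> 4 * 2 ^ N \<and> grid a b T (2 ^ N) (idx s) = s"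
    by (rule bchoice)
  then show ?thesis ..
qed

lemma grid_points_subset:
  assumes abT: "0 \<le> a" "a < b" "b \<le> T"
  shows "grid_points a b T \<subseteq> {0..T}"
proof
  fix s assume "s \<in> grid_points a b T"
  then obtain N j where j: "j \<le> 4 * 2 ^ N" "s = grid a b T (2 ^ N) j"
    unfolding grid_points_def by auto
  interpret swap_grid a b T "2 ^ N" by unfold_locales (use abT in auto)
  show "s \<in> {0..T}" using j grid_nonneg[of j] grid_le_T[OF j(1)] by simp
qed

lemma (in brownian_setting) swap_path_measurable:
  assumes abT: "0 \<le> a" "a < b" "b \<le> T"
  shows "(\<lambda>\<omega>. \<lambda>s\<in>grid_points a b T. swap_path a b (\<lambda>s. W s \<omega>) s)
    \<in> measurable M (PiM (grid_points a b T) (\<lambda>_. borel))"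
proof (intro measurable_restrict)
  fix s assume "s \<in> grid_points a b T"
  then have s: "0 \<le> s" "s \<le> T" using grid_points_subset[OF abT] by auto
  have r: "0 \<le> s + (b - a) / 2 \<and> s + (b - a) / 2 \<le> T" if "\<not> (s \<le> a \<or> b \<le> s)" "s \<le> (a + b) / 2"
    using that abT s by (simp add: field_simps)
  have l: "0 \<le> s - (b - a) / 2 \<and> s - (b - a) / 2 \<le> T" if "\<not> s \<le> (a + b) / 2"
    using that abT s by (simp add: field_simps)
  have W3: "W a \<in> borel_measurable M" "W b \<in> borel_measurable M" "W ((a + b) / 2) \<in> borel_measurable M"
    "W s \<in> borel_measurable M"
    using abT s by (auto intro!: W_measurable)
  show "(\<lambda>\<omega>. swap_path a b (\<lambda>s. W s \<omega>) s) \<in> borel_measurable M"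
    unfolding swap_path_def using W3 r l
    by (cases "s \<le> a \<or> b \<le> s"; cases "s \<le> (a + b) / 2")
       (simp_all add: W_measurable borel_measurable_add borel_measurable_diff)
qed

context brownian_setting begin

lemma increment_law_cong:
  assumes "0 \<le> s" "s \<le> t" "t \<le> T" "0 \<le> s'" "s' \<le> t'" "t' \<le> T" "t - s = t' - s'" and B: "B \<in> sets borel"
  shows "prob {\<omega> \<in> space M. W t \<omega> - W s \<omega> \<in> B} = prob {\<omega> \<in> space M. W t' \<omega> - W s' \<omega> \<in> B}"
proof (cases "s = t")
  case False
  have eq: "prob {\<omega> \<in> space M. W t \<omega> - W s \<omega> \<in> B}
      = measure (density lborel (normal_density 0 (sqrt (t - s)))) B"
    if st: "0 \<le> s" "s < t" "t \<le> T" for s t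
  proof -
    have D: "distributed M lborel (\<lambda>\<omega>. W t \<omega> - W s \<omega>) (normal_density 0 (sqrt (t - s)))"
      using increment_distributed[OF st] .
    have m: "(\<lambda>\<omega>. W t \<omega> - W s \<omega>) \<in> measurable M lborel"
      using st by simp
    have "measure (density lborel (normal_density 0 (sqrt (t - s)))) B
      = measure (distr M lborel (\<lambda>\<omega>. W t \<omega> - W s \<omega>)) B"
      unfolding distributed_distr_eq_density[OF D] ..
    also have "\<dots> = prob ((\<lambda>\<omega>. W t \<omega> - W s \<omega>) -` B \<inter> space M)"
      using B by (intro measure_distr[OF m]) simp
    also have "(\<lambda>\<omega>. W t \<omega> - W s \<omega>) -` B \<inter> space M = {\<omega> \<in> space M. W t \<omega> - W s \<omega> \<in> B}" by auto
    finally show ?thesis ..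
  qed
  show ?thesis using eq[of s t] eq[of s' t'] assms False by simp
qed (use assms in auto)

lemma increments_product:
  fixes p :: "nat \<Rightarrow> real"
  assumes p: "0 \<le> p 0" "\<And>i j. i \<le> j \<Longrightarrow> j \<le> n \<Longrightarrow> p i \<le> p j" "p n \<le> T"
    and A: "\<And>i. A i \<in> sets borel"
  shows "prob {\<omega> \<in> space M. \<forall>i<n. W (p (Suc i)) \<omega> - W (p i) \<omega> \<in> A i}
    = (\<Prod>i<n. prob {\<omega> \<in> space M. W (p (Suc i)) \<omega> - W (p i) \<omega> \<in> A i})"
  using p(2,3)
proof (induction n)
  case 0
  then show ?case by (simp add: prob_space)
next
  case (Suc n)
  let ?E = "{\<omega> \<in> space M. \<forall>i<n. W (p (Suc i)) \<omega> - W (p i) \<omega> \<in> A i}"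
  have pn: "0 \<le> p n" "p n \<le> p (Suc n)" "p (Suc n) \<le> T" "p n \<le> T"
    using Suc.prems(1)[of 0 n] Suc.prems(1)[of n "Suc n"] p(1) Suc.prems(2) by auto
  have "?E \<in> sets (F (p n))"
  proof -
    have "{\<omega> \<in> space (F (p n)). \<forall>i\<in>{..<n}. W (p (Suc i)) \<omega> - W (p i) \<omega> \<in> A i} \<in> sets (F (p n))"
    proof (rule sets.sets_Collect_finite_All)
      fix i assume "i \<in> {..<n}"
      then have i: "0 \<le> p i" "p i \<le> p n" "0 \<le> p (Suc i)" "p (Suc i) \<le> p n"
        using Suc.prems(1)[of 0 i] Suc.prems(1)[of i n] Suc.prems(1)[of 0 "Suc i"] Suc.prems(1)[of "Suc i" n] p(1)
        by auto
      have [measurable]: "W (p i) \<in> borel_measurable (F (p n))" "W (p (Suc i)) \<in> borel_measurable (F (p n))"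
        using i pn by (auto intro: W_measurable_F)
      note [measurable] = A[of i]
      show "{\<omega> \<in> space (F (p n)). W (p (Suc i)) \<omega> - W (p i) \<omega> \<in> A i} \<in> sets (F (p n))"
        by measurable
    qed simp
    moreover have "space (F (p n)) = space M" using pn by simp
    moreover have "?E = {\<omega> \<in> space M. \<forall>i\<in>{..<n}. W (p (Suc i)) \<omega> - W (p i) \<omega> \<in> A i}" by auto
    ultimately show ?thesis by (simp only:)
  qed
  note indep = increment_indep_event[OF pn(1,2,3) this A[of n]]
  have "(\<lambda>\<omega>. W (p (Suc n)) \<omega> - W (p n) \<omega>) -` A n \<inter> space M
    = {\<omega> \<in> space M. W (p (Suc n)) \<omega> - W (p n) \<omega> \<in> A n}" by auto
  with indep have "prob (?E \<inter> ((\<lambda>\<omega>. W (p (Suc n)) \<omega> - W (p n) \<omega>) -` A n \<inter> space M))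
    = prob ?E * prob {\<omega> \<in> space M. W (p (Suc n)) \<omega> - W (p n) \<omega> \<in> A n}"
    by (simp only:)
  moreover have "?E \<inter> ((\<lambda>\<omega>. W (p (Suc n)) \<omega> - W (p n) \<omega>) -` A n \<inter> space M)
    = {\<omega> \<in> space M. \<forall>i<Suc n. W (p (Suc i)) \<omega> - W (p i) \<omega> \<in> A i}"
    by (auto simp: less_Suc_eq)
  moreover have "prob ?E = (\<Prod>i<n. prob {\<omega> \<in> space M. W (p (Suc i)) \<omega> - W (p i) \<omega> \<in> A i})"
    using Suc.prems pn by (intro Suc.IH) auto
  ultimately show ?case by (simp only: prod.lessThan_Suc)
qed

text \<open>
  The increments are independent, and their laws depend only on the lengths of the steps, which the
  permutation preserves.
\<close>
lemma increments_permuted_law: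
  fixes p :: "nat \<Rightarrow> real"
  assumes p: "0 \<le> p 0" "\<And>i j. i \<le> j \<Longrightarrow> j \<le> n \<Longrightarrow> p i \<le> p j" "p n \<le> T"
    and \<sigma>: "bij_betw \<sigma> {..<n} {..<n}" "\<And>i. i < n \<Longrightarrow> \<sigma> (\<sigma> i) = i"
      "\<And>i. i < n \<Longrightarrow> p (Suc (\<sigma> i)) - p (\<sigma> i) = p (Suc i) - p i"
  shows "distr M (PiM {..<n} (\<lambda>_. borel)) (\<lambda>\<omega>. \<lambda>i\<in>{..<n}. W (p (Suc i)) \<omega> - W (p i) \<omega>)
    = distr M (PiM {..<n} (\<lambda>_. borel)) (\<lambda>\<omega>. \<lambda>i\<in>{..<n}. W (p (Suc (\<sigma> i))) \<omega> - W (p (\<sigma> i)) \<omega>)"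
    (is "distr M ?P ?X = distr M ?P ?Y")
proof -
  have \<sigma>n: "\<sigma> i < n" if "i < n" for i using bij_betwE[OF \<sigma>(1)] that by auto
  have pi: "0 \<le> p i" "p i \<le> T" if "i \<le> n" for i
    using p(2)[of 0 i] p(2)[of i n] p(1,3) that by auto
  have Wm: "W (p i) \<in> borel_measurable M" if "i \<le> n" for i using pi[OF that] by simp
  have Xm: "?X \<in> measurable M ?P"
    using Wm by (intro measurable_restrict borel_measurable_diff) auto
  have Ym: "?Y \<in> measurable M ?P"
    using Wm \<sigma>n by (intro measurable_restrict borel_measurable_diff) (auto simp: Suc_le_eq less_imp_le)
  show ?thesis
  proof (rule measure_eqI_PiM_infinite)
    show "finite_measure (distr M ?P ?X)"
      by (rule finite_measure_distr[OF Xm])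
    fix A J assume J: "finite J" "J \<subseteq> {..<n}" and A: "\<And>i. i \<in> J \<Longrightarrow> A i \<in> sets (borel :: real measure)"
    define B where "B i = (if i \<in> J then A i else UNIV)" for i
    have B: "B i \<in> sets borel" for i using A by (simp add: B_def)
    have E: "prod_emb {..<n} (\<lambda>_. borel) J (Pi\<^sub>E J A) \<in> sets ?P"
      using J A by (intro sets_PiM_I) auto
    have mem: "(\<lambda>i\<in>{..<n}. z i) \<in> prod_emb {..<n} (\<lambda>_. borel) J (Pi\<^sub>E J A) \<longleftrightarrow> (\<forall>i<n. z i \<in> B i)" for z :: "nat \<Rightarrow> real"
      using J(2) by (auto simp: prod_emb_def B_def PiE_iff subset_eq)
    have eqX: "?X -` prod_emb {..<n} (\<lambda>_. borel) J (Pi\<^sub>E J A) \<inter> space M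
      = {\<omega> \<in> space M. \<forall>i<n. W (p (Suc i)) \<omega> - W (p i) \<omega> \<in> B i}"
      unfolding vimage_def mem by auto
    have "?Y -` prod_emb {..<n} (\<lambda>_. borel) J (Pi\<^sub>E J A) \<inter> space M
      = {\<omega> \<in> space M. \<forall>i<n. W (p (Suc (\<sigma> i))) \<omega> - W (p (\<sigma> i)) \<omega> \<in> B i}"
      unfolding vimage_def mem by auto
    also have "\<dots> = {\<omega> \<in> space M. \<forall>i<n. W (p (Suc i)) \<omega> - W (p i) \<omega> \<in> B (\<sigma> i)}"
    proof -
      have "(\<forall>i<n. z (\<sigma> i) \<in> B i) \<longleftrightarrow> (\<forall>i<n. z i \<in> B (\<sigma> i))" for z :: "nat \<Rightarrow> real"
      proof (intro iffI allI impI)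
        fix i assume "\<forall>i<n. z (\<sigma> i) \<in> B i" and i: "i < n"
        then have "z (\<sigma> (\<sigma> i)) \<in> B (\<sigma> i)" using \<sigma>n[OF i] by blast
        then show "z i \<in> B (\<sigma> i)" using \<sigma>(2)[OF i] by simp
      next
        fix i assume "\<forall>i<n. z i \<in> B (\<sigma> i)" and i: "i < n"
        then have "z (\<sigma> i) \<in> B (\<sigma> (\<sigma> i))" using \<sigma>n[OF i] by blast
        then show "z (\<sigma> i) \<in> B i" using \<sigma>(2)[OF i] by simp
      qed
      note this[of "\<lambda>i. W (p (Suc i)) \<omega> - W (p i) \<omega>" for \<omega>]
      then show ?thesis by simp
    qed
    finally have "prob (?Y -` prod_emb {..<n} (\<lambda>_. borel) J (Pi\<^sub>E J A) \<inter> space M)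
      = (\<Prod>i<n. prob {\<omega> \<in> space M. W (p (Suc i)) \<omega> - W (p i) \<omega> \<in> B (\<sigma> i)})"
      using increments_product[OF p, of "\<lambda>i. B (\<sigma> i)"] B by simp
    also have "\<dots> = (\<Prod>i<n. prob {\<omega> \<in> space M. W (p (Suc (\<sigma> i))) \<omega> - W (p (\<sigma> i)) \<omega> \<in> B (\<sigma> i)})"
    proof (rule prod.cong[OF refl])
      fix i assume "i \<in> {..<n}"
      then have i: "i < n" by simp
      note \<sigma>i = \<sigma>n[OF i]
      show "prob {\<omega> \<in> space M. W (p (Suc i)) \<omega> - W (p i) \<omega> \<in> B (\<sigma> i)}
        = prob {\<omega> \<in> space M. W (p (Suc (\<sigma> i))) \<omega> - W (p (\<sigma> i)) \<omega> \<in> B (\<sigma> i)}"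
        using i \<sigma>i p(2)[of i "Suc i"] p(2)[of "\<sigma> i" "Suc (\<sigma> i)"] pi(1)[of i] pi(1)[of "\<sigma> i"]
          pi(2)[of "Suc i"] pi(2)[of "Suc (\<sigma> i)"] \<sigma>(3)[OF i] B[of "\<sigma> i"]
        by (intro increment_law_cong) auto
    qed
    also have "\<dots> = (\<Prod>i<n. prob {\<omega> \<in> space M. W (p (Suc i)) \<omega> - W (p i) \<omega> \<in> B i})"
      using prod.reindex_bij_betw[OF \<sigma>(1), of "\<lambda>i. prob {\<omega> \<in> space M. W (p (Suc i)) \<omega> - W (p i) \<omega> \<in> B i}"] .
    also have "\<dots> = prob (?X -` prod_emb {..<n} (\<lambda>_. borel) J (Pi\<^sub>E J A) \<inter> space M)"
      unfolding eqX using increments_product[OF p, of B] B by simp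
    finally show "emeasure (distr M ?P ?X) (prod_emb {..<n} (\<lambda>_. borel) J (Pi\<^sub>E J A))
      = emeasure (distr M ?P ?Y) (prod_emb {..<n} (\<lambda>_. borel) J (Pi\<^sub>E J A))"
      unfolding emeasure_distr[OF Xm E] emeasure_distr[OF Ym E] emeasure_eq_measure by simp
  qed simp_all
qed

text \<open>
  On a single grid the values of both paths are the same partial sums, taken over the increments in
  the original and in the permuted order, and both orders have the same joint law.
\<close>
lemma swap_law:
  assumes abT: "0 \<le> a" "a < b" "b \<le> T"
  defines "D \<equiv> grid_points a b T"
  shows "distr M (PiM D (\<lambda>_. borel)) (\<lambda>\<omega>. \<lambda>s\<in>D. W s \<omega>)
    = distr M (PiM D (\<lambda>_. borel)) (\<lambda>\<omega>. \<lambda>s\<in>D. swap_path a b (\<lambda>s. W s \<omega>) s)"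
    (is "distr M ?P ?X = distr M ?P ?Y")
proof -
  have D0T: "D \<subseteq> {0..T}" unfolding D_def by (rule grid_points_subset[OF abT])
  have Xm: "?X \<in> measurable M ?P"
    using D0T by (intro measurable_restrict W_measurable) auto
  have Ym: "?Y \<in> measurable M ?P" unfolding D_def by (rule swap_path_measurable[OF abT])
  show ?thesis
  proof (rule measure_eqI_PiM_infinite)
    show "finite_measure (distr M ?P ?X)" by (rule finite_measure_distr[OF Xm])
    fix A J assume J: "finite J" "J \<subseteq> D" and A: "\<And>i. i \<in> J \<Longrightarrow> A i \<in> sets (borel :: real measure)"
    from finite_subset_grid[OF abT J(1) J(2)[unfolded D_def]]
    obtain N idx where idx0: "\<forall>s\<in>J. idx s \<le> 4 * 2 ^ N \<and> grid a b T (2 ^ N) (idx s) = s"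
      by (elim exE) (rule that)
    define n where "n = (2::nat) ^ N"
    interpret swap_grid a b T n by unfold_locales (use abT in \<open>auto simp: n_def\<close>)
    have idx: "idx s \<le> 4 * n" "p (idx s) = s" if "s \<in> J" for s
      using bspec[OF idx0 that] by (simp_all add: n_def)
    let ?L = "{..<4 * n}"
    let ?Q = "PiM ?L (\<lambda>_. borel :: real measure)"
    let ?E = "prod_emb D (\<lambda>_. borel) J (Pi\<^sub>E J A)"
    define G where "G = {x \<in> space ?Q. \<forall>s\<in>J. (\<Sum>i<idx s. x i) \<in> A s}"
    have E: "?E \<in> sets ?P" using J A by (intro sets_PiM_I) auto
    have G: "G \<in> sets ?Q"
      unfolding G_def
    proof (rule sets.sets_Collect_finite_All[OF _ J(1)])
      fix s assume s: "s \<in> J"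
      have [measurable]: "(\<lambda>x. \<Sum>i<idx s. x i) \<in> borel_measurable ?Q"
        using idx(1)[OF s] by (intro borel_measurable_sum measurable_component_singleton) auto
      note [measurable] = A[OF s]
      show "{x \<in> space ?Q. (\<Sum>i<idx s. x i) \<in> A s} \<in> sets ?Q" by measurable
    qed
    let ?U = "\<lambda>\<omega>. \<lambda>i\<in>?L. W (p (Suc i)) \<omega> - W (p i) \<omega>"
    let ?V = "\<lambda>\<omega>. \<lambda>i\<in>?L. W (p (Suc (swap_index n i))) \<omega> - W (p (swap_index n i)) \<omega>"
    have Wm: "W (p i) \<in> borel_measurable M" if "i \<le> 4 * n" for i
      using grid_nonneg[of i] grid_le_T[OF that] by simp
    have Um: "?U \<in> measurable M ?Q" by (intro measurable_restrict borel_measurable_diff Wm) auto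
    have Vm: "?V \<in> measurable M ?Q"
      by (intro measurable_restrict borel_measurable_diff Wm) (auto simp: Suc_le_eq swap_index_lt less_imp_le)
    have law: "distr M ?Q ?U = distr M ?Q ?V"
      using grid_mono grid_at swap_index_bij swap_index_involution swap_index_step
      by (intro increments_permuted_law) auto
    have mem: "(\<lambda>s\<in>D. z s) \<in> ?E \<longleftrightarrow> (\<forall>s\<in>J. z s \<in> A s)" for z :: "real \<Rightarrow> real"
      using J(2) by (auto simp: prod_emb_def PiE_iff subset_eq)
    have memG: "(\<lambda>i\<in>?L. z i) \<in> G \<longleftrightarrow> (\<forall>s\<in>J. (\<Sum>i<idx s. z i) \<in> A s)" for z :: "nat \<Rightarrow> real"
    proof -
      have "(\<Sum>i<idx s. (\<lambda>i\<in>?L. z i) i) = (\<Sum>i<idx s. z i)" if "s \<in> J" for s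
        using idx(1)[OF that] by (intro sum.cong) auto
      then show ?thesis by (auto simp: G_def space_PiM)
    qed
    have WX: "W s \<omega> = (\<Sum>i<idx s. W (p (Suc i)) \<omega> - W (p i) \<omega>)" if "s \<in> J" "\<omega> \<in> space M" for s \<omega>
      using path_as_sum[of "\<lambda>s. W s \<omega>" "idx s"] W_0[OF that(2)] idx(2)[OF that(1)] by simp
    have WY: "swap_path a b (\<lambda>s. W s \<omega>) s
        = (\<Sum>i<idx s. W (p (Suc (swap_index n i))) \<omega> - W (p (swap_index n i)) \<omega>)"
      if "s \<in> J" "\<omega> \<in> space M" for s \<omega>
      using swap_path_as_sum[of "\<lambda>s. W s \<omega>" "idx s"] W_0[OF that(2)] idx(2)[OF that(1)] by simp
    have X: "?X -` ?E \<inter> space M = ?U -` G \<inter> space M"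
      unfolding vimage_def mem memG using WX by auto
    have Y: "?Y -` ?E \<inter> space M = ?V -` G \<inter> space M"
      unfolding vimage_def mem memG using WY by auto
    show "emeasure (distr M ?P ?X) ?E = emeasure (distr M ?P ?Y) ?E"
      unfolding emeasure_distr[OF Xm E] emeasure_distr[OF Ym E] X Y
        emeasure_distr[OF Um G, symmetric] emeasure_distr[OF Vm G, symmetric] law ..
  qed simp_all
qed

end

section \<open>The noise collected by a path\<close>

lemma mesh_tendsto_0:
  assumes "0 \<le> (d::real)" and L: "\<And>N. N < L N"
  shows "(\<lambda>N. d / real (L N)) \<longlonglongrightarrow> 0"
proof (rule tendsto_sandwich[of "\<lambda>_. 0" _ _ "\<lambda>N. d / real (Suc N)"])
  show "(\<lambda>N. d / real (Suc N)) \<longlonglongrightarrow> 0" by (rule LIMSEQ_Suc[OF lim_const_over_n])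
  have "d / real (L N) \<le> d / real (Suc N)" for N
    using L[of N] assms(1) by (intro divide_left_mono) auto
  then show "\<forall>\<^sub>F N in sequentially. d / real (L N) \<le> d / real (Suc N)" by simp
  show "\<forall>\<^sub>F N in sequentially. 0 \<le> d / real (L N)" using assms(1) by simp
qed simp

definition uniform_grid :: "real \<Rightarrow> real \<Rightarrow> nat \<Rightarrow> nat \<Rightarrow> real" where
  "uniform_grid u v n i = u + (v - u) * real i / real n"

lemma uniform_grid:
  assumes "u \<le> v" "0 < n"
  shows "uniform_grid u v n 0 = u" "uniform_grid u v n n = v"
    "uniform_grid u v n (Suc i) - uniform_grid u v n i = (v - u) / real n"
    "uniform_grid u v n i \<le> uniform_grid u v n (Suc i)" "u \<le> uniform_grid u v n i"
    "i \<le> n \<Longrightarrow> uniform_grid u v n i \<le> v"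
proof -
  show "uniform_grid u v n 0 = u" "uniform_grid u v n n = v"
    using assms by (auto simp: uniform_grid_def)
  show 1: "uniform_grid u v n (Suc i) - uniform_grid u v n i = (v - u) / real n"
    by (simp add: uniform_grid_def diff_divide_distrib[symmetric] right_diff_distrib[symmetric])
  have "0 \<le> (v - u) / real n" using assms by simp
  then show "uniform_grid u v n i \<le> uniform_grid u v n (Suc i)" using 1 by linarith
  show "u \<le> uniform_grid u v n i" using assms by (simp add: uniform_grid_def)
  assume "i \<le> n"
  then have "(v - u) * real i / real n \<le> (v - u) * real n / real n"
    using assms by (intro divide_right_mono mult_left_mono) auto
  then show "uniform_grid u v n i \<le> v" using assms by (simp add: uniform_grid_def)
qed

context brownian_setting begin

lemma increment_sum_second_moment:
  assumes p: "0 \<le> p 0" "\<And>i. i < n \<Longrightarrow> p i \<le> p (Suc i)" "p n \<le> T"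
  shows "integrable M (increment_sum c p n) \<and> integrable M (\<lambda>\<omega>. (increment_sum c p n \<omega>)\<^sup>2) \<and>
    expectation (\<lambda>\<omega>. (increment_sum c p n \<omega>)\<^sup>2) = increment_energy c p n"
  using p(2,3)
proof (induction n)
  case 0
  then show ?case by (simp add: increment_sum_def[abs_def] increment_energy_def)
next
  case (Suc n)
  let ?S = "increment_sum c p n" and ?\<Delta> = "\<lambda>\<omega>. W (p (Suc n)) \<omega> - W (p n) \<omega>"
  have pn: "0 \<le> p n" "p n \<le> p (Suc n)" "p (Suc n) \<le> T" "p n \<le> T"
    using Suc.prems steps_imp_le[of n p 0 n] p(1) Suc.prems(1)[of n] by (auto intro: order_trans)
  have IH: "integrable M ?S" "integrable M (\<lambda>\<omega>. (?S \<omega>)\<^sup>2)" "expectation (\<lambda>\<omega>. (?S \<omega>)\<^sup>2) = increment_energy c p n"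
    using Suc.IH Suc.prems pn by auto
  have Sm: "?S \<in> borel_measurable (F (p n))"
    using Suc.prems pn p(1) by (intro increment_sum_measurable_F) auto
  have S: "increment_sum c p (Suc n) \<omega> = ?S \<omega> + c n * ?\<Delta> \<omega>" for \<omega>
    by (simp add: increment_sum_def)
  have S2: "(increment_sum c p (Suc n) \<omega>)\<^sup>2 = (?S \<omega>)\<^sup>2 + (2 * c n * (?S \<omega> * ?\<Delta> \<omega>) + (c n)\<^sup>2 * (?\<Delta> \<omega>)\<^sup>2)" for \<omega>
    unfolding S by (simp add: power2_eq_square algebra_simps)
  note X = expectation_times_increment(1,2)[OF pn(1,2,3) Sm IH(1)]
  note I = increment_integrable[OF pn(1,2,3)] increment_square_integrable[OF pn(1,2,3)]
    increment_variance[OF pn(1,2,3)]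
  have "integrable M (increment_sum c p (Suc n))"
    unfolding S[abs_def] by (intro Bochner_Integration.integrable_add integrable_mult_right IH I)
  moreover have "integrable M (\<lambda>\<omega>. (increment_sum c p (Suc n) \<omega>)\<^sup>2)"
    unfolding S2 by (intro Bochner_Integration.integrable_add integrable_mult_right IH I X)
  moreover have "expectation (\<lambda>\<omega>. (increment_sum c p (Suc n) \<omega>)\<^sup>2) = increment_energy c p (Suc n)"
  proof -
    have "expectation (\<lambda>\<omega>. (increment_sum c p (Suc n) \<omega>)\<^sup>2)
      = expectation (\<lambda>\<omega>. (?S \<omega>)\<^sup>2) + expectation (\<lambda>\<omega>. 2 * c n * (?S \<omega> * ?\<Delta> \<omega>) + (c n)\<^sup>2 * (?\<Delta> \<omega>)\<^sup>2)"
      unfolding S2 by (intro Bochner_Integration.integral_add Bochner_Integration.integrable_add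
          integrable_mult_right IH I X)
    also have "expectation (\<lambda>\<omega>. 2 * c n * (?S \<omega> * ?\<Delta> \<omega>) + (c n)\<^sup>2 * (?\<Delta> \<omega>)\<^sup>2)
      = expectation (\<lambda>\<omega>. 2 * c n * (?S \<omega> * ?\<Delta> \<omega>)) + expectation (\<lambda>\<omega>. (c n)\<^sup>2 * (?\<Delta> \<omega>)\<^sup>2)"
      by (intro Bochner_Integration.integral_add integrable_mult_right I X)
    also have "\<dots> = (c n)\<^sup>2 * (p (Suc n) - p n)"
      using X I by simp
    finally show ?thesis unfolding IH(3) by (simp add: increment_energy_def)
  qed
  ultimately show ?case by blast
qed

lemma increment_sum_limit_second_moment:
  assumes p: "\<And>N. 0 \<le> p N 0" "\<And>N i. i < n N \<Longrightarrow> p N i \<le> p N (Suc i)" "\<And>N. p N (n N) \<le> T"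
    and lim: "\<And>\<omega>. \<omega> \<in> space M \<Longrightarrow> (\<lambda>N. increment_sum (c N) (p N) (n N) \<omega>) \<longlonglongrightarrow> X \<omega>"
    and K: "\<And>N. increment_energy (c N) (p N) (n N) \<le> K"
  shows "(\<integral>\<^sup>+\<omega>. ennreal ((X \<omega>)\<^sup>2) \<partial>M) \<le> ennreal K"
proof -
  let ?S = "\<lambda>N. increment_sum (c N) (p N) (n N)"
  have m [measurable]: "?S N \<in> borel_measurable M" for N
    using increment_sum_measurable_F[of "p N" "n N" T "c N"] measurable_F_M[of _ T] p T_pos by auto
  have "(\<integral>\<^sup>+\<omega>. ennreal ((X \<omega>)\<^sup>2) \<partial>M) = (\<integral>\<^sup>+\<omega>. liminf (\<lambda>N. ennreal ((?S N \<omega>)\<^sup>2)) \<partial>M)"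
  proof (rule nn_integral_cong)
    fix \<omega> assume "\<omega> \<in> space M"
    from lim[OF this] have "(\<lambda>N. ennreal ((?S N \<omega>)\<^sup>2)) \<longlonglongrightarrow> ennreal ((X \<omega>)\<^sup>2)"
      by (intro tendsto_ennrealI tendsto_power)
    then show "ennreal ((X \<omega>)\<^sup>2) = liminf (\<lambda>N. ennreal ((?S N \<omega>)\<^sup>2))"
      by (rule lim_imp_Liminf[OF trivial_limit_sequentially, symmetric])
  qed
  also have "\<dots> \<le> liminf (\<lambda>N. \<integral>\<^sup>+\<omega>. ennreal ((?S N \<omega>)\<^sup>2) \<partial>M)"
    by (rule nn_integral_liminf) simp
  also have "\<dots> \<le> liminf (\<lambda>N. ennreal K)"
  proof (intro Liminf_mono always_eventually allI)
    fix N
    have "(\<integral>\<^sup>+\<omega>. ennreal ((?S N \<omega>)\<^sup>2) \<partial>M) = ennreal (increment_energy (c N) (p N) (n N))"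
      using increment_sum_second_moment[of "p N" "n N" "c N"] p by (subst nn_integral_eq_integral) auto
    also have "\<dots> \<le> ennreal K" by (intro ennreal_leI K)
    finally show "(\<integral>\<^sup>+\<omega>. ennreal ((?S N \<omega>)\<^sup>2) \<partial>M) \<le> ennreal K" .
  qed
  finally show ?thesis by (simp add: Liminf_const)
qed

end

locale noise_profile = brownian_setting M T F W
  for M :: "'a measure" and T F W +
  fixes f f' :: "real \<Rightarrow> real" and \<tau> \<tau>1 B :: real
  assumes \<tau>s: "0 < \<tau>" "\<tau> < \<tau>1" "\<tau>1 < T"
    and f_der: "\<And>x. (f has_real_derivative f' x) (at x)"
    and f'_cont: "continuous_on UNIV f'"
    and f'_bounds: "\<And>x. -2 \<le> f' x" "\<And>x. f' x \<le> 0"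
    and f'_steep: "\<And>x. 0 < x \<Longrightarrow> x < \<tau> \<Longrightarrow> f' x \<le> -1"
    and f_pos: "\<And>x. x < \<tau>1 \<Longrightarrow> 0 < f x"
    and f_zero: "\<And>x. \<tau>1 \<le> x \<Longrightarrow> f x = 0"
    and f_bound: "\<And>x. \<bar>f x\<bar> \<le> B"
begin

text \<open>
  The Stieltjes integral of \<open>f\<close> along a path with \<open>w 0 = 0\<close>, after integration by parts; the
  boundary term at \<open>T\<close> is absent because \<open>f T = 0\<close>.
\<close>
definition noise :: "(real \<Rightarrow> real) \<Rightarrow> real" where
  "noise w = - integral {0..T} (\<lambda>s. f' s * w s)"

lemma f_der_within: "(f has_real_derivative f' x) (at x within A)"
  using f_der by (rule DERIV_subset) simp

lemma f'_cont_on: "continuous_on A f'"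
  using f'_cont continuous_on_subset by blast

lemma f_diff: "r \<le> s \<Longrightarrow> 0 \<le> f r - f s \<and> f r - f s \<le> 2 * (s - r)"
proof (cases "r = s")
  case False
  assume "r \<le> s"
  then have rs: "r < s" using False by simp
  obtain z where z: "f s - f r = (s - r) * f' z" using MVT2[OF rs, of f f'] f_der by blast
  have "(s - r) * (-2) \<le> (s - r) * f' z"
    by (rule mult_left_mono) (use rs f'_bounds(1)[of z] in simp_all)
  moreover have "(s - r) * f' z \<le> (s - r) * 0"
    by (rule mult_left_mono) (use rs f'_bounds(2)[of z] in simp_all)
  ultimately show ?thesis using z by simp
qed simp

lemma f_lipschitz: "\<bar>f s - f r\<bar> \<le> 2 * \<bar>s - r\<bar>"
  using f_diff[of r s] f_diff[of s r] by (cases "r \<le> s") auto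

lemma f_diff_steep: "0 \<le> r \<Longrightarrow> r \<le> s \<Longrightarrow> s \<le> \<tau> \<Longrightarrow> s - r \<le> f r - f s"
proof (cases "r = s")
  case False
  assume "0 \<le> r" "r \<le> s" "s \<le> \<tau>"
  then have rs: "r < s" using False by simp
  obtain z where z: "r < z" "z < s" "f s - f r = (s - r) * f' z" using MVT2[OF rs, of f f'] f_der by blast
  have "f' z \<le> -1" using z \<open>0 \<le> r\<close> \<open>s \<le> \<tau>\<close> by (intro f'_steep) auto
  then have "(s - r) * f' z \<le> (s - r) * (-1)" using rs by (intro mult_left_mono) auto
  then show ?thesis using z by simp
qed simp

lemma f'_zero: "\<tau>1 < x \<Longrightarrow> f' x = 0"
proof -
  assume x: "\<tau>1 < x"
  have "\<forall>\<^sub>F y in nhds x. \<tau>1 < y" using x by (rule order_tendstoD(1)[OF filterlim_ident])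
  then have "\<forall>\<^sub>F y in nhds x. f y = 0" by eventually_elim (simp add: f_zero)
  then have "(f has_real_derivative 0) (at x) \<longleftrightarrow> ((\<lambda>_. 0) has_real_derivative (0::real)) (at x)"
    using f_zero[of x] x by (intro DERIV_cong_ev) auto
  then show "f' x = 0" using f_der[of x] DERIV_unique by fastforce
qed

lemma f'w_integrable:
  assumes "continuous_on {0..T} w" "0 \<le> u" "v \<le> T"
  shows "(\<lambda>s. f' s * w s) integrable_on {u..v}"
  using assms by (intro integrable_continuous_real continuous_intros f'_cont_on)
    (auto intro: continuous_on_subset)

lemma integral_f'w_tail:
  assumes "\<tau>1 \<le> t"
  shows "integral {t..T} (\<lambda>s. f' s * w s) = 0"
proof -
  have "integral {t..T} (\<lambda>s. f' s * w s) = integral {t..T} (\<lambda>s. 0)"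
    by (rule integral_spike[of "{\<tau>1}"]) (use assms f'_zero in \<open>auto simp: less_le\<close>)
  then show ?thesis by simp
qed

lemma noise_eq:
  assumes w: "continuous_on {0..T} w" and t: "\<tau>1 \<le> t" "t \<le> T"
  shows "noise w = - integral {0..t} (\<lambda>s. f' s * w s)"
  using Henstock_Kurzweil_Integration.integral_combine[of 0 t T "\<lambda>s. f' s * w s"]
    f'w_integrable[OF w, of 0 T] integral_f'w_tail[OF t(1), of w] t \<tau>s
  by (simp add: noise_def)

lemma noise_uniform_sums:
  assumes w: "continuous_on {0..T} w" "w 0 = 0" and t: "\<tau>1 \<le> t" "t \<le> T"
  shows "(\<lambda>N. \<Sum>i<Suc N. f (t * real i / real (Suc N)) *
    (w (t * real (Suc i) / real (Suc N)) - w (t * real i / real (Suc N)))) \<longlonglongrightarrow> noise w"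
proof -
  have t0: "0 \<le> t" using t \<tau>s by simp
  have "(\<lambda>N. \<Sum>i<Suc N. f (uniform_grid 0 t (Suc N) i) *
      (w (uniform_grid 0 t (Suc N) (Suc i)) - w (uniform_grid 0 t (Suc N) i)))
    \<longlonglongrightarrow> f t * w t - f 0 * w 0 - integral {0..t} (\<lambda>s. f' s * w s)"
  proof (rule stieltjes_sums_tendsto[OF t0, where d = "\<lambda>N. t / real (Suc N)"])
    show "continuous_on {0..t} w" using w(1) t by (auto intro: continuous_on_subset)
    show "(\<lambda>N. t / real (Suc N)) \<longlonglongrightarrow> 0" by (rule LIMSEQ_Suc[OF lim_const_over_n])
  qed (use uniform_grid[OF t0] f_der_within f'_cont_on in auto)
  then show ?thesis
    using noise_eq[OF w(1) t] f_zero[OF t(1)] w(2) by (simp add: uniform_grid_def)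
qed

lemma noise_grid_sums:
  assumes w: "continuous_on {0..T} w" "w 0 = 0" and abT: "0 \<le> a" "a < b" "b \<le> T"
  shows "(\<lambda>N. \<Sum>i<4 * 2 ^ N. f (grid a b T (2 ^ N) i) *
    (w (grid a b T (2 ^ N) (Suc i)) - w (grid a b T (2 ^ N) i))) \<longlonglongrightarrow> noise w"
proof -
  have g: "swap_grid a b T (2 ^ N)" for N by unfold_locales (use abT in auto)
  have "(\<lambda>N. \<Sum>i<4 * 2 ^ N. f (grid a b T (2 ^ N) i) *
      (w (grid a b T (2 ^ N) (Suc i)) - w (grid a b T (2 ^ N) i)))
    \<longlonglongrightarrow> f T * w T - f 0 * w 0 - integral {0..T} (\<lambda>s. f' s * w s)"
  proof (rule stieltjes_sums_tendsto[where d = "\<lambda>N. T / 2 ^ N"])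
    show "(\<lambda>N. T / 2 ^ N) \<longlonglongrightarrow> 0" by (rule LIMSEQ_divide_realpow_zero) simp
    show "grid a b T (2 ^ N) (Suc i) - grid a b T (2 ^ N) i \<le> T / 2 ^ N" for N i
      using swap_grid.grid_mesh[OF g, of N i] by simp
  qed (use w swap_grid.grid_0[OF g] swap_grid.grid_at(4)[OF g] swap_grid.grid_mono_step[OF g]
      f_der_within f'_cont_on T_pos in auto)
  then show ?thesis using f_zero[of T] \<tau>s w(2) by (simp add: noise_def)
qed

definition W_noise :: "'a \<Rightarrow> real" where "W_noise \<omega> = noise (\<lambda>s. W s \<omega>)"
definition swapped_noise :: "real \<Rightarrow> real \<Rightarrow> 'a \<Rightarrow> real" where
  "swapped_noise a b \<omega> = noise (swap_path a b (\<lambda>s. W s \<omega>))"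

lemma W_noise_measurable [measurable]: "W_noise \<in> borel_measurable M"
proof (rule borel_measurable_LIMSEQ_metric)
  show "(\<lambda>N. \<Sum>i<Suc N. f (T * real i / real (Suc N)) *
      (W (T * real (Suc i) / real (Suc N)) \<omega> - W (T * real i / real (Suc N)) \<omega>)) \<longlonglongrightarrow> W_noise \<omega>"
    if "\<omega> \<in> space M" for \<omega>
    unfolding W_noise_def using \<tau>s
    by (intro noise_uniform_sums W_continuous[OF that] W_0[OF that]) auto
  fix N
  have W: "W (T * real i / real (Suc N)) \<in> borel_measurable M" if "i \<le> Suc N" for i
  proof (rule W_measurable)
    have "T * real i \<le> T * real (Suc N)" using that T_pos by (intro mult_left_mono) auto
    then show "T * real i / real (Suc N) \<in> {0..T}" using T_pos by (auto simp: divide_le_eq)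
  qed
  show "(\<lambda>\<omega>. \<Sum>i<Suc N. f (T * real i / real (Suc N)) *
      (W (T * real (Suc i) / real (Suc N)) \<omega> - W (T * real i / real (Suc N)) \<omega>)) \<in> borel_measurable M"
    by (intro borel_measurable_sum borel_measurable_times borel_measurable_diff W) auto
qed

end

section \<open>The effect of the exchange on the noise\<close>

context noise_profile begin

text \<open>
  With \<open>S = W_noise + noise_half_diff\<close>, the noises of the original and of the exchanged path are
  \<open>S\<close> minus and plus this quantity.
\<close>
definition noise_half_diff :: "real \<Rightarrow> real \<Rightarrow> 'a \<Rightarrow> real" where
  "noise_half_diff a b \<omega> = (swapped_noise a b \<omega> - W_noise \<omega>) / 2"

text \<open>
  Half the difference of the weights that an increment receives in the two noises.
\<close>
definition swap_coeff :: "real \<Rightarrow> real \<Rightarrow> nat \<Rightarrow> nat \<Rightarrow> real" where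
  "swap_coeff a b n i = (f (grid a b T n (swap_index n i)) - f (grid a b T n i)) / 2"

lemma swapped_noise_sums:
  assumes abT: "0 \<le> a" "a < b" "b \<le> T" and \<omega>: "\<omega> \<in> space M"
  shows "(\<lambda>N. \<Sum>i<4 * 2 ^ N. f (grid a b T (2 ^ N) i) *
    (swap_path a b (\<lambda>s. W s \<omega>) (grid a b T (2 ^ N) (Suc i)) - swap_path a b (\<lambda>s. W s \<omega>) (grid a b T (2 ^ N) i)))
    \<longlonglongrightarrow> swapped_noise a b \<omega>"
  unfolding swapped_noise_def using abT W_0[OF \<omega>]
  by (intro noise_grid_sums swap_path_continuous W_continuous[OF \<omega>]) (auto simp: swap_path_def)

lemma W_noise_sums:
  assumes abT: "0 \<le> a" "a < b" "b \<le> T" and \<omega>: "\<omega> \<in> space M"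
  shows "(\<lambda>N. \<Sum>i<4 * 2 ^ N. f (grid a b T (2 ^ N) i) *
    (W (grid a b T (2 ^ N) (Suc i)) \<omega> - W (grid a b T (2 ^ N) i) \<omega>)) \<longlonglongrightarrow> W_noise \<omega>"
  unfolding W_noise_def using abT
  by (intro noise_grid_sums W_continuous[OF \<omega>] W_0[OF \<omega>]) auto

lemma noise_half_diff_sums:
  assumes abT: "0 \<le> a" "a < b" "b \<le> T" and \<omega>: "\<omega> \<in> space M"
  shows "(\<lambda>N. increment_sum (swap_coeff a b (2 ^ N)) (grid a b T (2 ^ N)) (4 * 2 ^ N) \<omega>)
    \<longlonglongrightarrow> noise_half_diff a b \<omega>"
proof -
  let ?g = "\<lambda>N. grid a b T (2 ^ N)"
  have eq: "increment_sum (swap_coeff a b (2 ^ N)) (?g N) (4 * 2 ^ N) \<omega>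
    = ((\<Sum>i<4 * 2 ^ N. f (?g N i) *
        (swap_path a b (\<lambda>s. W s \<omega>) (?g N (Suc i)) - swap_path a b (\<lambda>s. W s \<omega>) (?g N i)))
      - (\<Sum>i<4 * 2 ^ N. f (?g N i) * (W (?g N (Suc i)) \<omega> - W (?g N i) \<omega>))) / 2" for N
  proof -
    interpret swap_grid a b T "2 ^ N" by unfold_locales (use abT in auto)
    let ?\<sigma> = "swap_index (2 ^ N)"
    have "(\<Sum>i<4 * 2 ^ N. f (p i) *
        (swap_path a b (\<lambda>s. W s \<omega>) (p (Suc i)) - swap_path a b (\<lambda>s. W s \<omega>) (p i)))
      = (\<Sum>i<4 * 2 ^ N. f (p (?\<sigma> (?\<sigma> i))) * (W (p (Suc (?\<sigma> i))) \<omega> - W (p (?\<sigma> i)) \<omega>))"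
      unfolding swap_path_increment swap_index_involution ..
    also have "\<dots> = (\<Sum>i<4 * 2 ^ N. f (p (?\<sigma> i)) * (W (p (Suc i)) \<omega> - W (p i) \<omega>))"
      using sum.reindex_bij_betw[OF swap_index_bij, of "\<lambda>i. f (p (?\<sigma> i)) * (W (p (Suc i)) \<omega> - W (p i) \<omega>)"] .
    finally have s: "(\<Sum>i<4 * 2 ^ N. f (p i) *
        (swap_path a b (\<lambda>s. W s \<omega>) (p (Suc i)) - swap_path a b (\<lambda>s. W s \<omega>) (p i)))
      = (\<Sum>i<4 * 2 ^ N. f (p (?\<sigma> i)) * (W (p (Suc i)) \<omega> - W (p i) \<omega>))" .
    show ?thesis
      unfolding s increment_sum_def swap_coeff_def sum_subtractf[symmetric] sum_divide_distrib
      by (intro sum.cong refl) (simp add: left_diff_distrib[symmetric])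
  qed
  show ?thesis
    unfolding eq noise_half_diff_def
    by (intro tendsto_divide tendsto_diff swapped_noise_sums[OF abT \<omega>] W_noise_sums[OF abT \<omega>] tendsto_const) simp
qed

text \<open>
  The exchange shifts an increment by \<open>h\<close>, and the derivative of \<open>f\<close> is between \<open>-2\<close> and \<open>-1\<close> on
  \<open>{0<..<\<tau>}\<close>.
\<close>
lemma swap_coeff_bounds:
  assumes ab: "0 \<le> a" "a < b" "b \<le> \<tau>" and n: "0 < n"
  defines "h \<equiv> (b - a) / 2"
  shows "i < n \<or> 3 * n \<le> i \<Longrightarrow> swap_coeff a b n i = 0"
    and "n \<le> i \<Longrightarrow> i < 3 * n \<Longrightarrow> h / 2 \<le> \<bar>swap_coeff a b n i\<bar> \<and> \<bar>swap_coeff a b n i\<bar> \<le> h"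
proof -
  interpret swap_grid a b T n by unfold_locales (use ab n \<tau>s in auto)
  show "i < n \<or> 3 * n \<le> i \<Longrightarrow> swap_coeff a b n i = 0"
    using n by (auto simp: swap_coeff_def swap_index_def)
  assume i: "n \<le> i" "i < 3 * n"
  have *: "h / 2 \<le> \<bar>f s - f r\<bar> / 2 \<and> \<bar>f s - f r\<bar> / 2 \<le> h" if "s = r + h" "0 \<le> r" "s \<le> \<tau>" for r s
    using f_diff[of r s] f_diff_steep[of r s] that ab by (auto simp: h_def)
  show "h / 2 \<le> \<bar>swap_coeff a b n i\<bar> \<and> \<bar>swap_coeff a b n i\<bar> \<le> h"
  proof (cases "i < 2 * n")
    case True
    have "p (i + n) \<le> p (3 * n)" using True by (intro grid_mono) auto
    then show ?thesis
      using *[of "p (i + n)" "p i"] grid_shift[of i] grid_nonneg[of i] grid_at ab True i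
      by (simp add: swap_coeff_def swap_index_def h_def)
  next
    case False
    have e: "i - n + n = i" using i by simp
    have "p i \<le> p (3 * n)" using i by (intro grid_mono) auto
    then show ?thesis
      using *[of "p i" "p (i - n)"] grid_shift[of "i - n"] grid_nonneg[of "i - n"] grid_at ab False i
      unfolding e by (simp add: swap_coeff_def swap_index_def h_def abs_minus_commute)
  qed
qed

lemma swap_energy_bounds:
  assumes ab: "0 \<le> a" "a < b" "b \<le> \<tau>" and n: "0 < n"
  defines "h \<equiv> (b - a) / 2"
  shows "h ^ 3 / 2 \<le> increment_energy (swap_coeff a b n) (grid a b T n) (4 * n)"
    and "increment_energy (swap_coeff a b n) (grid a b T n) (4 * n) \<le> 2 * h ^ 3"
proof -
  interpret swap_grid a b T n by unfold_locales (use ab n \<tau>s in auto)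
  have h: "0 < h" using ab by (simp add: h_def)
  note c = swap_coeff_bounds[OF ab n, folded h_def]
  have "increment_energy (swap_coeff a b n) p (4 * n)
    = (\<Sum>i\<in>{n..<3 * n}. (swap_coeff a b n i)\<^sup>2 * (p (Suc i) - p i))"
    unfolding increment_energy_def by (rule sum.mono_neutral_right) (use c(1) in auto)
  also have "\<dots> = (\<Sum>i\<in>{n..<3 * n}. (swap_coeff a b n i)\<^sup>2 * (h / real n))"
    by (rule sum.cong[OF refl]) (use grid_step in \<open>simp add: h_def\<close>)
  finally have e: "increment_energy (swap_coeff a b n) p (4 * n)
    = (\<Sum>i\<in>{n..<3 * n}. (swap_coeff a b n i)\<^sup>2 * (h / real n))" .
  have sq: "(h / 2)\<^sup>2 \<le> (swap_coeff a b n i)\<^sup>2" "(swap_coeff a b n i)\<^sup>2 \<le> h\<^sup>2" if "i \<in> {n..<3 * n}" for i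
  proof -
    from c(2)[of i] that have *: "h / 2 \<le> \<bar>swap_coeff a b n i\<bar>" "\<bar>swap_coeff a b n i\<bar> \<le> h" by auto
    show "(h / 2)\<^sup>2 \<le> (swap_coeff a b n i)\<^sup>2" using power_mono[OF *(1), of 2] h by simp
    show "(swap_coeff a b n i)\<^sup>2 \<le> h\<^sup>2" using power_mono[OF *(2), of 2] by simp
  qed
  have "(\<Sum>i\<in>{n..<3 * n}. (h / 2)\<^sup>2 * (h / real n)) \<le> increment_energy (swap_coeff a b n) p (4 * n)"
    unfolding e using sq h by (intro sum_mono mult_right_mono) auto
  moreover have "(\<Sum>i\<in>{n..<3 * n}. (h / 2)\<^sup>2 * (h / real n)) = h ^ 3 / 2"
    using n by (simp add: power2_eq_square power3_eq_cube field_simps)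
  ultimately show "h ^ 3 / 2 \<le> increment_energy (swap_coeff a b n) p (4 * n)" by simp
  have "increment_energy (swap_coeff a b n) p (4 * n) \<le> (\<Sum>i\<in>{n..<3 * n}. h\<^sup>2 * (h / real n))"
    unfolding e using sq h by (intro sum_mono mult_right_mono) auto
  moreover have "(\<Sum>i\<in>{n..<3 * n}. h\<^sup>2 * (h / real n)) = 2 * h ^ 3"
    using n by (simp add: power2_eq_square power3_eq_cube field_simps)
  ultimately show "increment_energy (swap_coeff a b n) p (4 * n) \<le> 2 * h ^ 3" by simp
qed

lemma noise_half_diff_measurable:
  assumes ab: "0 \<le> a" "a < b" "b \<le> \<tau>"
  shows "noise_half_diff a b \<in> borel_measurable (F \<tau>)"
proof (rule borel_measurable_LIMSEQ_metric)
  have \<tau>T: "\<tau> \<in> {0..T}" using \<tau>s by simp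
  fix N
  interpret swap_grid a b T "2 ^ N" by unfold_locales (use ab \<tau>s in auto)
  have "increment_sum (swap_coeff a b (2 ^ N)) p (4 * 2 ^ N)
    = increment_sum (swap_coeff a b (2 ^ N)) p (3 * 2 ^ N)"
    unfolding increment_sum_def
    by (intro ext sum.mono_neutral_right) (use swap_coeff_bounds(1)[OF ab, of "2 ^ N"] in auto)
  moreover have "increment_sum (swap_coeff a b (2 ^ N)) p (3 * 2 ^ N) \<in> borel_measurable (F \<tau>)"
    using grid_mono_step grid_at ab \<tau>s by (intro increment_sum_measurable_F) auto
  ultimately show "increment_sum (swap_coeff a b (2 ^ N)) p (4 * 2 ^ N) \<in> borel_measurable (F \<tau>)" by simp
next
  fix \<omega> assume "\<omega> \<in> space (F \<tau>)"
  then have "\<omega> \<in> space M" using \<tau>s by simp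
  then show "(\<lambda>N. increment_sum (swap_coeff a b (2 ^ N)) (grid a b T (2 ^ N)) (4 * 2 ^ N) \<omega>)
    \<longlonglongrightarrow> noise_half_diff a b \<omega>"
    using ab \<tau>s by (intro noise_half_diff_sums) auto
qed

lemma noise_half_diff_second_moment:
  assumes ab: "0 \<le> a" "a < b" "b \<le> \<tau>"
  shows "(\<integral>\<^sup>+\<omega>. ennreal ((noise_half_diff a b \<omega>)\<^sup>2) \<partial>M) \<le> ennreal (2 * \<tau> ^ 3)"
proof (rule increment_sum_limit_second_moment)
  show "(\<lambda>N. increment_sum (swap_coeff a b (2 ^ N)) (grid a b T (2 ^ N)) (4 * 2 ^ N) \<omega>)
    \<longlonglongrightarrow> noise_half_diff a b \<omega>" if "\<omega> \<in> space M" for \<omega>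
    using ab \<tau>s that by (intro noise_half_diff_sums) auto
  fix N
  interpret swap_grid a b T "2 ^ N" by unfold_locales (use ab \<tau>s in auto)
  show "0 \<le> p 0" "p (4 * 2 ^ N) \<le> T" "p i \<le> p (Suc i)" for i
    using grid_at grid_mono_step by auto
  have "((b - a) / 2) ^ 3 \<le> \<tau> ^ 3" using ab by (intro power_mono) auto
  then show "increment_energy (swap_coeff a b (2 ^ N)) p (4 * 2 ^ N) \<le> 2 * \<tau> ^ 3"
    using swap_energy_bounds(2)[OF ab, of "2 ^ N"] by simp
qed

lemma noise_half_diff_cos:
  assumes ab: "0 \<le> a" "a < b" "b \<le> \<tau>"
  shows "expectation (\<lambda>\<omega>. cos (\<theta> * noise_half_diff a b \<omega>)) \<le> exp (- (\<theta>\<^sup>2 * ((b - a) / 2) ^ 3) / 4)"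
proof -
  let ?D = "noise_half_diff a b" and ?h = "(b - a) / 2"
  let ?E = "\<lambda>N. increment_energy (swap_coeff a b (2 ^ N)) (grid a b T (2 ^ N)) (4 * 2 ^ N)"
  have g: "swap_grid a b T (2 ^ N)" for N by unfold_locales (use ab \<tau>s in auto)
  have Dm [measurable]: "?D \<in> borel_measurable M"
    using measurable_F_M[OF noise_half_diff_measurable[OF ab]] \<tau>s by auto
  have sp: "space M \<in> sets (F 0)" using sets.top[of "F 0"] T_pos by simp
  have "(\<lambda>N. complex_of_real (prob (space M) * exp (- (\<theta>\<^sup>2 * ?E N) / 2)))
    \<longlonglongrightarrow> (CLINT \<omega>|M. indicator (space M) \<omega> * iexp (\<theta> * ?D \<omega>))"
    using ab \<tau>s swap_grid.grid_0[OF g] swap_grid.grid_at(4)[OF g] swap_grid.grid_mono_step[OF g]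
    by (intro increment_sum_limit_iexp[where s = 0] noise_half_diff_sums sp) auto
  from tendsto_Re[OF this]
  have lim: "(\<lambda>N. exp (- (\<theta>\<^sup>2 * ?E N) / 2)) \<longlonglongrightarrow> Re (CLINT \<omega>|M. indicator (space M) \<omega> * iexp (\<theta> * ?D \<omega>))"
    by (simp add: prob_space)
  have "(CLINT \<omega>|M. indicator (space M) \<omega> * iexp (\<theta> * ?D \<omega>)) = (CLINT \<omega>|M. iexp (\<theta> * ?D \<omega>))"
    by (intro Bochner_Integration.integral_cong refl) simp
  moreover have "integrable M (\<lambda>\<omega>. iexp (\<theta> * ?D \<omega>))"
    by (rule integrable_const_bound[of _ 1]) auto
  then have "Re (CLINT \<omega>|M. iexp (\<theta> * ?D \<omega>)) = expectation (\<lambda>\<omega>. Re (iexp (\<theta> * ?D \<omega>)))"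
    by (rule integral_Re[symmetric])
  moreover have "Re (iexp (\<theta> * ?D \<omega>)) = cos (\<theta> * ?D \<omega>)" for \<omega>
    by (simp add: Re_exp)
  ultimately have "(\<lambda>N. exp (- (\<theta>\<^sup>2 * ?E N) / 2)) \<longlonglongrightarrow> expectation (\<lambda>\<omega>. cos (\<theta> * ?D \<omega>))"
    using lim by simp
  then show ?thesis
  proof (rule LIMSEQ_le_const2)
    have "exp (- (\<theta>\<^sup>2 * ?E N) / 2) \<le> exp (- (\<theta>\<^sup>2 * ?h ^ 3) / 4)" for N
    proof -
      have "\<theta>\<^sup>2 * (?h ^ 3 / 2) \<le> \<theta>\<^sup>2 * ?E N"
        using swap_energy_bounds(1)[OF ab, of "2 ^ N"] by (intro mult_left_mono) auto
      then show ?thesis by simp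
    qed
    then show "\<exists>N. \<forall>n\<ge>N. exp (- (\<theta>\<^sup>2 * ?E n) / 2) \<le> exp (- (\<theta>\<^sup>2 * ?h ^ 3) / 4)" by blast
  qed
qed

text \<open>
  The contributions of \<open>{0..\<tau>}\<close> and of \<open>{\<tau>..\<tau>1}\<close> to the noise, again after integration by parts.
\<close>
definition early_noise :: "'a \<Rightarrow> real" where
  "early_noise \<omega> = f \<tau> * W \<tau> \<omega> - integral {0..\<tau>} (\<lambda>s. f' s * W s \<omega>)"

definition late_noise :: "'a \<Rightarrow> real" where
  "late_noise \<omega> = - f \<tau> * W \<tau> \<omega> - integral {\<tau>..\<tau>1} (\<lambda>s. f' s * W s \<omega>)"

lemma W_noise_split: "\<omega> \<in> space M \<Longrightarrow> W_noise \<omega> = early_noise \<omega> + late_noise \<omega>"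
  using Henstock_Kurzweil_Integration.integral_combine[of 0 \<tau> \<tau>1 "\<lambda>s. f' s * W s \<omega>"]
    f'w_integrable[OF W_continuous, of \<omega> 0 \<tau>1] noise_eq[OF W_continuous, of \<omega> \<tau>1] \<tau>s
  by (simp add: W_noise_def early_noise_def late_noise_def)

lemma part_sums:
  assumes uv: "0 \<le> u" "u \<le> v" "v \<le> T" and \<omega>: "\<omega> \<in> space M" and L: "\<And>N. N < L N"
  shows "(\<lambda>N. increment_sum (\<lambda>i. f (uniform_grid u v (L N) i)) (uniform_grid u v (L N)) (L N) \<omega>)
    \<longlonglongrightarrow> f v * W v \<omega> - f u * W u \<omega> - integral {u..v} (\<lambda>s. f' s * W s \<omega>)"
  unfolding increment_sum_def
proof (rule stieltjes_sums_tendsto[OF uv(2), where d = "\<lambda>N. (v - u) / real (L N)"])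
  have L0: "0 < L N" for N using L[of N] by simp
  show "continuous_on {u..v} (\<lambda>s. W s \<omega>)"
    using W_continuous[OF \<omega>] uv by (auto intro: continuous_on_subset)
  show "(\<lambda>N. (v - u) / real (L N)) \<longlonglongrightarrow> 0" using uv(2) by (intro mesh_tendsto_0 L) simp
  show "uniform_grid u v (L N) 0 = u" "uniform_grid u v (L N) (L N) = v"
    "uniform_grid u v (L N) i \<le> uniform_grid u v (L N) (Suc i)"
    "uniform_grid u v (L N) (Suc i) - uniform_grid u v (L N) i \<le> (v - u) / real (L N)" for N i
    using uniform_grid[OF uv(2) L0] by auto
qed (use f_der_within f'_cont_on in auto)

lemma early_noise_sums:
  assumes \<omega>: "\<omega> \<in> space M"
  shows "(\<lambda>N. increment_sum (\<lambda>i. f (uniform_grid 0 \<tau> (Suc N) i)) (uniform_grid 0 \<tau> (Suc N)) (Suc N) \<omega>)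
    \<longlonglongrightarrow> early_noise \<omega>"
  using part_sums[OF _ _ _ \<omega>, of 0 \<tau> Suc] W_0[OF \<omega>] \<tau>s by (simp add: early_noise_def)

lemma early_noise_measurable: "early_noise \<in> borel_measurable (F \<tau>)"
proof (rule borel_measurable_LIMSEQ_metric)
  have \<tau>0: "0 \<le> \<tau>" using \<tau>s by simp
  show "increment_sum (\<lambda>i. f (uniform_grid 0 \<tau> (Suc N) i)) (uniform_grid 0 \<tau> (Suc N)) (Suc N) \<in> borel_measurable (F \<tau>)" for N
    using uniform_grid[OF \<tau>0, of "Suc N"] \<tau>s by (intro increment_sum_measurable_F) auto
qed (use early_noise_sums \<tau>s in auto)

lemma early_noise_second_moment: "(\<integral>\<^sup>+\<omega>. ennreal ((early_noise \<omega>)\<^sup>2) \<partial>M) \<le> ennreal (B\<^sup>2 * T)"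
proof (rule increment_sum_limit_second_moment)
  have \<tau>0: "0 \<le> \<tau>" using \<tau>s by simp
  fix N
  let ?p = "uniform_grid 0 \<tau> (Suc N)"
  note g = uniform_grid[OF \<tau>0, of "Suc N"]
  show "0 \<le> ?p 0" "?p (Suc N) \<le> T" "?p i \<le> ?p (Suc i)" for i using g \<tau>s by auto
  have fb: "(f x)\<^sup>2 \<le> B\<^sup>2" for x using power_mono[OF f_bound[of x], of 2] by simp
  have "increment_energy (\<lambda>i. f (?p i)) ?p (Suc N) \<le> (\<Sum>i<Suc N. B\<^sup>2 * (\<tau> / real (Suc N)))"
    unfolding increment_energy_def
  proof (rule sum_mono)
    fix i
    have "?p (Suc i) - ?p i = \<tau> / real (Suc N)" using g(3)[of i] by simp
    then show "(f (?p i))\<^sup>2 * (?p (Suc i) - ?p i) \<le> B\<^sup>2 * (\<tau> / real (Suc N))"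
      using \<tau>0 by (simp only:) (intro mult_right_mono fb, simp)
  qed
  also have "\<dots> = B\<^sup>2 * \<tau>" by simp
  also have "\<dots> \<le> B\<^sup>2 * T" using \<tau>s by (intro mult_left_mono) auto
  finally show "increment_energy (\<lambda>i. f (?p i)) ?p (Suc N) \<le> B\<^sup>2 * T" .
qed (rule early_noise_sums)

text \<open>
  The variance is positive because \<open>f\<close> is nonincreasing and still positive at the midpoint of
  \<open>{\<tau>..\<tau>1}\<close>.
\<close>
lemma late_noise_gaussian:
  "\<exists>v>0. \<forall>A\<in>sets (F \<tau>). \<forall>\<theta>.
      (CLINT \<omega>|M. indicator A \<omega> * iexp (\<theta> * late_noise \<omega>)) = prob A * exp (- (\<theta>\<^sup>2 * v) / 2)"
proof -
  \<comment> \<open>an even number of steps, so that the first \<open>Suc N\<close> of them fill the first half of the interval\<close>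
  define L where "L N = 2 * Suc N" for N
  define p where "p N = uniform_grid \<tau> \<tau>1 (L N)" for N
  define E where "E N = increment_energy (\<lambda>i. f (p N i)) (p N) (L N)" for N
  have \<tau>le: "\<tau> \<le> \<tau>1" using \<tau>s by simp
  have L: "0 < L N" "N < L N" for N by (simp_all add: L_def)
  have Lr: "real (L N) = 2 * real (Suc N)" for N by (simp add: L_def)
  note g = uniform_grid[OF \<tau>le L(1), folded p_def]
  have sums: "(\<lambda>N. increment_sum (\<lambda>i. f (p N i)) (p N) (L N) \<omega>) \<longlonglongrightarrow> late_noise \<omega>" if "\<omega> \<in> space M" for \<omega>
    using part_sums[OF _ \<tau>le _ that L(2)] \<tau>s f_zero[of \<tau>1] by (simp add: late_noise_def p_def)
  define v where "v = (f \<tau>1)\<^sup>2 * \<tau>1 - (f \<tau>)\<^sup>2 * \<tau> - integral {\<tau>..\<tau>1} (\<lambda>s. 2 * f s * f' s * s)"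
  have Ev: "E \<longlonglongrightarrow> v"
    unfolding E_def increment_energy_def v_def
  proof (rule stieltjes_sums_tendsto[OF \<tau>le, where d = "\<lambda>N. (\<tau>1 - \<tau>) / real (L N)" and w = "\<lambda>s. s"
        and \<phi> = "\<lambda>s. (f s)\<^sup>2"])
    show "(\<lambda>N. (\<tau>1 - \<tau>) / real (L N)) \<longlonglongrightarrow> 0" using \<tau>le by (intro mesh_tendsto_0 L(2)) simp
    show "continuous_on {\<tau>..\<tau>1} (\<lambda>s. 2 * f s * f' s)"
      by (intro continuous_intros f'_cont_on DERIV_continuous_on[OF f_der_within])
    show "((\<lambda>s. (f s)\<^sup>2) has_real_derivative 2 * f x * f' x) (at x within {\<tau>..\<tau>1})" for x
      by (auto intro!: derivative_eq_intros f_der_within)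
  qed (use g in auto)
  define m where "m = (\<tau> + \<tau>1) / 2"
  have "0 < f m" using \<tau>s by (intro f_pos) (simp add: m_def)
  then have pos: "0 < (f m)\<^sup>2 * ((\<tau>1 - \<tau>) / 2)" using \<tau>s by simp
  have "(f m)\<^sup>2 * ((\<tau>1 - \<tau>) / 2) \<le> E N" for N
  proof -
    have "(f m)\<^sup>2 * ((\<tau>1 - \<tau>) / 2) = (\<Sum>i<Suc N. (f m)\<^sup>2 * ((\<tau>1 - \<tau>) / real (L N)))"
      unfolding Lr by (simp del: of_nat_Suc)
    also have "\<dots> \<le> (\<Sum>i<Suc N. (f (p N i))\<^sup>2 * ((\<tau>1 - \<tau>) / real (L N)))"
    proof (intro sum_mono mult_right_mono)
      fix i assume i: "i \<in> {..<Suc N}"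
      have "(\<tau>1 - \<tau>) * real i / real (L N) \<le> (\<tau>1 - \<tau>) * real (Suc N) / real (L N)"
        using i \<tau>le by (intro divide_right_mono mult_left_mono) auto
      also have "\<dots> = (\<tau>1 - \<tau>) / 2" unfolding Lr by (simp del: of_nat_Suc)
      finally have "p N i \<le> m" by (simp add: p_def uniform_grid_def m_def field_simps)
      from f_diff[OF this] have "f m \<le> f (p N i)" by simp
      then show "(f m)\<^sup>2 \<le> (f (p N i))\<^sup>2" using \<open>0 < f m\<close> by (intro power_mono) auto
    qed (use \<tau>le in auto)
    also have "\<dots> \<le> (\<Sum>i<L N. (f (p N i))\<^sup>2 * ((\<tau>1 - \<tau>) / real (L N)))"
      using \<tau>le by (intro sum_mono2) (auto simp: L_def)
    also have "\<dots> = E N" by (simp add: E_def increment_energy_def g)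
    finally show ?thesis .
  qed
  then have "(f m)\<^sup>2 * ((\<tau>1 - \<tau>) / 2) \<le> v" by (intro LIMSEQ_le_const[OF Ev]) blast
  with pos have v: "0 < v" by linarith
  show ?thesis
  proof (intro exI[of _ v] conjI ballI allI v)
    fix A \<theta> assume A: "A \<in> sets (F \<tau>)"
    have "(\<lambda>N. complex_of_real (prob A * exp (- (\<theta>\<^sup>2 * E N) / 2)))
      \<longlonglongrightarrow> (CLINT \<omega>|M. indicator A \<omega> * iexp (\<theta> * late_noise \<omega>))"
      unfolding E_def using \<tau>s g A sums by (intro increment_sum_limit_iexp[where s = \<tau>]) auto
    moreover have "(\<lambda>N. complex_of_real (prob A * exp (- (\<theta>\<^sup>2 * E N) / 2)))
      \<longlonglongrightarrow> complex_of_real (prob A * exp (- (\<theta>\<^sup>2 * v) / 2))"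
      by (intro tendsto_of_real tendsto_mult tendsto_const tendsto_exp tendsto_divide tendsto_minus Ev) simp
    ultimately show "(CLINT \<omega>|M. indicator A \<omega> * iexp (\<theta> * late_noise \<omega>)) = prob A * exp (- (\<theta>\<^sup>2 * v) / 2)"
      by (rule LIMSEQ_unique)
  qed
qed

end

section \<open>The exchange is invisible to the observer\<close>

context noise_profile begin

lemma noise_half_diff_M: "0 \<le> a \<Longrightarrow> a < b \<Longrightarrow> b \<le> \<tau> \<Longrightarrow> noise_half_diff a b \<in> borel_measurable M"
  using measurable_F_M[OF noise_half_diff_measurable] \<tau>s by auto

lemma swapped_noise_M:
  assumes "0 \<le> a" "a < b" "b \<le> \<tau>"
  shows "swapped_noise a b \<in> borel_measurable M"
proof -
  have "swapped_noise a b = (\<lambda>\<omega>. W_noise \<omega> + 2 * noise_half_diff a b \<omega>)"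
    by (rule ext) (simp only: noise_half_diff_def, simp add: field_simps)
  then show ?thesis using noise_half_diff_M[OF assms] by simp
qed

text \<open>
  The mean of the squared sine is at least \<open>1 / 4\<close>. By Chebyshev's inequality the bound on \<open>R\<close>
  makes the two truncations cost at most \<open>1 / 8\<close>: if one of them is active, then \<open>R\<^sup>2\<close> is at most
  \<open>3 * D\<^sup>2 + 2 * early_noise\<^sup>2\<close>, and the two second moments are at most \<open>2 * \<tau>^3\<close> and \<open>B\<^sup>2 * T\<close>.
\<close>
lemma sin_half_diff_lower_bound:
  assumes ab: "0 \<le> a" "a < b" "b \<le> \<tau>" and l: "1 \<le> l\<^sup>2 * ((b - a) / 2) ^ 3"
    and R: "0 < R" "8 * (6 * \<tau> ^ 3 + 2 * (B\<^sup>2 * T)) \<le> R\<^sup>2"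
  defines "D \<equiv> noise_half_diff a b"
  shows "ennreal (1 / 8) \<le> (\<integral>\<^sup>+\<omega>. ennreal ((sin (l * D \<omega>))\<^sup>2) * indicator {-R..R} (D \<omega>)
    * indicator {-R..R} (early_noise \<omega> + D \<omega>) \<partial>M)"
proof -
  have Dm [measurable]: "D \<in> borel_measurable M" unfolding D_def by (rule noise_half_diff_M[OF ab])
  have Em [measurable]: "early_noise \<in> borel_measurable M"
    using measurable_F_M[OF early_noise_measurable] \<tau>s by auto
  let ?g = "\<lambda>\<omega>. ennreal ((sin (l * D \<omega>))\<^sup>2) * indicator {-R..R} (D \<omega>)
    * indicator {-R..R} (early_noise \<omega> + D \<omega>)"
  have "expectation (\<lambda>\<omega>. (sin (l * D \<omega>))\<^sup>2) = (1 - expectation (\<lambda>\<omega>. cos (2 * l * D \<omega>))) / 2"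
  proof -
    have e: "(sin (l * D \<omega>))\<^sup>2 = 1 / 2 - cos (2 * l * D \<omega>) / 2" for \<omega>
      using cos_double_sin[of "l * D \<omega>"] by (simp add: mult.assoc diff_divide_distrib)
    have "integrable M (\<lambda>\<omega>. cos (2 * l * D \<omega>))"
      by (rule integrable_const_bound[of _ 1]) auto
    then show ?thesis unfolding e by (simp add: prob_space)
  qed
  moreover have "expectation (\<lambda>\<omega>. cos (2 * l * D \<omega>)) \<le> 1 / 2"
  proof -
    have "expectation (\<lambda>\<omega>. cos (2 * l * D \<omega>)) \<le> exp (- ((2 * l)\<^sup>2 * ((b - a) / 2) ^ 3) / 4)"
      unfolding D_def by (rule noise_half_diff_cos[OF ab])
    also have "\<dots> \<le> exp (- 1)" using l by (simp add: power_mult_distrib)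
    also have "\<dots> \<le> 1 / 2" using exp_ge_add_one_self[of 1] by (simp add: exp_minus field_simps)
    finally show ?thesis .
  qed
  ultimately have "1 / 4 \<le> expectation (\<lambda>\<omega>. (sin (l * D \<omega>))\<^sup>2)" by simp
  moreover have "integrable M (\<lambda>\<omega>. (sin (l * D \<omega>))\<^sup>2)"
    by (rule integrable_const_bound[of _ 1]) (auto simp: abs_square_le_1)
  ultimately have "ennreal (1 / 4) \<le> (\<integral>\<^sup>+\<omega>. ennreal ((sin (l * D \<omega>))\<^sup>2) \<partial>M)"
    by (simp add: nn_integral_eq_integral ennreal_leI)
  also have "\<dots> \<le> (\<integral>\<^sup>+\<omega>. ?g \<omega> + (ennreal (3 / R\<^sup>2) * ennreal ((D \<omega>)\<^sup>2) + ennreal (2 / R\<^sup>2) * ennreal ((early_noise \<omega>)\<^sup>2)) \<partial>M)"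
  proof (intro nn_integral_mono)
    fix \<omega>
    let ?d = "D \<omega>" and ?e = "early_noise \<omega>"
    show "ennreal ((sin (l * ?d))\<^sup>2) \<le> ?g \<omega> + (ennreal (3 / R\<^sup>2) * ennreal (?d\<^sup>2) + ennreal (2 / R\<^sup>2) * ennreal (?e\<^sup>2))"
    proof (cases "?d \<in> {-R..R} \<and> ?e + ?d \<in> {-R..R}")
      case True
      then show ?thesis by simp
    next
      case False
      have R2: "0 < R\<^sup>2" using R(1) by simp
      have "R\<^sup>2 \<le> 3 * ?d\<^sup>2 + 2 * ?e\<^sup>2"
      proof (cases "?d \<in> {-R..R}")
        case True
        then have "R < \<bar>?e + ?d\<bar>" using False by auto
        then have "R\<^sup>2 \<le> (?e + ?d)\<^sup>2" using power_mono[of R "\<bar>?e + ?d\<bar>" 2] R(1) by simp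
        also have "\<dots> \<le> 2 * ?e\<^sup>2 + 2 * ?d\<^sup>2"
          using zero_le_power2[of "?e - ?d"] by (simp add: power2_eq_square algebra_simps)
        finally show ?thesis using zero_le_power2[of ?d] by linarith
      next
        case False
        then have "R < \<bar>?d\<bar>" by auto
        then have "R\<^sup>2 \<le> ?d\<^sup>2" using power_mono[of R "\<bar>?d\<bar>" 2] R(1) by simp
        then show ?thesis using zero_le_power2[of ?d] zero_le_power2[of ?e] by linarith
      qed
      then have "1 \<le> 3 / R\<^sup>2 * ?d\<^sup>2 + 2 / R\<^sup>2 * ?e\<^sup>2"
        using R2 by (simp add: add_divide_distrib[symmetric])
      moreover have "(sin (l * ?d))\<^sup>2 \<le> 1" by (simp add: abs_square_le_1)
      ultimately have "ennreal ((sin (l * ?d))\<^sup>2) \<le> ennreal (3 / R\<^sup>2 * ?d\<^sup>2 + 2 / R\<^sup>2 * ?e\<^sup>2)"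
        by (intro ennreal_leI) linarith
      also have "\<dots> = ennreal (3 / R\<^sup>2) * ennreal (?d\<^sup>2) + ennreal (2 / R\<^sup>2) * ennreal (?e\<^sup>2)"
        using R2 by (simp add: ennreal_plus ennreal_mult[symmetric])
      finally show ?thesis by (rule order_trans) simp
    qed
  qed
  also have "\<dots> = (\<integral>\<^sup>+\<omega>. ?g \<omega> \<partial>M) + (ennreal (3 / R\<^sup>2) * (\<integral>\<^sup>+\<omega>. ennreal ((D \<omega>)\<^sup>2) \<partial>M)
      + ennreal (2 / R\<^sup>2) * (\<integral>\<^sup>+\<omega>. ennreal ((early_noise \<omega>)\<^sup>2) \<partial>M))"
    by (simp add: nn_integral_add nn_integral_cmult)
  also have "\<dots> \<le> (\<integral>\<^sup>+\<omega>. ?g \<omega> \<partial>M) + (ennreal (3 / R\<^sup>2) * ennreal (2 * \<tau> ^ 3) + ennreal (2 / R\<^sup>2) * ennreal (B\<^sup>2 * T))"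
    unfolding D_def
    by (intro add_left_mono add_mono mult_left_mono noise_half_diff_second_moment[OF ab]
        early_noise_second_moment) auto
  also have "ennreal (3 / R\<^sup>2) * ennreal (2 * \<tau> ^ 3) + ennreal (2 / R\<^sup>2) * ennreal (B\<^sup>2 * T)
    = ennreal ((6 * \<tau> ^ 3 + 2 * (B\<^sup>2 * T)) / R\<^sup>2)"
    using \<tau>s T_pos by (simp add: ennreal_mult[symmetric] ennreal_plus[symmetric] add_divide_distrib del: ennreal_plus)
  also have "\<dots> \<le> ennreal (1 / 8)"
    using R by (intro ennreal_leI) (simp add: divide_le_eq)
  finally have "ennreal (1 / 8) + ennreal (1 / 8) \<le> (\<integral>\<^sup>+\<omega>. ?g \<omega> \<partial>M) + ennreal (1 / 8)"
    by (simp add: ennreal_plus[symmetric] add_left_mono del: ennreal_plus)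
  then show ?thesis by (simp add: ennreal_add_left_cancel_le add.commute)
qed

text \<open>
  Given the past up to \<open>\<tau>\<close>, the half difference and the early noise are fixed, while the late noise is
  an independent Gaussian. It moves the sum into the window with a probability that is bounded below
  as long as the fixed terms are at most \<open>R\<close>.
\<close>
lemma oscillation_lower_bound:
  "\<exists>R \<rho>. 0 < R \<and> (\<forall>u. 0 < \<rho> u) \<and>
    (\<forall>a b l c u. 0 \<le> a \<and> a < b \<and> b \<le> \<tau> \<and> 2 \<le> l \<and> 1 \<le> l\<^sup>2 * ((b - a) / 2) ^ 3 \<and> R \<le> u \<longrightarrow>
      ennreal (\<rho> u) \<le> (\<integral>\<^sup>+\<omega>.
        ennreal ((sin (l * (W_noise \<omega> + noise_half_diff a b \<omega>) + c))\<^sup>2)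
          * indicator {u..u + 1} (W_noise \<omega> + noise_half_diff a b \<omega>)
          * (ennreal ((sin (l * noise_half_diff a b \<omega>))\<^sup>2)
              * indicator {-R..R} (noise_half_diff a b \<omega>)) \<partial>M))"
proof -
  obtain v where v: "0 < v" and "\<forall>A\<in>sets (F \<tau>). \<forall>\<theta>.
      (CLINT \<omega>|M. indicator A \<omega> * iexp (\<theta> * late_noise \<omega>)) = prob A * exp (- (\<theta>\<^sup>2 * v) / 2)"
    using late_noise_gaussian by blast
  then have ch: "(CLINT \<omega>|M. indicator A \<omega> * iexp (\<theta> * late_noise \<omega>)) = prob A * exp (- (\<theta>\<^sup>2 * v) / 2)"
    if "A \<in> sets (F \<tau>)" for A \<theta>
    using that by blast
  define s where "s = sqrt v"
  have s: "0 < s" using v by (simp add: s_def)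
  define R where "R = sqrt (8 * (6 * \<tau> ^ 3 + 2 * (B\<^sup>2 * T)))"
  have pos: "0 < 8 * (6 * \<tau> ^ 3 + 2 * (B\<^sup>2 * T))"
    using \<tau>s T_pos by (intro mult_pos_pos add_pos_nonneg) auto
  have R: "0 < R" "8 * (6 * \<tau> ^ 3 + 2 * (B\<^sup>2 * T)) \<le> R\<^sup>2" using pos by (simp_all add: R_def)
  define \<rho>0 where "\<rho>0 u = std_normal_density ((u + 1 + R) / s) / s / 4" for u
  have \<rho>0: "0 < \<rho>0 u" for u
    using s by (simp add: \<rho>0_def std_normal_density_def)
  have \<tau>T: "\<tau> \<in> {0..T}" using \<tau>s by simp
  have Em: "early_noise \<in> borel_measurable M" using measurable_F_M[OF early_noise_measurable \<tau>T] .
  have Lm: "late_noise \<in> borel_measurable M"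
  proof -
    have "(\<lambda>\<omega>. W_noise \<omega> - early_noise \<omega>) \<in> borel_measurable M" using Em by simp
    then show ?thesis
      by (rule measurable_cong[THEN iffD1, rotated]) (simp add: W_noise_split)
  qed
  show ?thesis
  proof (intro exI[of _ R] exI[of _ "\<lambda>u. \<rho>0 u / 8"] conjI allI impI; (elim conjE)?)
    show "0 < R" by (rule R)
    show "0 < \<rho>0 u / 8" for u using \<rho>0[of u] by simp
    fix a b l c u :: real
    assume ab: "0 \<le> a" "a < b" "b \<le> \<tau>" and l: "2 \<le> l" "1 \<le> l\<^sup>2 * ((b - a) / 2) ^ 3" and u: "R \<le> u"
    let ?D = "noise_half_diff a b"
    let ?N = "borel \<Otimes>\<^sub>M borel :: (real \<times> real) measure"
    define Y where "Y \<omega> = (early_noise \<omega> + ?D \<omega>, ?D \<omega>)" for \<omega>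
    have Y: "Y \<in> measurable (F \<tau>) ?N"
      unfolding Y_def
      by (intro measurable_Pair borel_measurable_add early_noise_measurable noise_half_diff_measurable[OF ab])
    have YM [measurable]: "Y \<in> measurable M ?N" using measurable_F_M[OF Y \<tau>T] .
    have Xm [measurable]: "(\<lambda>\<omega>. late_noise \<omega> / s) \<in> borel_measurable M" using Lm by simp
    have law: "distr M (?N \<Otimes>\<^sub>M borel) (\<lambda>\<omega>. (Y \<omega>, late_noise \<omega> / s)) = distr M ?N Y \<Otimes>\<^sub>M std_normal_distribution"
      unfolding s_def by (rule indep_normal_if_iexp(2)[OF Lm \<tau>T v ch Y])
    define H where "H q x = ennreal ((sin (l * (s * x + q) + c))\<^sup>2) * indicator {u..u + 1} (s * x + q)" for q x
    define G where "G z = ennreal ((sin (l * snd z))\<^sup>2) * indicator {-R..R} (snd z) * indicator {-R..R} (fst z)"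
      for z :: "real \<times> real"
    have Gm [measurable]: "G \<in> borel_measurable ?N" unfolding G_def by measurable
    have Hm [measurable]: "(\<lambda>(z, x). H (fst z) x) \<in> borel_measurable (?N \<Otimes>\<^sub>M borel)"
      unfolding H_def by measurable
    interpret S: prob_space std_normal_distribution
      using real_dist_normal_dist by (simp add: real_distribution_def)
    have "ennreal (\<rho>0 u / 8) = ennreal (\<rho>0 u) * ennreal (1 / 8)"
      using \<rho>0[of u] by (simp add: ennreal_mult[symmetric])
    also have "\<dots> \<le> ennreal (\<rho>0 u) * (\<integral>\<^sup>+\<omega>. G (Y \<omega>) \<partial>M)"
      using sin_half_diff_lower_bound[OF ab l(2) R] by (intro mult_left_mono) (auto simp: G_def Y_def)
    also have "\<dots> = (\<integral>\<^sup>+z. ennreal (\<rho>0 u) * G z \<partial>distr M ?N Y)"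
      by (subst nn_integral_cmult) (auto simp: nn_integral_distr)
    also have "\<dots> \<le> (\<integral>\<^sup>+z. (\<integral>\<^sup>+x. H (fst z) x * G z \<partial>std_normal_distribution) \<partial>distr M ?N Y)"
    proof (intro nn_integral_mono)
      fix z :: "real \<times> real"
      have Hz: "(\<lambda>x. H (fst z) x) \<in> borel_measurable std_normal_distribution"
        unfolding H_def by measurable
      show "ennreal (\<rho>0 u) * G z \<le> (\<integral>\<^sup>+x. H (fst z) x * G z \<partial>std_normal_distribution)"
      proof (cases "fst z \<in> {-R..R}")
        case True
        then have "\<bar>fst z\<bar> \<le> R" by auto
        from gaussian_window_sin_squared[OF v l(1) this u, of c]
        have "ennreal (\<rho>0 u) \<le> (\<integral>\<^sup>+x. H (fst z) x \<partial>std_normal_distribution)"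
          by (simp add: \<rho>0_def H_def s_def)
        then show ?thesis using Hz by (subst nn_integral_multc) (auto intro: mult_right_mono)
      qed (simp add: G_def)
    qed
    also have "\<dots> = (\<integral>\<^sup>+zx. H (fst (fst zx)) (snd zx) * G (fst zx) \<partial>(distr M ?N Y \<Otimes>\<^sub>M std_normal_distribution))"
    proof -
      have "(\<lambda>zx. H (fst (fst zx)) (snd zx) * G (fst zx)) \<in> borel_measurable (distr M ?N Y \<Otimes>\<^sub>M std_normal_distribution)"
        using Hm unfolding case_prod_beta by measurable
      from S.nn_integral_fst[OF this] show ?thesis by simp
    qed
    also have "\<dots> = (\<integral>\<^sup>+\<omega>. H (fst (Y \<omega>)) (late_noise \<omega> / s) * G (Y \<omega>) \<partial>M)"
    proof -
      have "(\<lambda>zx. H (fst (fst zx)) (snd zx) * G (fst zx)) \<in> borel_measurable (?N \<Otimes>\<^sub>M borel)"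
        using Hm unfolding case_prod_beta by measurable
      then show ?thesis unfolding law[symmetric] by (subst nn_integral_distr) auto
    qed
    also have "\<dots> \<le> (\<integral>\<^sup>+\<omega>. ennreal ((sin (l * (W_noise \<omega> + ?D \<omega>) + c))\<^sup>2)
          * indicator {u..u + 1} (W_noise \<omega> + ?D \<omega>)
          * (ennreal ((sin (l * ?D \<omega>))\<^sup>2) * indicator {-R..R} (?D \<omega>)) \<partial>M)"
    proof (intro nn_integral_mono)
      fix \<omega> assume "\<omega> \<in> space M"
      then have e: "s * (late_noise \<omega> / s) + (early_noise \<omega> + ?D \<omega>) = W_noise \<omega> + ?D \<omega>"
        using s W_noise_split[of \<omega>] by simp
      show "H (fst (Y \<omega>)) (late_noise \<omega> / s) * G (Y \<omega>)
        \<le> ennreal ((sin (l * (W_noise \<omega> + ?D \<omega>) + c))\<^sup>2) * indicator {u..u + 1} (W_noise \<omega> + ?D \<omega>)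
          * (ennreal ((sin (l * ?D \<omega>))\<^sup>2) * indicator {-R..R} (?D \<omega>))"
        unfolding H_def G_def Y_def fst_conv snd_conv e
        by (intro mult_left_mono) (auto simp: indicator_def)
    qed
    finally show "ennreal (\<rho>0 u / 8) \<le> (\<integral>\<^sup>+\<omega>. ennreal ((sin (l * (W_noise \<omega> + ?D \<omega>) + c))\<^sup>2)
          * indicator {u..u + 1} (W_noise \<omega> + ?D \<omega>)
          * (ennreal ((sin (l * ?D \<omega>))\<^sup>2) * indicator {-R..R} (?D \<omega>)) \<partial>M)" .
  qed
qed

lemma observed_path_measurable:
  assumes abT: "0 \<le> a" "a < b" "b \<le> T"
  defines "K \<equiv> {0..a} \<union> {b..T}"
  shows "(\<lambda>\<omega>. \<lambda>s\<in>K. W s \<omega>) \<in> measurable M (C_borel K)"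
proof (rule path_measurable_C_borel)
  show "compact K" unfolding K_def by (intro compact_Un compact_Icc)
  show "countable (grid_points a b T \<inter> K)" using countable_grid_points by (rule countable_Int1)
  show "grid_points a b T \<inter> K \<subseteq> K" by simp
  show "K \<subseteq> closure (grid_points a b T \<inter> K)" unfolding K_def by (rule grid_points_dense[OF abT])
  show "continuous_on K (\<lambda>s. W s \<omega>)" if "\<omega> \<in> space M" for \<omega>
    using W_continuous[OF that] by (rule continuous_on_subset) (use abT in \<open>auto simp: K_def\<close>)
  show "W s \<in> borel_measurable M" if "s \<in> grid_points a b T \<inter> K" for s
    using that abT by (intro W_measurable) (auto simp: K_def)
qed

text \<open>
  Both noises are the same measurable functional \<open>\<Psi>\<close> of the values of the respective path at the
  grid points. The observed path is determined by its values at the grid points in \<open>K\<close>, where the two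
  paths agree. So the claim reduces to the equality of the laws on the grid points.
\<close>
lemma swap_joint_law:
  assumes ab: "0 \<le> a" "a < b" "b \<le> \<tau>"
  defines "K \<equiv> {0..a} \<union> {b..T}"
  defines "V \<equiv> \<lambda>\<omega>. \<lambda>s\<in>K. W s \<omega>"
  shows "distr M (borel \<Otimes>\<^sub>M C_borel K) (\<lambda>\<omega>. (W_noise \<omega>, V \<omega>))
    = distr M (borel \<Otimes>\<^sub>M C_borel K) (\<lambda>\<omega>. (swapped_noise a b \<omega>, V \<omega>))"
    (is "distr M ?Q ?A = distr M ?Q ?B")
proof -
  have abT: "0 \<le> a" "a < b" "b \<le> T" using ab \<tau>s by auto
  have Vm [measurable]: "V \<in> measurable M (C_borel K)"
    unfolding V_def K_def by (rule observed_path_measurable[OF abT])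
  have Sm [measurable]: "swapped_noise a b \<in> borel_measurable M" by (rule swapped_noise_M[OF ab])
  have Am: "?A \<in> measurable M ?Q" and Bm: "?B \<in> measurable M ?Q" by measurable
  let ?D = "grid_points a b T"
  let ?P = "PiM ?D (\<lambda>_. borel :: real measure)"
  let ?X = "\<lambda>\<omega>. \<lambda>s\<in>?D. W s \<omega>" and ?Y = "\<lambda>\<omega>. \<lambda>s\<in>?D. swap_path a b (\<lambda>s. W s \<omega>) s"
  have law: "distr M ?P ?X = distr M ?P ?Y" by (rule swap_law[OF abT])
  have D0T: "?D \<subseteq> {0..T}" by (rule grid_points_subset[OF abT])
  have in_D: "grid a b T (2 ^ N) i \<in> ?D" if "i \<le> 4 * 2 ^ N" for N i
    unfolding grid_points_def using that by (intro UN_I[of N] imageI) auto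
  define \<Psi> where "\<Psi> x = lim (\<lambda>N. \<Sum>i<4 * 2 ^ N. f (grid a b T (2 ^ N) i) *
    (x (grid a b T (2 ^ N) (Suc i)) - x (grid a b T (2 ^ N) i)))" for x
  have \<Psi>m [measurable]: "\<Psi> \<in> borel_measurable ?P"
    unfolding \<Psi>_def
    by (intro borel_measurable_lim_metric borel_measurable_sum borel_measurable_times
        borel_measurable_diff measurable_component_singleton in_D) auto
  have restr: "(\<Sum>i<4 * 2 ^ N. f (grid a b T (2 ^ N) i) *
      (restrict w ?D (grid a b T (2 ^ N) (Suc i)) - restrict w ?D (grid a b T (2 ^ N) i)))
    = (\<Sum>i<4 * 2 ^ N. f (grid a b T (2 ^ N) i) * (w (grid a b T (2 ^ N) (Suc i)) - w (grid a b T (2 ^ N) i)))" for w N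
    using in_D by (intro sum.cong refl) (simp add: Suc_le_eq)
  have \<Psi>X: "\<Psi> (?X \<omega>) = W_noise \<omega>" if "\<omega> \<in> space M" for \<omega>
    unfolding \<Psi>_def restr using W_noise_sums[OF abT that] by (rule limI)
  have \<Psi>Y: "\<Psi> (?Y \<omega>) = swapped_noise a b \<omega>" if "\<omega> \<in> space M" for \<omega>
    unfolding \<Psi>_def restr using swapped_noise_sums[OF abT that] by (rule limI)
  have Xm: "?X \<in> measurable M ?P"
    by (rule measurable_restrict) (use D0T in \<open>auto intro!: W_measurable\<close>)
  have Ym: "?Y \<in> measurable M ?P" by (rule swap_path_measurable[OF abT])
  let ?E = "{S \<times> A |S A. S \<in> sets (borel :: real measure) \<and> A \<in> sets (C_borel K)}"
  show ?thesis
  proof (rule measure_eqI_generator_eq[where E = ?E and \<Omega> = "space borel \<times> space (C_borel K)"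
        and A = "\<lambda>_. space borel \<times> space (C_borel K)"])
    show "Int_stable ?E" by (rule Int_stable_pair_measure_generator)
    show "?E \<subseteq> Pow (space borel \<times> space (C_borel K))" by (rule pair_measure_closed)
    show "sets (distr M ?Q ?A) = sigma_sets (space borel \<times> space (C_borel K)) ?E"
      "sets (distr M ?Q ?B) = sigma_sets (space borel \<times> space (C_borel K)) ?E"
      by (simp_all only: sets_distr sets_pair_measure)
    show "range (\<lambda>_::nat. space borel \<times> space (C_borel K)) \<subseteq> ?E" by blast
    show "(\<Union>i::nat. space borel \<times> space (C_borel K)) = space borel \<times> space (C_borel K)" by simp
    interpret A: prob_space "distr M ?Q ?A" by (rule prob_space_distr[OF Am])
    show "emeasure (distr M ?Q ?A) (space borel \<times> space (C_borel K)) \<noteq> \<infinity>" by simp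
    fix Z assume "Z \<in> ?E"
    then obtain S A where Z: "Z = S \<times> A" "S \<in> sets borel" "A \<in> sets (C_borel K)" by blast
    obtain C where C: "C \<in> sets (PiM (?D \<inter> K) (\<lambda>_. borel :: real measure))"
      "A = {v \<in> C_space K. restrict v (?D \<inter> K) \<in> C}"
    proof (rule C_borel_cylinder[OF _ _ _ _ Z(3), of "?D \<inter> K"])
      show "compact K" unfolding K_def by (intro compact_Un compact_Icc)
      show "countable (?D \<inter> K)" using countable_grid_points by (rule countable_Int1)
      show "K \<subseteq> closure (?D \<inter> K)" unfolding K_def by (rule grid_points_dense[OF abT])
    qed auto
    have rm: "(\<lambda>x. restrict x (?D \<inter> K)) \<in> measurable ?P (PiM (?D \<inter> K) (\<lambda>_. borel))"
      by (rule measurable_restrict_subset) simp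
    define U where "U = (\<Psi> -` S \<inter> space ?P) \<inter> ((\<lambda>x. restrict x (?D \<inter> K)) -` C \<inter> space ?P)"
    have U: "U \<in> sets ?P"
      unfolding U_def by (intro sets.Int measurable_sets[OF \<Psi>m Z(2)] measurable_sets[OF rm C(1)])
    have Zs: "Z \<in> sets ?Q" unfolding Z(1) by (intro pair_measureI Z)
    have VA: "V \<omega> \<in> A \<longleftrightarrow> restrict (V \<omega>) (?D \<inter> K) \<in> C" if "\<omega> \<in> space M" for \<omega>
    proof -
      have "V \<omega> \<in> C_space K" using measurable_space[OF Vm that] unfolding space_C_borel .
      then show ?thesis unfolding C(2) mem_Collect_eq by (simp only: simp_thms)
    qed
    have rX: "restrict (V \<omega>) (?D \<inter> K) = restrict (?X \<omega>) (?D \<inter> K)" for \<omega>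
      by (auto simp: V_def restrict_def fun_eq_iff)
    have rY: "restrict (V \<omega>) (?D \<inter> K) = restrict (?Y \<omega>) (?D \<inter> K)" for \<omega>
      by (auto simp: V_def K_def restrict_def fun_eq_iff swap_path_def)
    have X: "?A -` Z \<inter> space M = ?X -` U \<inter> space M"
    proof -
      have "?A \<omega> \<in> Z \<longleftrightarrow> ?X \<omega> \<in> U" if "\<omega> \<in> space M" for \<omega>
        unfolding Z(1) U_def mem_Times_iff fst_conv snd_conv VA[OF that] rX Int_iff vimage_eq \<Psi>X[OF that]
        using measurable_space[OF Xm that] by blast
      then show ?thesis by blast
    qed
    have Y: "?B -` Z \<inter> space M = ?Y -` U \<inter> space M"
    proof -
      have "?B \<omega> \<in> Z \<longleftrightarrow> ?Y \<omega> \<in> U" if "\<omega> \<in> space M" for \<omega>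
        unfolding Z(1) U_def mem_Times_iff fst_conv snd_conv VA[OF that] rY Int_iff vimage_eq \<Psi>Y[OF that]
        using measurable_space[OF Ym that] by blast
      then show ?thesis by blast
    qed
    show "emeasure (distr M ?Q ?A) Z = emeasure (distr M ?Q ?B) Z"
      unfolding emeasure_distr[OF Am Zs] emeasure_distr[OF Bm Zs] X Y
        emeasure_distr[OF Xm U, symmetric] emeasure_distr[OF Ym U, symmetric] law ..
  qed
qed

text \<open>
  By the joint law, a predictor errs as much on the noise of the exchanged path as on the original
  one. The triangle inequality does the rest.
\<close>
lemma swap_prediction_error:
  assumes ab: "0 \<le> a" "a < b" "b \<le> \<tau>"
    and k [measurable]: "k \<in> borel_measurable borel"
  defines "K \<equiv> {0..a} \<union> {b..T}"
  assumes u [measurable]: "u \<in> borel_measurable (C_borel K)"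
  shows "(\<integral>\<^sup>+\<omega>. ennreal \<bar>k (W_noise \<omega>) - k (swapped_noise a b \<omega>)\<bar> \<partial>M)
    \<le> 2 * (\<integral>\<^sup>+\<omega>. ennreal \<bar>k (W_noise \<omega>) - u (\<lambda>s\<in>K. W s \<omega>)\<bar> \<partial>M)"
proof -
  define V where "V = (\<lambda>\<omega>. \<lambda>s\<in>K. W s \<omega>)"
  have abT: "0 \<le> a" "a < b" "b \<le> T" using ab \<tau>s by auto
  have Vm [measurable]: "V \<in> measurable M (C_borel K)"
    unfolding V_def K_def by (rule observed_path_measurable[OF abT])
  have Sm [measurable]: "swapped_noise a b \<in> borel_measurable M" by (rule swapped_noise_M[OF ab])
  let ?Q = "borel \<Otimes>\<^sub>M C_borel K"
  have em: "(\<lambda>x. ennreal \<bar>k (fst x) - u (snd x)\<bar>) \<in> borel_measurable ?Q" by measurable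
  have "(\<integral>\<^sup>+\<omega>. ennreal \<bar>k (swapped_noise a b \<omega>) - u (V \<omega>)\<bar> \<partial>M)
    = (\<integral>\<^sup>+x. ennreal \<bar>k (fst x) - u (snd x)\<bar> \<partial>distr M ?Q (\<lambda>\<omega>. (swapped_noise a b \<omega>, V \<omega>)))"
    using em by (subst nn_integral_distr) auto
  also have "\<dots> = (\<integral>\<^sup>+x. ennreal \<bar>k (fst x) - u (snd x)\<bar> \<partial>distr M ?Q (\<lambda>\<omega>. (W_noise \<omega>, V \<omega>)))"
    using swap_joint_law[OF ab] unfolding K_def V_def by simp
  also have "\<dots> = (\<integral>\<^sup>+\<omega>. ennreal \<bar>k (W_noise \<omega>) - u (V \<omega>)\<bar> \<partial>M)"
    using em by (subst nn_integral_distr) auto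
  finally have eq: "(\<integral>\<^sup>+\<omega>. ennreal \<bar>k (swapped_noise a b \<omega>) - u (V \<omega>)\<bar> \<partial>M)
    = (\<integral>\<^sup>+\<omega>. ennreal \<bar>k (W_noise \<omega>) - u (V \<omega>)\<bar> \<partial>M)" .
  have "(\<integral>\<^sup>+\<omega>. ennreal \<bar>k (W_noise \<omega>) - k (swapped_noise a b \<omega>)\<bar> \<partial>M)
    \<le> (\<integral>\<^sup>+\<omega>. ennreal \<bar>k (W_noise \<omega>) - u (V \<omega>)\<bar> + ennreal \<bar>k (swapped_noise a b \<omega>) - u (V \<omega>)\<bar> \<partial>M)"
    by (intro nn_integral_mono) (simp add: ennreal_plus[symmetric] ennreal_leI del: ennreal_plus)
  also have "\<dots> = (\<integral>\<^sup>+\<omega>. ennreal \<bar>k (W_noise \<omega>) - u (V \<omega>)\<bar> \<partial>M)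
      + (\<integral>\<^sup>+\<omega>. ennreal \<bar>k (swapped_noise a b \<omega>) - u (V \<omega>)\<bar> \<partial>M)"
    by (rule nn_integral_add) measurable
  also have "\<dots> = 2 * (\<integral>\<^sup>+\<omega>. ennreal \<bar>k (W_noise \<omega>) - u (V \<omega>)\<bar> \<partial>M)"
    unfolding eq by (simp add: mult_2)
  finally show ?thesis unfolding V_def .
qed

end

section \<open>The coupled equations\<close>

lemma (in prob_space) AE_if_prob_1:
  assumes "\<P>(\<omega> in M. P \<omega>) = 1"
  shows "AE \<omega> in M. P \<omega>"
proof -
  have "{\<omega> \<in> space M. P \<omega>} \<in> events"
    using assms measure_notin_sets[of "{\<omega> \<in> space M. P \<omega>}" M]
    by (cases "{\<omega> \<in> space M. P \<omega>} \<in> events") auto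
  from prob_Collect_eq_1[OF this] show ?thesis using assms by simp
qed

locale coupled_profile = noise_profile M T F W f f' \<tau> \<tau>1 B + speed_profile g \<tau>1 \<tau>2 T
  for M :: "'a measure" and T F W f f' \<tau> \<tau>1 B g \<tau>2
begin

text \<open>
  The second component is the identity up to \<open>\<tau>1\<close>, so the integrand of the first is the
  deterministic function \<open>f\<close>. This fixes the first component from \<open>\<tau>1\<close> on, and then the second
  one is a traveller with a frozen parameter.
\<close>
lemma coupled_identification:
  fixes Y1 Y2 :: "real \<Rightarrow> 'a \<Rightarrow> real"
  assumes \<psi>: "continuous_on UNIV \<psi>"
    and Y1: "continuous_adapted M T F Y1" and Y2: "continuous_adapted M T F Y2"
    and Y1_eq: "\<And>t. t \<in> {0..T} \<Longrightarrow>
      \<exists>I. has_ito_integral M F W t (\<lambda>s \<omega>. f (Y2 s \<omega>)) I \<and> \<P>(\<omega> in M. Y1 t \<omega> = I \<omega>) = 1"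
    and Y2_eq: "\<And>t. t \<in> {0..T} \<Longrightarrow>
      \<P>(\<omega> in M. Y2 t \<omega> = t + (LBINT s:{0..t}. g (Y2 s \<omega>) * (cos (\<psi> (Y1 s \<omega>)) + 1))) = 1"
  shows "AE \<omega> in M. Y2 T \<omega> = arrival (1 + cos (\<psi> (W_noise \<omega>)))"
proof -
  have Y1c: "continuous_on {0..T} (\<lambda>t. Y1 t \<omega>)" and Y2c: "continuous_on {0..T} (\<lambda>t. Y2 t \<omega>)"
    if "\<omega> \<in> space M" for \<omega>
    using Y1 Y2 that by (auto simp: continuous_adapted_def)
  define y where "y \<omega> s = cos (\<psi> (Y1 s \<omega>)) + 1" for \<omega> s
  define k where "k \<omega> s = g (Y2 s \<omega>) * y \<omega> s" for \<omega> s
  have yc: "continuous_on {0..T} (y \<omega>)" if "\<omega> \<in> space M" for \<omega>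
    unfolding y_def by (intro continuous_intros continuous_on_compose2[OF \<psi> Y1c[OF that]]) auto
  have y0: "0 \<le> y \<omega> s" for \<omega> s unfolding y_def using cos_ge_minus_one[of "\<psi> (Y1 s \<omega>)"] by linarith
  have kc: "continuous_on {0..T} (k \<omega>)" if "\<omega> \<in> space M" for \<omega>
    unfolding k_def
    by (intro continuous_intros yc[OF that] continuous_on_compose2[OF g_cont Y2c[OF that]]) auto
  have ki: "k \<omega> integrable_on {r..t}" if "\<omega> \<in> space M" "0 \<le> r" "t \<le> T" for \<omega> r t
    using that by (intro integrable_continuous_real continuous_on_subset[OF kc]) auto
  have lb: "(LBINT s:{0..t}. k \<omega> s) = integral {0..t} (k \<omega>)" if "\<omega> \<in> space M" "t \<le> T" for \<omega> t
  proof (rule set_borel_integral_eq_integral(2))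
    have "continuous_on {0..t} (k \<omega>)" using that by (intro continuous_on_subset[OF kc]) auto
    then show "set_integrable lborel {0..t} (k \<omega>)" by (rule borel_integrable_atLeastAtMost')
  qed
  have space: "AE \<omega> in M. \<omega> \<in> space M" by (rule AE_space)
  have cnt: "countable (\<rat> \<inter> {u<..<v} :: real set)" for u v using countable_rat by (rule countable_Int1)
  \<comment> \<open>the equation for \<open>Y2\<close> holds simultaneously at all times\<close>
  have "AE \<omega> in M. \<forall>t\<in>\<rat> \<inter> {0<..<T}. Y2 t \<omega> = t + (LBINT s:{0..t}. k \<omega> s)"
  proof (rule AE_ball_countable[THEN iffD2, OF cnt], rule ballI)
    fix t assume "t \<in> \<rat> \<inter> {0<..<T}"
    then show "AE \<omega> in M. Y2 t \<omega> = t + (LBINT s:{0..t}. k \<omega> s)"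
      unfolding k_def y_def by (intro AE_if_prob_1 Y2_eq) auto
  qed
  with space have eq: "AE \<omega> in M. \<forall>t\<in>{0..T}. Y2 t \<omega> = t + integral {0..t} (k \<omega>)"
  proof eventually_elim
    fix \<omega> assume \<omega>: "\<omega> \<in> space M" and eq: "\<forall>t\<in>\<rat> \<inter> {0<..<T}. Y2 t \<omega> = t + (LBINT s:{0..t}. k \<omega> s)"
    have cont: "continuous_on {0..T} (\<lambda>t. Y2 t \<omega> - (t + integral {0..t} (k \<omega>)))"
      using \<omega> by (intro continuous_intros Y2c indefinite_integral_continuous_1 ki) auto
    have "Y2 t \<omega> - (t + integral {0..t} (k \<omega>)) = 0" if "t \<in> {0..T}" for t
      by (rule zero_on_rationals_imp_zero[OF cont T_pos _ that]) (use eq lb[OF \<omega>] in auto)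
    then show "\<forall>t\<in>{0..T}. Y2 t \<omega> = t + integral {0..t} (k \<omega>)" by simp
  qed
  with space have start: "AE \<omega> in M. (\<forall>t\<in>{0..\<tau>1}. Y2 t \<omega> = t) \<and> (\<forall>t\<in>{\<tau>1..T}. \<tau>1 \<le> Y2 t \<omega>)"
  proof eventually_elim
    fix \<omega> assume \<omega>: "\<omega> \<in> space M" and eq: "\<forall>t\<in>{0..T}. Y2 t \<omega> = t + integral {0..t} (k \<omega>)"
    have kk: "k \<omega> = (\<lambda>s. g (Y2 s \<omega>) * y \<omega> s)" by (rule ext) (simp add: k_def)
    have eq': "Y2 t \<omega> = t + integral {0..t} (\<lambda>s. g (Y2 s \<omega>) * y \<omega> s)" if "t \<in> {0..T}" for t
      using eq that unfolding kk by blast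
    note P = path_starts_as_identity[where x = "\<lambda>t. Y2 t \<omega>", OF Y2c[OF \<omega>] yc[OF \<omega>] y0 eq']
    show "(\<forall>t\<in>{0..\<tau>1}. Y2 t \<omega> = t) \<and> (\<forall>t\<in>{\<tau>1..T}. \<tau>1 \<le> Y2 t \<omega>)"
      using P by blast
  qed
  then have fY2: "AE \<omega> in M. \<forall>s\<in>{0..T}. f (Y2 s \<omega>) = f s"
  proof eventually_elim
    fix \<omega> assume \<omega>: "(\<forall>t\<in>{0..\<tau>1}. Y2 t \<omega> = t) \<and> (\<forall>t\<in>{\<tau>1..T}. \<tau>1 \<le> Y2 t \<omega>)"
    show "\<forall>s\<in>{0..T}. f (Y2 s \<omega>) = f s"
    proof
      fix s assume "s \<in> {0..T}"
      then show "f (Y2 s \<omega>) = f s"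
        using \<omega> f_zero[of s] f_zero[of "Y2 s \<omega>"] by (cases "s \<le> \<tau>1") auto
    qed
  qed
  have "AE \<omega> in M. \<forall>t\<in>\<rat> \<inter> {\<tau>1<..<T}. Y1 t \<omega> = W_noise \<omega>"
  proof (rule AE_ball_countable[THEN iffD2, OF cnt], rule ballI)
    fix t assume "t \<in> \<rat> \<inter> {\<tau>1<..<T}"
    then have t: "\<tau>1 < t" "t < T" "t \<in> {0..T}" using \<tau>s by auto
    obtain I where I: "has_ito_integral M F W t (\<lambda>s \<omega>. f (Y2 s \<omega>)) I" "\<P>(\<omega> in M. Y1 t \<omega> = I \<omega>) = 1"
      using Y1_eq[OF t(3)] by blast
    have "AE \<omega> in M. I \<omega> = W_noise \<omega>"
    proof (rule ito_integral_deterministic[OF t(3) _ _ _ I(1), of f 2])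
      show "continuous_on UNIV f" by (rule DERIV_continuous_on[OF f_der_within])
      show "AE \<omega> in M. \<forall>s\<in>{0..t}. f (Y2 s \<omega>) = f s"
        using fY2 by eventually_elim (use t in auto)
      fix \<omega> assume \<omega>: "\<omega> \<in> space M"
      show "(\<lambda>N. \<Sum>i<Suc N. f (t * real i / real (Suc N)) *
          (W (t * real (Suc i) / real (Suc N)) \<omega> - W (t * real i / real (Suc N)) \<omega>)) \<longlonglongrightarrow> W_noise \<omega>"
        unfolding W_noise_def using t by (intro noise_uniform_sums W_continuous[OF \<omega>] W_0[OF \<omega>]) auto
    qed (use f_lipschitz in auto)
    with AE_if_prob_1[OF I(2)] show "AE \<omega> in M. Y1 t \<omega> = W_noise \<omega>" by eventually_elim simp
  qed
  with space have Y1J: "AE \<omega> in M. \<forall>t\<in>{\<tau>1..T}. Y1 t \<omega> = W_noise \<omega>"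
  proof eventually_elim
    fix \<omega> assume \<omega>: "\<omega> \<in> space M" and eq: "\<forall>t\<in>\<rat> \<inter> {\<tau>1<..<T}. Y1 t \<omega> = W_noise \<omega>"
    have cont: "continuous_on {\<tau>1..T} (\<lambda>t. Y1 t \<omega> - W_noise \<omega>)"
      using \<tau>s by (intro continuous_intros continuous_on_subset[OF Y1c[OF \<omega>]]) auto
    have "Y1 t \<omega> - W_noise \<omega> = 0" if "t \<in> {\<tau>1..T}" for t
      by (rule zero_on_rationals_imp_zero[OF cont \<tau>s(3) _ that]) (use eq in auto)
    then show "\<forall>t\<in>{\<tau>1..T}. Y1 t \<omega> = W_noise \<omega>" by simp
  qed
  from space eq start Y1J show ?thesis
  proof eventually_elim
    fix \<omega> assume \<omega>: "\<omega> \<in> space M" and eq: "\<forall>t\<in>{0..T}. Y2 t \<omega> = t + integral {0..t} (k \<omega>)"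
      and st: "(\<forall>t\<in>{0..\<tau>1}. Y2 t \<omega> = t) \<and> (\<forall>t\<in>{\<tau>1..T}. \<tau>1 \<le> Y2 t \<omega>)"
      and J: "\<forall>t\<in>{\<tau>1..T}. Y1 t \<omega> = W_noise \<omega>"
    let ?v = "1 + cos (\<psi> (W_noise \<omega>))"
    have Y2c': "continuous_on {\<tau>1..T} (\<lambda>t. Y2 t \<omega>)"
      using \<tau>s by (intro continuous_on_subset[OF Y2c[OF \<omega>]]) auto
    show "Y2 T \<omega> = arrival ?v"
    proof (rule path_arrival[OF Y2c'])
      show "0 \<le> ?v" using cos_ge_minus_one[of "\<psi> (W_noise \<omega>)"] by linarith
      show "\<tau>1 \<le> Y2 t \<omega>" if "t \<in> {\<tau>1..T}" for t using st that by blast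
      fix t assume t: "t \<in> {\<tau>1..T}"
      then have tT: "t \<in> {0..T}" "\<tau>1 \<in> {0..T}" "0 \<le> \<tau>1" "\<tau>1 \<le> t" "t \<le> T" using \<tau>s by auto
      have c: "continuous_on {\<tau>1..t} (\<lambda>s. g (Y2 s \<omega>) * ?v)"
        using tT by (intro continuous_intros continuous_on_compose2[OF g_cont continuous_on_subset[OF Y2c[OF \<omega>]]]) auto
      have "integral {\<tau>1..t} (\<lambda>s. 1 + g (Y2 s \<omega>) * ?v)
        = integral {\<tau>1..t} (\<lambda>s. 1) + integral {\<tau>1..t} (\<lambda>s. g (Y2 s \<omega>) * ?v)"
        using c by (intro Henstock_Kurzweil_Integration.integral_add integrable_continuous_real) auto
      also have "integral {\<tau>1..t} (\<lambda>s. g (Y2 s \<omega>) * ?v) = integral {\<tau>1..t} (k \<omega>)"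
        using J t by (intro Henstock_Kurzweil_Integration.integral_cong) (auto simp: k_def y_def)
      also have "integral {\<tau>1..t} (k \<omega>) = integral {0..t} (k \<omega>) - integral {0..\<tau>1} (k \<omega>)"
        using Henstock_Kurzweil_Integration.integral_combine[OF tT(3,4) ki[OF \<omega> order_refl tT(5)]] by simp
      also have "integral {0..\<tau>1} (k \<omega>) = 0"
        using bspec[OF eq tT(2)] st tT by auto
      finally show "Y2 t \<omega> = \<tau>1 + integral {\<tau>1..t} (\<lambda>s. 1 + g (Y2 s \<omega>) * ?v)"
        using bspec[OF eq tT(1)] tT by simp
    qed
  qed
qed

text \<open>
  On \<open>{0..2}\<close>, which contains the range of \<open>1 + cos\<close>, the function \<open>arrival\<close> is monotone. Clipping the
  argument to this interval extends the monotonicity to the whole line.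
\<close>
lemma arrival_measurable:
  assumes [measurable]: "\<psi> \<in> borel_measurable borel"
  shows "(\<lambda>x. arrival (1 + cos (\<psi> x))) \<in> borel_measurable borel"
proof -
  have "mono (\<lambda>v. arrival (max 0 (min 2 v)))"
  proof (rule monoI)
    fix v w :: real assume "v \<le> w"
    then have "4 * (T - \<tau>2) / 81 * (max 0 (min 2 w) - max 0 (min 2 v))
        \<le> arrival (max 0 (min 2 w)) - arrival (max 0 (min 2 v))"
      by (intro arrival_expansion) auto
    moreover have "0 \<le> 4 * (T - \<tau>2) / 81 * (max 0 (min 2 w) - max 0 (min 2 v))"
      using \<open>v \<le> w\<close> ad by (intro mult_nonneg_nonneg) auto
    ultimately show "arrival (max 0 (min 2 v)) \<le> arrival (max 0 (min 2 w))" by linarith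
  qed
  then have [measurable]: "(\<lambda>v. arrival (max 0 (min 2 v))) \<in> borel_measurable borel"
    by (rule borel_measurable_mono)
  have "(\<lambda>x. arrival (max 0 (min 2 (1 + cos (\<psi> x))))) \<in> borel_measurable borel"
    by measurable
  moreover have "max 0 (min 2 (1 + cos (\<psi> x))) = 1 + cos (\<psi> x)" for x
  proof -
    have "0 \<le> 1 + cos (\<psi> x)" "1 + cos (\<psi> x) \<le> 2"
      using cos_ge_minus_one[of "\<psi> x"] cos_le_one[of "\<psi> x"] by linarith+
    then show ?thesis by (simp only: min_absorb2 max_absorb2)
  qed
  ultimately show ?thesis by simp
qed

lemma arrival_cos_expansion:
  "4 * (T - \<tau>2) / 81 * \<bar>cos x - cos y\<bar> \<le> \<bar>arrival (1 + cos x) - arrival (1 + cos y)\<bar>"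
proof -
  have *: "4 * (T - \<tau>2) / 81 * \<bar>cos x - cos y\<bar> \<le> \<bar>arrival (1 + cos x) - arrival (1 + cos y)\<bar>"
    if "cos y \<le> cos x" for x y
  proof -
    have "4 * (T - \<tau>2) / 81 * ((1 + cos x) - (1 + cos y)) \<le> arrival (1 + cos x) - arrival (1 + cos y)"
      using that cos_ge_minus_one[of y] cos_le_one[of x] by (intro arrival_expansion) linarith+
    then have "4 * (T - \<tau>2) / 81 * \<bar>cos x - cos y\<bar> \<le> arrival (1 + cos x) - arrival (1 + cos y)"
      using that by simp
    then show ?thesis by (rule order_trans[OF _ abs_ge_self])
  qed
  show ?thesis
    using *[of x y] *[of y x] by (cases "cos y \<le> cos x") (auto simp: abs_minus_commute)
qed

text \<open>
  If \<open>S\<close> is in the unit window at \<open>u\<close> and \<open>\<bar>D\<bar>\<close> is at most \<open>R\<close>, then both noises \<open>S - D\<close> and \<open>S + D\<close>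
  lie where \<open>\<psi>\<close> is affine, and the difference of the cosines factors into two sines.
\<close>
lemma prediction_lower_bound:
  "\<exists>R \<rho>. 0 < R \<and> (\<forall>u. 0 < \<rho> u) \<and>
    (\<forall>\<psi> a b l c u (U :: (real \<Rightarrow> real) \<Rightarrow> real). \<psi> \<in> borel_measurable borel \<and> 0 \<le> a \<and> a < b \<and> b \<le> \<tau> \<and>
      2 \<le> l \<and> 1 \<le> l\<^sup>2 * ((b - a) / 2) ^ 3 \<and> R \<le> u \<and> (\<forall>x\<in>{u - R..u + 1 + R}. \<psi> x = l * x + c) \<and>
      U \<in> borel_measurable (C_borel ({0..a} \<union> {b..T})) \<longrightarrow>
      ennreal (\<rho> u) \<le> (\<integral>\<^sup>+\<omega>. ennreal \<bar>arrival (1 + cos (\<psi> (W_noise \<omega>)))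
        - U (\<lambda>s\<in>{0..a} \<union> {b..T}. W s \<omega>)\<bar> \<partial>M))"
proof -
  define \<kappa> where "\<kappa> = 4 * (T - \<tau>2) / 81"
  have \<kappa>: "0 < \<kappa>" using ad by (simp add: \<kappa>_def)
  from oscillation_lower_bound
  obtain R \<rho> where R: "0 < R" and \<rho>: "\<forall>u. 0 < \<rho> u" and low:
    "\<forall>a b l c u. 0 \<le> a \<and> a < b \<and> b \<le> \<tau> \<and> 2 \<le> l \<and> 1 \<le> l\<^sup>2 * ((b - a) / 2) ^ 3 \<and> R \<le> u \<longrightarrow>
      ennreal (\<rho> u) \<le> (\<integral>\<^sup>+\<omega>.
        ennreal ((sin (l * (W_noise \<omega> + noise_half_diff a b \<omega>) + c))\<^sup>2)
          * indicator {u..u + 1} (W_noise \<omega> + noise_half_diff a b \<omega>)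
          * (ennreal ((sin (l * noise_half_diff a b \<omega>))\<^sup>2)
              * indicator {-R..R} (noise_half_diff a b \<omega>)) \<partial>M)"
    by (elim exE conjE) (rule that)
  show ?thesis
  proof (intro exI[of _ R] exI[of _ "\<lambda>u. \<kappa> * \<rho> u"] conjI allI impI; (elim conjE)?)
    show "0 < R" "0 < \<kappa> * \<rho> u" for u using R \<rho> \<kappa> by auto
    fix \<psi> :: "real \<Rightarrow> real" and a b l c u :: real and U :: "(real \<Rightarrow> real) \<Rightarrow> real"
    assume \<psi> [measurable]: "\<psi> \<in> borel_measurable borel"
      and ab: "0 \<le> a" "a < b" "b \<le> \<tau>" and l: "2 \<le> l" "1 \<le> l\<^sup>2 * ((b - a) / 2) ^ 3" and u: "R \<le> u"
      and affine': "\<forall>x\<in>{u - R..u + 1 + R}. \<psi> x = l * x + c"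
      and U: "U \<in> borel_measurable (C_borel ({0..a} \<union> {b..T}))"
    note affine = bspec[OF affine']
    define k where "k x = arrival (1 + cos (\<psi> x))" for x
    have km: "k \<in> borel_measurable borel" unfolding k_def by (rule arrival_measurable[OF \<psi>])
    let ?D = "noise_half_diff a b"
    let ?h = "\<lambda>\<omega>. ennreal ((sin (l * (W_noise \<omega> + ?D \<omega>) + c))\<^sup>2) * indicator {u..u + 1} (W_noise \<omega> + ?D \<omega>)
          * (ennreal ((sin (l * ?D \<omega>))\<^sup>2) * indicator {-R..R} (?D \<omega>))"
    have Dm [measurable]: "?D \<in> borel_measurable M" by (rule noise_half_diff_M[OF ab])
    have "2 * ennreal (\<kappa> * \<rho> u) = ennreal (2 * \<kappa>) * ennreal (\<rho> u)"
      using \<kappa> spec[OF \<rho>, of u] by (simp add: ennreal_mult mult.assoc)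
    also have "\<dots> \<le> ennreal (2 * \<kappa>) * (\<integral>\<^sup>+\<omega>. ?h \<omega> \<partial>M)"
      by (intro mult_left_mono low[rule_format] conjI ab l u) simp
    also have "\<dots> = (\<integral>\<^sup>+\<omega>. ennreal (2 * \<kappa>) * ?h \<omega> \<partial>M)"
      by (rule nn_integral_cmult[symmetric]) measurable
    also have "\<dots> \<le> (\<integral>\<^sup>+\<omega>. ennreal \<bar>k (W_noise \<omega>) - k (swapped_noise a b \<omega>)\<bar> \<partial>M)"
    proof (intro nn_integral_mono)
      fix \<omega>
      define S where "S = W_noise \<omega> + ?D \<omega>"
      have J: "W_noise \<omega> = S - ?D \<omega>" "swapped_noise a b \<omega> = S + ?D \<omega>"
        by (simp_all add: S_def noise_half_diff_def field_simps)
      show "ennreal (2 * \<kappa>) * ?h \<omega> \<le> ennreal \<bar>k (W_noise \<omega>) - k (swapped_noise a b \<omega>)\<bar>"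
      proof (cases "S \<in> {u..u + 1} \<and> ?D \<omega> \<in> {-R..R}")
        case True
        then have w: "S - ?D \<omega> \<in> {u - R..u + 1 + R}" "S + ?D \<omega> \<in> {u - R..u + 1 + R}" by auto
        define p where "p = sin (l * S + c)"
        define q where "q = sin (l * ?D \<omega>)"
        have "cos (\<psi> (S - ?D \<omega>)) - cos (\<psi> (S + ?D \<omega>))
          = cos ((l * S + c) - l * ?D \<omega>) - cos ((l * S + c) + l * ?D \<omega>)"
          unfolding affine[OF w(1)] affine[OF w(2)] by (simp add: algebra_simps)
        also have "\<dots> = 2 * (p * q)" unfolding p_def q_def cos_diff cos_add by simp
        finally have cosd: "\<bar>cos (\<psi> (S - ?D \<omega>)) - cos (\<psi> (S + ?D \<omega>))\<bar> = 2 * (\<bar>p\<bar> * \<bar>q\<bar>)"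
          by (simp add: abs_mult)
        \<comment> \<open>squares of sines are easier to integrate than absolute values\<close>
        have "p\<^sup>2 \<le> \<bar>p\<bar>" "q\<^sup>2 \<le> \<bar>q\<bar>"
          using mult_left_le[of "\<bar>p\<bar>" "\<bar>p\<bar>"] mult_left_le[of "\<bar>q\<bar>" "\<bar>q\<bar>"]
          by (simp_all add: power2_eq_square p_def q_def)
        then have "p\<^sup>2 * q\<^sup>2 \<le> \<bar>p\<bar> * \<bar>q\<bar>" by (intro mult_mono) auto
        then have "2 * \<kappa> * (p\<^sup>2 * q\<^sup>2) \<le> \<kappa> * \<bar>cos (\<psi> (S - ?D \<omega>)) - cos (\<psi> (S + ?D \<omega>))\<bar>"
          unfolding cosd using \<kappa> by (simp add: mult.assoc)
        also have "\<dots> \<le> \<bar>k (S - ?D \<omega>) - k (S + ?D \<omega>)\<bar>"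
          unfolding \<kappa>_def k_def by (rule arrival_cos_expansion)
        finally have "2 * \<kappa> * (p\<^sup>2 * q\<^sup>2) \<le> \<bar>k (W_noise \<omega>) - k (swapped_noise a b \<omega>)\<bar>" unfolding J .
        moreover have "ennreal (2 * \<kappa>) * ?h \<omega> = ennreal (2 * \<kappa> * (p\<^sup>2 * q\<^sup>2))"
          using True \<kappa> unfolding S_def[symmetric] p_def[symmetric] q_def[symmetric]
          by (simp add: ennreal_mult)
        ultimately show ?thesis by (simp add: ennreal_leI)
      qed (auto simp: S_def)
    qed
    also have "\<dots> \<le> 2 * (\<integral>\<^sup>+\<omega>. ennreal \<bar>k (W_noise \<omega>) - U (\<lambda>s\<in>{0..a} \<union> {b..T}. W s \<omega>)\<bar> \<partial>M)"
      by (rule swap_prediction_error[OF ab km U])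
    finally show "ennreal (\<kappa> * \<rho> u) \<le> (\<integral>\<^sup>+\<omega>. ennreal \<bar>arrival (1 + cos (\<psi> (W_noise \<omega>)))
        - U (\<lambda>s\<in>{0..a} \<union> {b..T}. W s \<omega>)\<bar> \<partial>M)"
      unfolding k_def by (simp add: ennreal_mult_le_mult_iff)
  qed
qed

text \<open>
  A general continuous function need not vanish at \<open>0\<close>, whence the correction \<open>f 0 * w 0\<close> to the
  sums.
\<close>
lemma noise_measurable_C_borel: "noise \<in> borel_measurable (C_borel {0..T})"
proof (rule borel_measurable_LIMSEQ_metric)
  have T0: "0 \<le> T" using T_pos by simp
  let ?p = "\<lambda>N. uniform_grid 0 T (Suc N)"
  note g = uniform_grid[OF T0, of "Suc _"]
  fix N
  have "(\<lambda>w. w (?p N i)) \<in> borel_measurable (C_borel {0..T})" if "i \<le> Suc N" for i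
    using g that by (intro eval_C_borel) auto
  moreover have "(\<lambda>w. w 0) \<in> borel_measurable (C_borel {0..T})" using T0 by (intro eval_C_borel) auto
  ultimately show "(\<lambda>w. (\<Sum>i<Suc N. f (?p N i) * (w (?p N (Suc i)) - w (?p N i))) + f 0 * w 0)
      \<in> borel_measurable (C_borel {0..T})"
    by (intro borel_measurable_add borel_measurable_sum borel_measurable_times borel_measurable_diff
        borel_measurable_const) auto
next
  have T0: "0 \<le> T" using T_pos by simp
  let ?p = "\<lambda>N. uniform_grid 0 T (Suc N)"
  fix w assume "w \<in> space (C_borel {0..T})"
  then have w: "continuous_on {0..T} w" unfolding space_C_borel C_space_eq[OF compact_Icc] by simp
  have "(\<lambda>N. \<Sum>i<Suc N. f (?p N i) * (w (?p N (Suc i)) - w (?p N i)))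
    \<longlonglongrightarrow> f T * w T - f 0 * w 0 - integral {0..T} (\<lambda>s. f' s * w s)"
  proof (rule stieltjes_sums_tendsto[OF T0 w, where d = "\<lambda>N. T / real (Suc N)"])
    show "(\<lambda>N. T / real (Suc N)) \<longlonglongrightarrow> 0" by (rule LIMSEQ_Suc[OF lim_const_over_n])
  qed (use uniform_grid[OF T0] f_der_within f'_cont_on in auto)
  from tendsto_add[OF this tendsto_const[of "f 0 * w 0"]]
  show "(\<lambda>N. (\<Sum>i<Suc N. f (?p N i) * (w (?p N (Suc i)) - w (?p N i))) + f 0 * w 0) \<longlonglongrightarrow> noise w"
    using f_zero[of T] \<tau>s by (simp add: noise_def)
qed

lemma noise_restrict: "noise (restrict w {0..T}) = noise w"
  unfolding noise_def
  by (intro arg_cong[where f = uminus] Henstock_Kurzweil_Integration.integral_cong) auto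

end

section \<open>Arbitrarily slow convergence\<close>

theorem corollary3p18:
  fixes T \<tau> \<tau>1 \<tau>2 \<alpha> :: real
    and f g :: "real \<Rightarrow> real"
    and M :: "'a measure"
    and F :: "real \<Rightarrow> 'a measure"
    and W :: "real \<Rightarrow> 'a \<Rightarrow> real"
    and X1 X2 :: "(real \<Rightarrow> real) \<Rightarrow> real \<Rightarrow> 'a \<Rightarrow> real"
    and \<epsilon> \<delta> :: "nat \<Rightarrow> real"
  assumes T: "T \<in> {0<..}"
    and \<tau>: "\<tau> \<in> {0<..<T}"
    and \<tau>1: "\<tau>1 \<in> {\<tau><..<T}"
    and \<tau>2: "\<tau>2 \<in> {\<tau>1<..<T}"
    and \<alpha>: "\<alpha> \<in> {2 * \<tau> ^ 3 / 3..}"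
    and smooth_f: "smooth f" and smooth_g: "smooth g"
    and bounded: "bdd_above (range (\<lambda>x. \<bar>f x\<bar> + \<bar>g x\<bar>))"
    and f_pos: "f ` {..<\<tau>1} \<subseteq> {0<..}"
    and f_zero: "f ` {\<tau>1..} = {0}"
    and f'_bounds: "range (deriv f) \<subseteq> {-2..0}"
    and f'_initial: "deriv f ` {0<..<\<tau>} \<subseteq> {-2..<-1}"
    and g_zero: "g ` {..\<tau>1} = {0}"
    and g_four: "g ` {\<tau>2..} = {4}"
    and g'_nonneg: "range (deriv g) \<subseteq> {0..}"
    and \<alpha>_eq: "\<alpha> = (LBINT s:{0..\<tau>1}. \<bar>f s\<bar>\<^sup>2)"
    and M: "prob_space M"
    and F: "normal_filtration M T F"
    and W: "standard_brownian_motion M T F W"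
    and X1: "\<And>\<psi>. smooth \<psi> \<Longrightarrow> continuous_adapted M T F (X1 \<psi>)"
    and X2: "\<And>\<psi>. smooth \<psi> \<Longrightarrow> continuous_adapted M T F (X2 \<psi>)"
    and X1_eq: "\<And>\<psi> t. smooth \<psi> \<Longrightarrow> t \<in> {0..T} \<Longrightarrow>
      \<exists>I. has_ito_integral M F W t (\<lambda>s \<omega>. f (X2 \<psi> s \<omega>)) I \<and>
          \<P>(\<omega> in M. X1 \<psi> t \<omega> = I \<omega>) = 1"
    and X2_eq: "\<And>\<psi> t. smooth \<psi> \<Longrightarrow> t \<in> {0..T} \<Longrightarrow>
      \<P>(\<omega> in M. X2 \<psi> t \<omega> =
        t + (LBINT s:{0..t}. g (X2 \<psi> s \<omega>) * (cos (\<psi> (X1 \<psi> s \<omega>)) + 1))) = 1"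
    and \<epsilon>: "\<And>n. n \<ge> 1 \<Longrightarrow> \<epsilon> n \<in> {0<..\<tau>}"
    and \<delta>: "limsup (\<lambda>n. ereal (\<delta> n)) \<le> 0"
  shows "\<exists>\<psi> c \<Phi> Z.
    smooth \<psi> \<and> c \<in> {0<..} \<and> \<Phi> \<in> borel_measurable (C_borel {0..T}) \<and>
    continuous_adapted M T F Z \<and>
    (\<forall>n\<ge>1. \<forall>t\<in>{0..T}.
      \<P>(\<omega> in M. Z T \<omega> = \<Phi> (\<lambda>s\<in>{0..T}. W s \<omega>)) = 1 \<and>
      (\<exists>I. has_ito_integral M F W t (\<lambda>s \<omega>. f (Z s \<omega> / c)) I \<and>
           \<P>(\<omega> in M. X1 \<psi> t \<omega> = I \<omega>) = 1) \<and>
      \<P>(\<omega> in M. Z t \<omega> =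
        (LBINT s:{0..t}. c + c * g (Z s \<omega> / c) * (cos (\<psi> (X1 \<psi> s \<omega>)) + 1))) = 1 \<and>
      enn2ereal
        (INF (a, b)\<in>{(a, b). a \<in> {0..\<tau>} \<and> b \<in> {0..\<tau>} \<and> b - a \<ge> \<epsilon> n}.
         INF u\<in>borel_measurable (C_borel ({0..a} \<union> {b..T})).
           \<integral>\<^sup>+\<omega>. ennreal \<bar>Z T \<omega> - u (\<lambda>s\<in>{0..a} \<union> {b..T}. W s \<omega>)\<bar> \<partial>M)
        \<ge> ereal (\<delta> n))"
proof -
  have T0: "0 < T" and ts: "0 < \<tau>" "\<tau> < \<tau>1" "\<tau>1 < \<tau>2" "\<tau>2 < T"
    using T \<tau> \<tau>1 \<tau>2 by auto
  obtain B where B: "\<And>x. \<bar>f x\<bar> + \<bar>g x\<bar> \<le> B"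
    using bounded unfolding bdd_above_def by auto
  have df: "(f has_real_derivative deriv f x) (at x)" for x using smooth_deriv[OF smooth_f, of 0] by simp
  have ddf: "(deriv f has_real_derivative deriv (deriv f) x) (at x)" for x
    using smooth_deriv[OF smooth_f, of 1] by simp
  have dg: "(g has_real_derivative deriv g x) (at x)" for x using smooth_deriv[OF smooth_g, of 0] by simp
  have g_low: "g x = 0" if "x \<le> \<tau>1" for x using g_zero that by blast
  have g_high: "g x = 4" if "\<tau>2 \<le> x" for x using g_four that by blast
  have g_mono: "g x \<le> g y" if "x \<le> y" for x y
    using that
  proof (rule DERIV_nonneg_imp_nondecreasing)
    fix z assume "x \<le> z" "z \<le> y"
    have "0 \<le> deriv g z" using g'_nonneg by auto
    then show "\<exists>l. (g has_real_derivative l) (at z) \<and> 0 \<le> l" using dg by blast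
  qed
  interpret prob_space M by (rule M)
  interpret coupled_profile M T F W f "deriv f" \<tau> \<tau>1 B g \<tau>2
  proof (unfold_locales)
    show "0 < T" "0 < \<tau>" "\<tau> < \<tau>1" "\<tau>1 < T" "0 < \<tau>1" "\<tau>1 < \<tau>2" "\<tau>2 < T" using T0 ts by auto
    show "normal_filtration M T F" "standard_brownian_motion M T F W" by (fact F, fact W)
    show "(f has_real_derivative deriv f x) (at x)" for x by (rule df)
    show "continuous_on UNIV (deriv f)"
      using ddf by (intro continuous_at_imp_continuous_on ballI) (blast intro: DERIV_isCont)
    show "- 2 \<le> deriv f x" "deriv f x \<le> 0" for x
      using subsetD[OF f'_bounds, of "deriv f x"] by auto
    show "deriv f x \<le> - 1" if "0 < x" "x < \<tau>" for x
    proof -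
      have "deriv f x \<in> {- 2..<- 1}" using f'_initial that by (intro subsetD[OF f'_initial] imageI) simp
      then show ?thesis by simp
    qed
    show "0 < f x" if "x < \<tau>1" for x
      using subsetD[OF f_pos, of "f x"] that by simp
    show "f x = 0" if "\<tau>1 \<le> x" for x using f_zero that by blast
    show "\<bar>f x\<bar> \<le> B" for x using B[of x] by linarith
    show "continuous_on UNIV g"
      using dg by (intro continuous_at_imp_continuous_on ballI) (blast intro: DERIV_isCont)
    show "0 \<le> g x" for x using g_mono[of "min x \<tau>1" x] g_low[of "min x \<tau>1"] by simp
    show "g x \<le> 4" for x using g_mono[of x "max x \<tau>2"] g_high[of "max x \<tau>2"] by simp
    show "g x = 0" if "x \<le> \<tau>1" for x by (rule g_low[OF that])
    show "g x = 4" if "\<tau>2 \<le> x" for x by (rule g_high[OF that])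
  qed
  from prediction_lower_bound
  obtain R \<rho> where R: "0 < R" and \<rho>: "\<forall>u. 0 < \<rho> u" and low:
    "\<forall>\<psi> a b l c u (U :: (real \<Rightarrow> real) \<Rightarrow> real). \<psi> \<in> borel_measurable borel \<and> 0 \<le> a \<and> a < b \<and> b \<le> \<tau> \<and>
      2 \<le> l \<and> 1 \<le> l\<^sup>2 * ((b - a) / 2) ^ 3 \<and> R \<le> u \<and> (\<forall>x\<in>{u - R..u + 1 + R}. \<psi> x = l * x + c) \<and>
      U \<in> borel_measurable (C_borel ({0..a} \<union> {b..T})) \<longrightarrow>
      ennreal (\<rho> u) \<le> (\<integral>\<^sup>+\<omega>. ennreal \<bar>arrival (1 + cos (\<psi> (W_noise \<omega>)))
        - U (\<lambda>s\<in>{0..a} \<union> {b..T}. W s \<omega>)\<bar> \<partial>M)"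
    by (elim exE conjE) (rule that)
  \<comment> \<open>each affine window has length \<open>2 * R + 1\<close>, and the unit interval at \<open>u k\<close> is its centre\<close>
  define L where "L = 2 * R + 1 + \<tau>2"
  define u where "u k = real k * L + \<tau>2 + R" for k
  \<comment> \<open>a slope of \<open>m n\<close> resolves gaps of length \<open>\<epsilon> n\<close>\<close>
  define m where "m n = sqrt (8 / \<epsilon> n ^ 3)" for n
  obtain c \<nu> where c: "0 < c" and \<nu>: "\<And>k. 2 \<le> \<nu> k"
    and scale: "\<And>n. \<exists>k. m n \<le> \<nu> k \<and> \<delta> n \<le> c * \<rho> (u k)"
    by (rule choose_scales[OF \<delta>, of "\<lambda>k. \<rho> (u k)" m]) (use \<rho> in auto)
  have \<nu>0: "0 \<le> \<nu> k" for k using \<nu>[of k] by simp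
  have L1: "1 \<le> L" using R ts by (simp add: L_def)
  have "\<exists>\<psi>. smooth \<psi> \<and>
      (\<forall>k. \<exists>l c. \<nu> k \<le> l \<and> (\<forall>x\<in>{real k * L + \<tau>2..real (Suc k) * L}. \<psi> x = l * x + c))"
    by (rule smooth_affine_pieces[where \<nu> = \<nu>, OF smooth_g g_low g_high less_trans[OF ts(1,2)] ts(3) L1 \<nu>0]) blast+
  then obtain \<psi> where \<psi>: "smooth \<psi>"
    and affine: "\<forall>k. \<exists>l c. \<nu> k \<le> l \<and> (\<forall>x\<in>{real k * L + \<tau>2..real (Suc k) * L}. \<psi> x = l * x + c)"
    by (elim exE conjE) (rule that)
  have \<psi>c: "continuous_on UNIV \<psi>"
    using smooth_deriv[OF \<psi>, of 0] by (intro continuous_at_imp_continuous_on ballI) (auto intro: DERIV_isCont)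
  then have \<psi>m: "\<psi> \<in> borel_measurable borel" by (rule borel_measurable_continuous_onI)
  let ?k = "\<lambda>x. arrival (1 + cos (\<psi> x))"
  define Z where "Z t \<omega> = c * X2 \<psi> t \<omega>" for t \<omega>
  define \<Phi> :: "(real \<Rightarrow> real) \<Rightarrow> real" where "\<Phi> w = c * ?k (noise w)" for w
  have Zc: "Z t \<omega> / c = X2 \<psi> t \<omega>" for t \<omega> using c by (simp add: Z_def)
  have \<Phi>m: "\<Phi> \<in> borel_measurable (C_borel {0..T})"
    unfolding \<Phi>_def
    using measurable_compose[OF noise_measurable_C_borel arrival_measurable[OF \<psi>m]] by simp
  have Zad: "continuous_adapted M T F Z"
    using X2[OF \<psi>] unfolding continuous_adapted_def Z_def by (auto intro!: continuous_intros)
  have id: "AE \<omega> in M. X2 \<psi> T \<omega> = ?k (W_noise \<omega>)"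
    by (rule coupled_identification[OF \<psi>c X1[OF \<psi>] X2[OF \<psi>] X1_eq[OF \<psi>] X2_eq[OF \<psi>]])
  have \<Phi>W: "\<Phi> (\<lambda>s\<in>{0..T}. W s \<omega>) = c * ?k (W_noise \<omega>)" for \<omega>
    unfolding \<Phi>_def noise_restrict W_noise_def ..
  have "T \<in> {0..T}" using T0 by simp
  then have ZTm: "Z T \<in> borel_measurable M"
    using Zad measurable_F_M[of "Z T" T] by (auto simp: continuous_adapted_def)
  have km: "(\<lambda>\<omega>. ?k (W_noise \<omega>)) \<in> borel_measurable M"
    using measurable_compose[OF W_noise_measurable arrival_measurable[OF \<psi>m]] .
  have P1: "\<P>(\<omega> in M. Z T \<omega> = \<Phi> (\<lambda>s\<in>{0..T}. W s \<omega>)) = 1"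
  proof -
    have "{\<omega> \<in> space M. Z T \<omega> = c * ?k (W_noise \<omega>)} \<in> sets M"
      using ZTm km by measurable
    moreover have "AE \<omega> in M. Z T \<omega> = c * ?k (W_noise \<omega>)"
      using id by eventually_elim (simp add: Z_def)
    ultimately show ?thesis unfolding \<Phi>W by (simp add: prob_Collect_eq_1)
  qed
  have P2: "\<exists>I. has_ito_integral M F W t (\<lambda>s \<omega>. f (Z s \<omega> / c)) I \<and> \<P>(\<omega> in M. X1 \<psi> t \<omega> = I \<omega>) = 1"
    if "t \<in> {0..T}" for t
    unfolding Zc by (rule X1_eq[OF \<psi> that])
  have P3: "\<P>(\<omega> in M. Z t \<omega> =
      (LBINT s:{0..t}. c + c * g (Z s \<omega> / c) * (cos (\<psi> (X1 \<psi> s \<omega>)) + 1))) = 1"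
    if t: "t \<in> {0..T}" for t
  proof -
    have "(LBINT s:{0..t}. c + c * g (X2 \<psi> s \<omega>) * (cos (\<psi> (X1 \<psi> s \<omega>)) + 1))
      = c * (t + (LBINT s:{0..t}. g (X2 \<psi> s \<omega>) * (cos (\<psi> (X1 \<psi> s \<omega>)) + 1)))"
      if \<omega>: "\<omega> \<in> space M" for \<omega>
    proof -
      have "continuous_on {0..t} (\<lambda>s. X1 \<psi> s \<omega>)" "continuous_on {0..t} (\<lambda>s. X2 \<psi> s \<omega>)"
        using X1[OF \<psi>] X2[OF \<psi>] \<omega> t unfolding continuous_adapted_def
        by (auto intro: continuous_on_subset)
      then have "continuous_on {0..t} (\<lambda>s. g (X2 \<psi> s \<omega>) * (cos (\<psi> (X1 \<psi> s \<omega>)) + 1))"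
        by (intro continuous_intros continuous_on_compose2[OF g_cont] continuous_on_compose2[OF \<psi>c]) auto
      then have i: "set_integrable lborel {0..t} (\<lambda>s. g (X2 \<psi> s \<omega>) * (cos (\<psi> (X1 \<psi> s \<omega>)) + 1))"
        by (rule borel_integrable_atLeastAtMost')
      have "set_integrable lborel {0..t} (\<lambda>s. c)" by (rule borel_integrable_atLeastAtMost') simp
      then have "(LBINT s:{0..t}. c + c * (g (X2 \<psi> s \<omega>) * (cos (\<psi> (X1 \<psi> s \<omega>)) + 1)))
        = (LBINT s:{0..t}. c) + (LBINT s:{0..t}. c * (g (X2 \<psi> s \<omega>) * (cos (\<psi> (X1 \<psi> s \<omega>)) + 1)))"
        using i by (intro set_integral_add) auto
      also have "(LBINT s:{0..t}. c) = c * t"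
        using t by (simp add: set_lebesgue_integral_def)
      also have "(LBINT s:{0..t}. c * (g (X2 \<psi> s \<omega>) * (cos (\<psi> (X1 \<psi> s \<omega>)) + 1)))
        = c * (LBINT s:{0..t}. g (X2 \<psi> s \<omega>) * (cos (\<psi> (X1 \<psi> s \<omega>)) + 1))"
        by (rule set_integral_mult_right)
      finally show ?thesis by (simp only: mult.assoc distrib_left[of c t])
    qed
    then have "{\<omega> \<in> space M. Z t \<omega> = (LBINT s:{0..t}. c + c * g (X2 \<psi> s \<omega>) * (cos (\<psi> (X1 \<psi> s \<omega>)) + 1))}
      = {\<omega> \<in> space M. X2 \<psi> t \<omega> = t + (LBINT s:{0..t}. g (X2 \<psi> s \<omega>) * (cos (\<psi> (X1 \<psi> s \<omega>)) + 1))}"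
      using c by (intro Collect_cong conj_cong refl) (simp add: Z_def)
    then show ?thesis unfolding Zc using X2_eq[OF \<psi> t] by simp
  qed
  have P4: "ereal (\<delta> n) \<le> enn2ereal
      (INF (a, b)\<in>{(a, b). a \<in> {0..\<tau>} \<and> b \<in> {0..\<tau>} \<and> b - a \<ge> \<epsilon> n}.
       INF U\<in>borel_measurable (C_borel ({0..a} \<union> {b..T})).
         \<integral>\<^sup>+\<omega>. ennreal \<bar>Z T \<omega> - U (\<lambda>s\<in>{0..a} \<union> {b..T}. W s \<omega>)\<bar> \<partial>M)"
    (is "_ \<le> enn2ereal ?inf") if n: "1 \<le> n" for n
  proof -
    have en: "0 < \<epsilon> n" "\<epsilon> n \<le> \<tau>" using \<epsilon>[OF n] by auto
    obtain k where k: "m n \<le> \<nu> k" "\<delta> n \<le> c * \<rho> (u k)" using scale[of n] by blast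
    obtain l \<theta> where l: "\<nu> k \<le> l" and aff: "\<forall>x\<in>{real k * L + \<tau>2..real (Suc k) * L}. \<psi> x = l * x + \<theta>"
      using spec[OF affine, of k] by (elim exE conjE) (rule that)
    have pos: "0 < c * \<rho> (u k)" using c \<rho> by simp
    have main: "ennreal (c * \<rho> (u k)) \<le> (\<integral>\<^sup>+\<omega>. ennreal \<bar>Z T \<omega> - U (\<lambda>s\<in>{0..a} \<union> {b..T}. W s \<omega>)\<bar> \<partial>M)"
      if ab: "a \<in> {0..\<tau>}" "b \<in> {0..\<tau>}" "b - a \<ge> \<epsilon> n"
        and U: "U \<in> borel_measurable (C_borel ({0..a} \<union> {b..T}))" for a b and U :: "(real \<Rightarrow> real) \<Rightarrow> real"
    proof -
      have ab': "0 \<le> a" "a < b" "b \<le> \<tau>" using ab en by auto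
      have res: "1 \<le> l\<^sup>2 * ((b - a) / 2) ^ 3"
      proof -
        have "0 \<le> m n" unfolding m_def using en by simp
        then have "(m n)\<^sup>2 \<le> l\<^sup>2" using k(1) l by (intro power_mono) auto
        moreover have "(m n)\<^sup>2 = 8 / \<epsilon> n ^ 3" unfolding m_def using en by simp
        moreover have "(\<epsilon> n / 2) ^ 3 \<le> ((b - a) / 2) ^ 3" using ab en by (intro power_mono) auto
        ultimately have "8 / \<epsilon> n ^ 3 * (\<epsilon> n / 2) ^ 3 \<le> l\<^sup>2 * ((b - a) / 2) ^ 3"
          using en by (intro mult_mono) auto
        moreover have "8 / \<epsilon> n ^ 3 * (\<epsilon> n / 2) ^ 3 = 1" using en by (simp add: power_divide)
        ultimately show ?thesis by simp
      qed
      have win: "\<forall>x\<in>{u k - R..u k + 1 + R}. \<psi> x = l * x + \<theta>"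
      proof
        fix x assume "x \<in> {u k - R..u k + 1 + R}"
        moreover have "real (Suc k) * L = u k + 1 + R" by (simp add: u_def L_def algebra_simps)
        ultimately have "x \<in> {real k * L + \<tau>2..real (Suc k) * L}" by (auto simp: u_def)
        then show "\<psi> x = l * x + \<theta>" by (rule bspec[OF aff])
      qed
      have Ru: "R \<le> u k" using ts L1 by (simp add: u_def)
      have l2: "2 \<le> l" using \<nu>[of k] l by linarith
      have Uc: "(\<lambda>x. U x / c) \<in> borel_measurable (C_borel ({0..a} \<union> {b..T}))" using U by simp
      from low[rule_format, OF conjI[OF \<psi>m conjI[OF ab'(1) conjI[OF ab'(2) conjI[OF ab'(3)
            conjI[OF l2 conjI[OF res conjI[OF Ru conjI[OF win Uc]]]]]]]]]
      have lb: "ennreal (\<rho> (u k)) \<le> (\<integral>\<^sup>+\<omega>. ennreal \<bar>?k (W_noise \<omega>)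
        - U (\<lambda>s\<in>{0..a} \<union> {b..T}. W s \<omega>) / c\<bar> \<partial>M)" .
      have Vm: "(\<lambda>\<omega>. U (\<lambda>s\<in>{0..a} \<union> {b..T}. W s \<omega>)) \<in> borel_measurable M"
        using measurable_compose[OF observed_path_measurable[OF ab'(1,2)] U] ab'(3) ts by simp
      have "ennreal (c * \<rho> (u k)) = ennreal c * ennreal (\<rho> (u k))" using c \<rho> by (simp add: ennreal_mult less_imp_le)
      also have "\<dots> \<le> ennreal c * (\<integral>\<^sup>+\<omega>. ennreal \<bar>?k (W_noise \<omega>) - U (\<lambda>s\<in>{0..a} \<union> {b..T}. W s \<omega>) / c\<bar> \<partial>M)"
        by (intro mult_left_mono lb) simp
      also have "\<dots> = (\<integral>\<^sup>+\<omega>. ennreal c * ennreal \<bar>?k (W_noise \<omega>) - U (\<lambda>s\<in>{0..a} \<union> {b..T}. W s \<omega>) / c\<bar> \<partial>M)"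
      proof (rule nn_integral_cmult[symmetric])
        have "(\<lambda>\<omega>. \<bar>?k (W_noise \<omega>) - U (\<lambda>s\<in>{0..a} \<union> {b..T}. W s \<omega>) / c\<bar>) \<in> borel_measurable M"
          by (intro borel_measurable_abs borel_measurable_diff borel_measurable_divide
              borel_measurable_const km Vm)
        then show "(\<lambda>\<omega>. ennreal \<bar>?k (W_noise \<omega>) - U (\<lambda>s\<in>{0..a} \<union> {b..T}. W s \<omega>) / c\<bar>) \<in> borel_measurable M"
          by (rule measurable_compose[OF _ measurable_ennreal])
      qed
      also have "\<dots> = (\<integral>\<^sup>+\<omega>. ennreal \<bar>Z T \<omega> - U (\<lambda>s\<in>{0..a} \<union> {b..T}. W s \<omega>)\<bar> \<partial>M)"
      proof (rule nn_integral_cong_AE)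
        have e: "ennreal c * ennreal \<bar>x - y / c\<bar> = ennreal \<bar>c * x - y\<bar>" for x y
        proof -
          have "\<bar>c * x - y\<bar> = c * \<bar>x - y / c\<bar>"
            using c abs_mult[of c "x - y / c"] by (simp add: right_diff_distrib)
          then show ?thesis using c by (simp add: ennreal_mult)
        qed
        show "AE \<omega> in M. ennreal c * ennreal \<bar>?k (W_noise \<omega>) - U (\<lambda>s\<in>{0..a} \<union> {b..T}. W s \<omega>) / c\<bar>
          = ennreal \<bar>Z T \<omega> - U (\<lambda>s\<in>{0..a} \<union> {b..T}. W s \<omega>)\<bar>"
          using id by eventually_elim (simp add: e Z_def)
      qed
      finally show ?thesis .
    qed
    have "ennreal (c * \<rho> (u k)) \<le> ?inf"
      by (rule INF_greatest) (auto intro!: INF_greatest main)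
    then have "enn2ereal (ennreal (c * \<rho> (u k))) \<le> enn2ereal ?inf"
      by (simp only: less_eq_ennreal.rep_eq)
    moreover have "ereal (\<delta> n) \<le> enn2ereal (ennreal (c * \<rho> (u k)))"
      using k(2) pos by (simp add: enn2ereal_ennreal)
    ultimately show ?thesis by (rule order_trans[rotated])
  qed
  show ?thesis
    by (rule exI[of _ \<psi>], rule exI[of _ c], rule exI[of _ \<Phi>], rule exI[of _ Z])
       (use \<psi> c \<Phi>m Zad P1 P2 P3 P4 in blast)
qed

end
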